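(* Let $\lambda$ be a partition and $T\in\mathcal{KN}(\lambda,n)$. For each length $\ell$ of a column of $T$, let $C_\ell$ be the rightmost column of any KN skew tableau $S$ which has the same number of columns of each length as $T$, whose rightmost column has length $\ell$, whose column reading is a frank word and which rectifies to $T$. Then the tableau $K_+(T)$ of shape $\lambda$ obtained from $T$ by replacing each column of length $\ell$ by $r(C_\ell)$ is a key tableau.
   Context: Fix $n\ge1$; $[\pm n]=\{1,\dots,n,\overline n,\dots,\overline 1\}$ ($\overline i=-i$) with order $1<\dots<n<\overline n<\dots<\overline 1$. A column is a strictly increasing (top to bottom) sequence in $[\pm n]$; it is admissible if whenever $i,\overline i\in C$, with $i$ in row $a$ from the top and $\overline i$ in row $b$ from the bottom, $a+b\le i$. For admissible $C$, let $z_1>\dots>z_r$ be the $z\in[n]$ with $z,\overline z\in C$; $t_1$ is the greatest $t\in[n]$ with $t<z_1$, $t,\overline t\notin C$, and $t_k$ ($k\ge2$) the greatest $t\in[n]$ with $t<\min(t_{k-1},z_k)$, $t,\overline t\notin C$. $rC$ is obtained by replacing each $\overline{z_k}$ by $\overline{t_k}$ and reordering; $\ell C$ by replacing each $z_k$ by $t_k$ and reordering. A KN skew tableau is a semistandard skew tableau (rows weakly, columns strictly increasing) with admissible columns such that replacing each column $C$ by $\ell C\,rC$ gives a semistandard skew tableau; $\mathcal{KN}(\lambda,n)$ is the set of those of partition shape $\lambda$. The column reading $cr(T)$ reads columns right to left, each top to bottom. Knuth equivalence $\sim$ is the congruence on words generated by: (K1) $\gamma\beta\alpha\sim\beta\gamma\alpha$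 if $\gamma<\alpha\le\beta$, $(\beta,\gamma)\ne(\overline x,x)$; (K2) $\alpha\beta\gamma\sim\alpha\gamma\beta$ if $\gamma\le\alpha<\beta$, $(\beta,\gamma)\ne(\overline x,x)$; (K3) $(y+1)\overline{y+1}\beta\sim\overline y y\beta$ if $y<\beta<\overline y$, $y\in[n-1]$; (K4) $\beta\overline y y\sim\beta(y+1)\overline{y+1}$ if $y<\beta<\overline y$, $y\in[n-1]$; (K5) $w\sim w\setminus\{z,\overline z\}$ if $w$ is a strictly increasing non-admissible word all of whose proper factors are admissible columns and $z$ is the least $z\in[n]$ with $z,\overline z\in w$ and more than $z$ letters of $w$ of absolute value $\le z$. Each word $w$ is Knuth equivalent to the reading of a unique KN tableau $P(w)$ of partition shape; $S$ rectifies to $T$ if $P(cr(S))=T$. The columns of a word are its maximal strictly increasing factors; $w$ is frank if the multiset of its column lengths equals the multiset of column lengths of $P(w)$. (Such skew tableaux $S$ exist, and $C_\ell$ depends only on $\ell$.) A key tableau is a KN tableau of partition shape in which the entry set of each column contains the entry set of the next column to its right, and no $i\in[n]$ has both $i$ and $\overline i$ occurring as entries. *)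

theory Defs
  imports Complex_Main "HOL-Library.Multiset" "HOL-Library.Sublist"
begin

section \<open>Letters, words and admissible columns\<close>

text \<open>
  \<open>Pos i\<close> is the letter $i$ and \<open>Bar i\<close> is $\overline{i} = -i$. The order is
  $1 < 2 < \dots < \overline{2} < \overline{1}$; for all $n$ at once, and restricted to
  $[\pm n]$ by means of \<open>letters n\<close>.
\<close>

datatype letter = Pos (labs: nat) | Bar (labs: nat)

fun bar :: "letter \<Rightarrow> letter" where
  "bar (Pos i) = Bar i"
| "bar (Bar i) = Pos i"

instantiation letter :: linorder
begin

fun less_letter :: "letter \<Rightarrow> letter \<Rightarrow> bool" where
  "less_letter (Pos i) (Pos j) = (i < j)"
| "less_letter (Pos i) (Bar j) = True"
| "less_letter (Bar i) (Pos j) = False"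
| "less_letter (Bar i) (Bar j) = (j < i)"

definition less_eq_letter :: "letter \<Rightarrow> letter \<Rightarrow> bool" where
  "less_eq_letter x y \<longleftrightarrow> x < y \<or> x = y"

instance
proof
  fix x y z :: letter
  show "x < y \<longleftrightarrow> x \<le> y \<and> \<not> y \<le> x"
    by (cases x; cases y) (auto simp: less_eq_letter_def)
  show "x \<le> x"
    by (simp add: less_eq_letter_def)
  show "x \<le> y \<Longrightarrow> y \<le> z \<Longrightarrow> x \<le> z"
    by (cases x; cases y; cases z) (auto simp: less_eq_letter_def)
  show "x \<le> y \<Longrightarrow> y \<le> x \<Longrightarrow> x = y"
    by (cases x; cases y) (auto simp: less_eq_letter_def)
  show "x \<le> y \<or> y \<le> x"
    by (cases x; cases y) (auto simp: less_eq_letter_def)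
qed

end

type_synonym word = "letter list"

definition letters :: "nat \<Rightarrow> letter set" where
  "letters n = Pos ` {1..n} \<union> Bar ` {1..n}"

definition words :: "nat \<Rightarrow> word set" where
  "words n = lists (letters n)"

definition column :: "nat \<Rightarrow> word \<Rightarrow> bool" where
  "column n C \<longleftrightarrow> C \<in> words n \<and> sorted_wrt (<) C"

text \<open>Row numbers start at 1, list indices at 0, hence the two successors.\<close>

definition admissible :: "nat \<Rightarrow> word \<Rightarrow> bool" where
  "admissible n C \<longleftrightarrow> column n C \<and>
     (\<forall>i a b. a < length C \<longrightarrow> b < length C \<longrightarrow> C ! a = Pos i \<longrightarrow> rev C ! b = Bar i
        \<longrightarrow> Suc a + Suc b \<le> i)"


section \<open>Left and right columns\<close>

text \<open>The decreasing list $z_1 > \dots > z_r$.\<close>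

definition paired :: "nat \<Rightarrow> word \<Rightarrow> nat list" where
  "paired n C = rev (sorted_list_of_set {z \<in> {1..n}. Pos z \<in> set C \<and> Bar z \<in> set C})"

text \<open>
  The argument \<open>b\<close> is $t_{k-1}$; for $k = 1$ there is no such bound, which the initial value
  \<open>n + 1\<close> encodes. For an admissible column each greatest element below exists; otherwise the
  value is irrelevant.
\<close>

primrec replacements_aux :: "nat \<Rightarrow> word \<Rightarrow> nat \<Rightarrow> nat list \<Rightarrow> nat list" where
  "replacements_aux n C b [] = []"
| "replacements_aux n C b (z # zs) =
     (let t = (GREATEST t. t \<in> {1..n} \<and> t < min b z \<and> Pos t \<notin> set C \<and> Bar t \<notin> set C)
      in t # replacements_aux n C t zs)"

definition replacements :: "nat \<Rightarrow> word \<Rightarrow> nat list" where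
  "replacements n C = replacements_aux n C (n + 1) (paired n C)"

definition right_col :: "nat \<Rightarrow> word \<Rightarrow> word" where
  "right_col n C = sorted_list_of_set
     ((set C - Bar ` set (paired n C)) \<union> Bar ` set (replacements n C))"

definition left_col :: "nat \<Rightarrow> word \<Rightarrow> word" where
  "left_col n C = sorted_list_of_set
     ((set C - Pos ` set (paired n C)) \<union> Pos ` set (replacements n C))"


section \<open>Skew tableaux\<close>

text \<open>
  A skew tableau of shape $\lambda/\mu$ is the list of its columns from left to right; the
  \<open>j\<close>-th one is \<open>(m, C)\<close>, where \<open>m\<close> is the \<open>j\<close>-th column length of $\mu$ (so that \<open>C\<close> occupies
  the rows \<open>m, \<dots>, m + length C - 1\<close>, counting rows from 0 at the top) and \<open>m + length C\<close> is the
  \<open>j\<close>-th column length of $\lambda$. Both sequences have to be weakly decreasing.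
\<close>

type_synonym skew_tableau = "(nat \<times> word) list"

definition skew_shape :: "skew_tableau \<Rightarrow> bool" where
  "skew_shape S \<longleftrightarrow> sorted_wrt (\<ge>) (map fst S)
     \<and> sorted_wrt (\<ge>) (map (\<lambda>(m, C). m + length C) S)"

definition rows_weak :: "skew_tableau \<Rightarrow> bool" where
  "rows_weak S \<longleftrightarrow> sorted_wrt
     (\<lambda>(m, C) (m', C'). \<forall>i. m \<le> i \<and> i < m + length C \<and> m' \<le> i \<and> i < m' + length C'
        \<longrightarrow> C ! (i - m) \<le> C' ! (i - m')) S"

definition semistandard :: "nat \<Rightarrow> skew_tableau \<Rightarrow> bool" where
  "semistandard n S \<longleftrightarrow> skew_shape S \<and> rows_weak S \<and> (\<forall>(m, C) \<in> set S. column n C)"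

definition split_tableau :: "nat \<Rightarrow> skew_tableau \<Rightarrow> skew_tableau" where
  "split_tableau n S = concat (map (\<lambda>(m, C). [(m, left_col n C), (m, right_col n C)]) S)"

definition KN_skew :: "nat \<Rightarrow> skew_tableau \<Rightarrow> bool" where
  "KN_skew n S \<longleftrightarrow> semistandard n S \<and> (\<forall>(m, C) \<in> set S. admissible n C)
     \<and> semistandard n (split_tableau n S)"

definition col_lengths :: "skew_tableau \<Rightarrow> nat list" where
  "col_lengths S = map (\<lambda>(m, C). length C) S"

text \<open>Partitions are given by the weakly decreasing list of their nonzero parts (row lengths).\<close>

definition is_partition :: "nat list \<Rightarrow> bool" where
  "is_partition lam \<longleftrightarrow> sorted_wrt (\<ge>) lam \<and> 0 \<notin> set lam"

definition conjugate :: "nat list \<Rightarrow> nat list" where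
  "conjugate lam = map (\<lambda>j. length (filter (\<lambda>p. j < p) lam)) [0..<Max (insert 0 (set lam))]"

definition KN :: "nat list \<Rightarrow> nat \<Rightarrow> skew_tableau set" where
  "KN lam n = {T. KN_skew n T \<and> (\<forall>(m, C) \<in> set T. m = 0) \<and> col_lengths T = conjugate lam}"

definition column_reading :: "skew_tableau \<Rightarrow> word" where
  "column_reading S = concat (rev (map snd S))"


section \<open>Knuth equivalence, rectification and frank words\<close>

definition contraction_letter :: "nat \<Rightarrow> word \<Rightarrow> nat" where
  "contraction_letter n w = (LEAST z. z \<in> {1..n} \<and> Pos z \<in> set w \<and> Bar z \<in> set w
     \<and> length (filter (\<lambda>x. labs x \<le> z) w) > z)"

inductive knuth_step :: "nat \<Rightarrow> word \<Rightarrow> word \<Rightarrow> bool" for n :: nat where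
  K1: "\<lbrakk>\<alpha> \<in> letters n; \<beta> \<in> letters n; \<gamma> \<in> letters n; \<gamma> < \<alpha>; \<alpha> \<le> \<beta>;
        \<nexists>x. \<beta> = bar x \<and> \<gamma> = x\<rbrakk>
       \<Longrightarrow> knuth_step n [\<gamma>, \<beta>, \<alpha>] [\<beta>, \<gamma>, \<alpha>]"
| K2: "\<lbrakk>\<alpha> \<in> letters n; \<beta> \<in> letters n; \<gamma> \<in> letters n; \<gamma> \<le> \<alpha>; \<alpha> < \<beta>;
        \<nexists>x. \<beta> = bar x \<and> \<gamma> = x\<rbrakk>
       \<Longrightarrow> knuth_step n [\<alpha>, \<beta>, \<gamma>] [\<alpha>, \<gamma>, \<beta>]"
| K3: "\<lbrakk>1 \<le> y; y < n; \<beta> \<in> letters n; Pos y < \<beta>; \<beta> < Bar y\<rbrakk>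
       \<Longrightarrow> knuth_step n [Pos (y + 1), Bar (y + 1), \<beta>] [Bar y, Pos y, \<beta>]"
| K4: "\<lbrakk>1 \<le> y; y < n; \<beta> \<in> letters n; Pos y < \<beta>; \<beta> < Bar y\<rbrakk>
       \<Longrightarrow> knuth_step n [\<beta>, Bar y, Pos y] [\<beta>, Pos (y + 1), Bar (y + 1)]"
| K5: "\<lbrakk>column n w; \<not> admissible n w; \<And>u. strict_sublist u w \<Longrightarrow> admissible n u;
        z = contraction_letter n w\<rbrakk>
       \<Longrightarrow> knuth_step n w (filter (\<lambda>x. x \<noteq> Pos z \<and> x \<noteq> Bar z) w)"

text \<open>The congruence generated by \<open>knuth_step\<close> on the words over $[\pm n]$.\<close>

inductive knuth :: "nat \<Rightarrow> word \<Rightarrow> word \<Rightarrow> bool" for n :: nat where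
  step: "knuth_step n u v \<Longrightarrow> knuth n u v"
| refl: "u \<in> words n \<Longrightarrow> knuth n u u"
| sym: "knuth n u v \<Longrightarrow> knuth n v u"
| trans: "knuth n u v \<Longrightarrow> knuth n v w \<Longrightarrow> knuth n u w"
| cong: "knuth n u v \<Longrightarrow> x \<in> words n \<Longrightarrow> y \<in> words n \<Longrightarrow> knuth n (x @ u @ y) (x @ v @ y)"

text \<open>
  \<open>is_P n w T\<close> says that \<open>T\<close> is the tableau $P(w)$, i.e. the (unique) KN tableau of partition
  shape whose column reading is Knuth equivalent to \<open>w\<close>.
\<close>

definition is_P :: "nat \<Rightarrow> word \<Rightarrow> skew_tableau \<Rightarrow> bool" where
  "is_P n w T \<longleftrightarrow> (\<exists>lam. is_partition lam \<and> T \<in> KN lam n) \<and> knuth n w (column_reading T)"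

definition rectifies_to :: "nat \<Rightarrow> skew_tableau \<Rightarrow> skew_tableau \<Rightarrow> bool" where
  "rectifies_to n S T \<longleftrightarrow> is_P n (column_reading S) T"

text \<open>The factorization of a word into its maximal strictly increasing factors.\<close>

fun word_columns :: "word \<Rightarrow> word list" where
  "word_columns [] = []"
| "word_columns [x] = [[x]]"
| "word_columns (x # y # w) =
     (let cs = word_columns (y # w)
      in if x < y then (x # hd cs) # tl cs else [x] # cs)"

lemma word_columns_Cons: "\<exists>u cs. word_columns (x # w) = (x # u) # cs"
  by (induction "x # w" arbitrary: x w rule: word_columns.induct) (auto simp: Let_def)

lemma concat_word_columns: "concat (word_columns w) = w"
proof (induction w rule: word_columns.induct)
  case (3 x y w)
  obtain u cs where "word_columns (y # w) = (y # u) # cs"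
    using word_columns_Cons by blast
  with 3 show ?case by (auto simp: Let_def)
qed auto

lemma word_columns_maximal_increasing:
  "(\<forall>u \<in> set (word_columns w). u \<noteq> [] \<and> sorted_wrt (<) u) \<and>
   successively (\<lambda>u v. \<not> last u < hd v) (word_columns w)"
proof (induction w rule: word_columns.induct)
  case (3 x y w)
  obtain u cs where cs: "word_columns (y # w) = (y # u) # cs"
    using word_columns_Cons by blast
  from 3 cs show ?case
    by (cases cs) (auto simp: Let_def)
qed auto

definition frank :: "nat \<Rightarrow> word \<Rightarrow> bool" where
  "frank n w \<longleftrightarrow> (\<exists>T. is_P n w T \<and> mset (map length (word_columns w)) = mset (col_lengths T))"


section \<open>Keys\<close>

definition key_tableau :: "nat list \<Rightarrow> nat \<Rightarrow> skew_tableau \<Rightarrow> bool" where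
  "key_tableau lam n K \<longleftrightarrow> is_partition lam \<and> K \<in> KN lam n
     \<and> (\<forall>j. Suc j < length K \<longrightarrow> set (snd (K ! Suc j)) \<subseteq> set (snd (K ! j)))
     \<and> (\<forall>i \<in> {1..n}. \<not> (Pos i \<in> set (column_reading K) \<and> Bar i \<in> set (column_reading K)))"

text \<open>
  \<open>C\<close> is the rightmost column, of length \<open>l\<close>, of some frank KN skew tableau that rectifies
  to \<open>T\<close> and has the same number of columns of each length as \<open>T\<close>. (If \<open>l\<close> is a column length
  of \<open>T\<close>, then \<open>S\<close> is nonempty, so that \<open>last S\<close> is meaningful.)
\<close>

definition frank_right_column :: "nat \<Rightarrow> skew_tableau \<Rightarrow> nat \<Rightarrow> word \<Rightarrow> bool" where
  "frank_right_column n T l C \<longleftrightarrow> (\<exists>S. KN_skew n S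
     \<and> (\<forall>k. count (mset (col_lengths S)) k = count (mset (col_lengths T)) k)
     \<and> length (snd (last S)) = l
     \<and> frank n (column_reading S)
     \<and> rectifies_to n S T
     \<and> C = snd (last S))"

text \<open>$K_+(T)$, for the family $C_\ell$ of columns.\<close>

definition K_plus :: "nat \<Rightarrow> (nat \<Rightarrow> word) \<Rightarrow> skew_tableau \<Rightarrow> skew_tableau" where
  "K_plus n C T = map (\<lambda>(m, D). (m, right_col n (C (length D)))) T"

end

theory Submission
  imports Defs
begin

text \<open>
  All Knuth relations commute with the crystal operators of type $C_n$ acting on words by the
  signature rule. On an admissible column \<open>C\<close> the operator $e_i$ corresponds to $e_i^2$ on the
  word \<open>rC lC\<close>, which yields that KN tableaux of partition shape are closed under the $e_i$, that
  their highest weight elements consist of columns $1 \cdots l$, and hence the same for the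
  columns of \<open>S\<close>. Since columns $1 \cdots l$ commute up to Knuth equivalence, after splitting all
  columns one finds, for two lengths $l > l'$, equivalent two-column words $A X \sim A' X'$ with
  $A = rC_l$ and $A' = rC_{l'}$. Raising both words to the highest weight element, where
  $A' \subseteq A$ holds, and tracking the reflections that act on \<open>A\<close> and \<open>A'\<close> shows that
  $rC_{l'} \subseteq rC_l$.
\<close>

section \<open>Signatures and crystal operators on words\<close>

text \<open>Splitting serves the nestedness argument. On a column without pairs the maximal power of
  \<open>up n i\<close> is either trivial or the simple reflection of the letters; on a column with
  pairs it need not be, and inclusions could not be followed. The columns \<open>rC\<close> and
  \<open>lC\<close> have no pairs, and \<open>rC\<close> of the rightmost column is the first factor
  of the doubled reading. Maximal raising acts on a first factor independently of what follows, so
  the first columns of two equivalent words can be followed on their own. The obstacle is that one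
  raising may reflect only one of the two first columns, namely when they have opposite signs at
  \<open>i\<close>. A word in which every applicable \<open>i\<close> does this is excluded by
  knowing its highest weight exactly, which is what \<open>full\<close> records. Highest weights are
  handled through the sums \<open>H\<close>, bounded on products of columns by \<open>cap\<close>; a
  product of columns that attains all bounds is \<open>hw ls\<close>.\<close>

definition sg :: "nat \<Rightarrow> letter \<Rightarrow> int" where
  "sg i x = (case x of
     Pos j \<Rightarrow> (if j = i then 1 else if j = Suc i then -1 else 0)
   | Bar j \<Rightarrow> (if j = i then -1 else if j = Suc i then 1 else 0))"

lemma sg_simps [simp]:
  "sg i (Pos j) = (if j = i then 1 else if j = Suc i then -1 else 0)"
  "sg i (Bar j) = (if j = i then -1 else if j = Suc i then 1 else 0)"
  by (simp_all add: sg_def)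

fun upl :: "nat \<Rightarrow> nat \<Rightarrow> letter \<Rightarrow> letter" where
  "upl n i (Pos j) = (if j = Suc i then Pos i else Pos j)"
| "upl n i (Bar j) = (if j = i then (if i = n then Pos n else Bar (Suc i)) else Bar j)"

fun dnl :: "nat \<Rightarrow> nat \<Rightarrow> letter \<Rightarrow> letter" where
  "dnl n i (Pos j) = (if j = i then (if i = n then Bar n else Pos (Suc i)) else Pos j)"
| "dnl n i (Bar j) = (if j = Suc i then Bar i else Bar j)"

text \<open>
  A letter of sign \<open>+1\<close> cancels with a later letter of sign \<open>-1\<close>; \<open>eps\<close> and \<open>phi\<close> count the
  uncancelled letters of sign \<open>-1\<close> and \<open>+1\<close>. The operators \<open>up\<close> and \<open>dn\<close> are Kashiwara's $e_i$
  and $f_i$; they are meaningful only if \<open>eps\<close>, respectively \<open>phi\<close>, is positive.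
\<close>

primrec eps :: "nat \<Rightarrow> word \<Rightarrow> nat" where
  "eps i [] = 0"
| "eps i (x # w) = (if sg i x = 1 then eps i w - 1
     else if sg i x = -1 then Suc (eps i w) else eps i w)"

primrec phi :: "nat \<Rightarrow> word \<Rightarrow> nat" where
  "phi i [] = 0"
| "phi i (x # w) = phi i w + (if sg i x = 1 \<and> eps i w = 0 then 1 else 0)"

primrec up :: "nat \<Rightarrow> nat \<Rightarrow> word \<Rightarrow> word" where
  "up n i [] = []"
| "up n i (x # w) = (if sg i x = -1 \<and> eps i w = 0 then upl n i x # w else x # up n i w)"

primrec dn :: "nat \<Rightarrow> nat \<Rightarrow> word \<Rightarrow> word" where
  "dn n i [] = []"
| "dn n i (x # w) = (if sg i x = 1 \<and> eps i w = 0 then dnl n i x # w else x # dn n i w)"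

text \<open>The tensor product rule: uncancelled letters of sign -1 in \<open>v\<close> cancel
  against uncancelled letters of sign +1 in \<open>u\<close>. Hence the place where an operator acts
  depends on a factor only through its \<open>eps\<close> and \<open>phi\<close>.\<close>

lemma eps_append: "eps i (u @ v) = eps i u + (eps i v - phi i u)"
  by (induction u) auto

lemma phi_append: "phi i (u @ v) = phi i v + (phi i u - eps i v)"
  by (induction u) (auto simp: eps_append)

lemma up_append_right: "eps i v > phi i u \<Longrightarrow> up n i (u @ v) = u @ up n i v"
  by (induction u) (auto simp: eps_append split: if_splits)

lemma up_append_left: "eps i v \<le> phi i u \<Longrightarrow> eps i u > 0 \<Longrightarrow> up n i (u @ v) = up n i u @ v"
proof (induction u)
  case (Cons x u)
  then show ?case by (cases "eps i u") (auto simp: eps_append split: if_splits)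
qed simp

lemma dn_append_left: "phi i u > eps i v \<Longrightarrow> dn n i (u @ v) = dn n i u @ v"
  by (induction u) (auto simp: eps_append split: if_splits)

lemma dn_append_right: "phi i u \<le> eps i v \<Longrightarrow> dn n i (u @ v) = u @ dn n i v"
  by (induction u) (auto simp: eps_append split: if_splits)

lemma length_up [simp]: "length (up n i w) = length w"
  by (induction w) auto

lemma length_dn [simp]: "length (dn n i w) = length w"
  by (induction w) auto

lemma letters_simps [simp]: "Pos j \<in> letters n \<longleftrightarrow> 1 \<le> j \<and> j \<le> n"
  "Bar j \<in> letters n \<longleftrightarrow> 1 \<le> j \<and> j \<le> n"
  by (auto simp: letters_def)

lemma words_simps [simp]: "[] \<in> words n" "x # w \<in> words n \<longleftrightarrow> x \<in> letters n \<and> w \<in> words n"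
  "u @ v \<in> words n \<longleftrightarrow> u \<in> words n \<and> v \<in> words n"
  by (auto simp: words_def)

lemma words_iff: "w \<in> words n \<longleftrightarrow> set w \<subseteq> letters n"
  by (auto simp: words_def)

lemma sg_cases: "sg i x = 1 \<or> sg i x = -1 \<or> sg i x = 0"
  by (cases x) auto

lemma upl_props:
  assumes "x \<in> letters n" "sg i x = -1" "1 \<le> i" "i \<le> n"
  shows "upl n i x \<in> letters n" "sg i (upl n i x) = 1" "dnl n i (upl n i x) = x" "upl n i x < x"
  using assms by (cases x; auto split: if_splits)+

lemma dnl_props:
  assumes "x \<in> letters n" "sg i x = 1" "1 \<le> i" "i \<le> n"
  shows "dnl n i x \<in> letters n" "sg i (dnl n i x) = -1" "upl n i (dnl n i x) = x"
  using assms by (cases x; auto split: if_splits)+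

text \<open>The operator turns the rightmost uncancelled -1 into a +1, which stays uncancelled, and
  leaves all other cancellations alone.\<close>

lemma up_props:
  assumes "w \<in> words n" "1 \<le> i" "i \<le> n" "eps i w > 0"
  shows "up n i w \<in> words n \<and> dn n i (up n i w) = w \<and> eps i (up n i w) = eps i w - 1
    \<and> phi i (up n i w) = Suc (phi i w)"
  using assms
proof (induction w)
  case (Cons x w)
  show ?case
  proof (cases "sg i x = -1 \<and> eps i w = 0")
    case True
    then show ?thesis using Cons.prems upl_props[of x n i] by auto
  next
    case False
    then show ?thesis using Cons sg_cases[of i x] by (auto split: if_splits)
  qed
qed simp

lemmas up_words = up_props[THEN conjunct1]
lemmas dn_up = up_props[THEN conjunct2, THEN conjunct1]
lemmas eps_up = up_props[THEN conjunct2, THEN conjunct2, THEN conjunct1]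
lemmas phi_up = up_props[THEN conjunct2, THEN conjunct2, THEN conjunct2]

lemma dn_props:
  assumes "w \<in> words n" "1 \<le> i" "i \<le> n" "phi i w > 0"
  shows "dn n i w \<in> words n \<and> up n i (dn n i w) = w \<and> eps i (dn n i w) = Suc (eps i w)
    \<and> phi i (dn n i w) = phi i w - 1"
  using assms
proof (induction w)
  case (Cons x w)
  show ?case
  proof (cases "sg i x = 1 \<and> eps i w = 0")
    case True
    then show ?thesis using Cons.prems dnl_props[of x n i] by auto
  next
    case False
    then show ?thesis using Cons sg_cases[of i x] by (auto split: if_splits)
  qed
qed simp

lemmas up_dn = dn_props[THEN conjunct2, THEN conjunct1]

lemma phi_eps_sg: "int (phi i w) - int (eps i w) = (\<Sum>x\<leftarrow>w. sg i x)"
proof (induction w)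
  case (Cons x w)
  then show ?case using sg_cases[of i x] by (cases "eps i w") auto
qed simp


section \<open>Duality\<close>

text \<open>Barring reverses the order and the signs of the letters, so the reversed barred word has
  \<open>eps\<close> exchanged with \<open>phi\<close> and \<open>up\<close> with \<open>dn\<close>.
  Through it, facts on \<open>dn\<close> for columns and for Knuth equivalence are obtained from
  those on \<open>up\<close>.\<close>

definition star :: "word \<Rightarrow> word" where
  "star w = rev (map bar w)"

lemma bar_bar [simp]: "bar (bar x) = x"
  by (cases x) auto

lemma bar_less [simp]: "bar x < bar y \<longleftrightarrow> y < x"
  by (cases x; cases y) auto

lemma bar_eq [simp]: "bar x = bar y \<longleftrightarrow> x = y"
  by (metis bar_bar)

lemma bar_le [simp]: "bar x \<le> bar y \<longleftrightarrow> y \<le> x"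
  by (auto simp: less_eq_letter_def)

lemma bar_letters [simp]: "bar x \<in> letters n \<longleftrightarrow> x \<in> letters n"
  by (cases x) auto

lemma labs_bar [simp]: "labs (bar x) = labs x"
  by (cases x) auto

lemma sg_bar [simp]: "sg i (bar x) = - sg i x"
  by (cases x) auto

lemma star_simps [simp]: "star [] = []" "star (x # w) = star w @ [bar x]"
  "star (u @ v) = star v @ star u" "star (star w) = w" "length (star w) = length w"
  "set (star w) = bar ` set w" "star w \<in> words n \<longleftrightarrow> w \<in> words n"
  by (auto simp: star_def rev_map words_iff comp_def)

lemma upl_bar: "sg i x = 1 \<Longrightarrow> upl n i (bar x) = bar (dnl n i x)"
  by (cases x) (auto split: if_splits)

lemma eps_phi_star: "eps i (star w) = phi i w \<and> phi i (star w) = eps i w"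
proof (induction w)
  case (Cons x w)
  then show ?case using sg_cases[of i x] by (auto simp: eps_append phi_append)
qed simp

lemmas eps_star = eps_phi_star[THEN conjunct1]
lemmas phi_star = eps_phi_star[THEN conjunct2]

lemma up_star: "phi i w > 0 \<Longrightarrow> up n i (star w) = star (dn n i w)"
proof (induction w)
  case (Cons x w)
  show ?case
  proof (cases "sg i x = 1 \<and> eps i w = 0")
    case True
    then show ?thesis
      by (auto simp: up_append_right phi_star upl_bar)
  next
    case False
    then have "phi i w > 0" using Cons.prems by (auto split: if_splits)
    with False Cons.IH show ?thesis
      using sg_cases[of i x] by (auto simp: up_append_left eps_star phi_star)
  qed
qed simp

section \<open>Invariance under Knuth equivalence\<close>

lemma knuth_K1: "\<lbrakk>\<alpha> \<in> letters n; \<beta> \<in> letters n; \<gamma> \<in> letters n; \<gamma> < \<alpha>; \<alpha> \<le> \<beta>; \<beta> \<noteq> bar \<gamma>\<rbrakk>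
       \<Longrightarrow> knuth n [\<gamma>, \<beta>, \<alpha>] [\<beta>, \<gamma>, \<alpha>]"
  by (intro knuth.step knuth_step.K1) auto

lemma knuth_K2: "\<lbrakk>\<alpha> \<in> letters n; \<beta> \<in> letters n; \<gamma> \<in> letters n; \<gamma> \<le> \<alpha>; \<alpha> < \<beta>; \<beta> \<noteq> bar \<gamma>\<rbrakk>
       \<Longrightarrow> knuth n [\<alpha>, \<beta>, \<gamma>] [\<alpha>, \<gamma>, \<beta>]"
  by (intro knuth.step knuth_step.K2) auto

lemma knuth_K3: "\<lbrakk>1 \<le> y; y < n; \<beta> \<in> letters n; Pos y < \<beta>; \<beta> < Bar y\<rbrakk>
       \<Longrightarrow> knuth n [Pos (Suc y), Bar (Suc y), \<beta>] [Bar y, Pos y, \<beta>]"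
  using knuth_step.K3[of y n \<beta>] by (auto intro: knuth.step)

lemma knuth_K4: "\<lbrakk>1 \<le> y; y < n; \<beta> \<in> letters n; Pos y < \<beta>; \<beta> < Bar y\<rbrakk>
       \<Longrightarrow> knuth n [\<beta>, Bar y, Pos y] [\<beta>, Pos (Suc y), Bar (Suc y)]"
  using knuth_step.K4[of y n \<beta>] by (auto intro: knuth.step)

text \<open>Only raising is required; lowering follows by duality. The images are asked to be
  equivalent rather than one step apart, because an operator may turn one relation into another one,
  into a reversed one or into an equality; \<open>knuth_triple\<close> lists these outcomes.\<close>

definition crystal_compatible :: "nat \<Rightarrow> word \<Rightarrow> word \<Rightarrow> bool" where
  "crystal_compatible n u v \<longleftrightarrow> (\<forall>i \<in> {1..n}. eps i u = eps i v \<and> phi i u = phi i v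
     \<and> (eps i u > 0 \<longrightarrow> knuth n (up n i u) (up n i v)))"

lemmas knuth_triple = knuth_K1 knuth_K2 knuth_K3 knuth_K4
  knuth_K1[THEN knuth.sym] knuth_K2[THEN knuth.sym] knuth_K3[THEN knuth.sym] knuth_K4[THEN knuth.sym] knuth.refl

lemma compatible_K1:
  assumes "\<alpha> \<in> letters n" "\<beta> \<in> letters n" "\<gamma> \<in> letters n" "\<gamma> < \<alpha>" "\<alpha> \<le> \<beta>" "\<beta> \<noteq> bar \<gamma>"
  shows "crystal_compatible n [\<gamma>, \<beta>, \<alpha>] [\<beta>, \<gamma>, \<alpha>]"
  unfolding crystal_compatible_def
proof (intro ballI conjI impI)
  fix i assume i: "i \<in> {1..n}"
  show "eps i [\<gamma>, \<beta>, \<alpha>] = eps i [\<beta>, \<gamma>, \<alpha>]"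
    using assms i by (cases \<alpha>; cases \<beta>; cases \<gamma>) (auto simp: less_eq_letter_def)
  show "phi i [\<gamma>, \<beta>, \<alpha>] = phi i [\<beta>, \<gamma>, \<alpha>]"
    using assms i by (cases \<alpha>; cases \<beta>; cases \<gamma>) (auto simp: less_eq_letter_def)
  assume "eps i [\<gamma>, \<beta>, \<alpha>] > 0"
  then show "knuth n (up n i [\<gamma>, \<beta>, \<alpha>]) (up n i [\<beta>, \<gamma>, \<alpha>])"
    using assms i
    by (cases \<alpha>; cases \<beta>; cases \<gamma>)
      (auto simp: less_eq_letter_def split: if_splits,
        (rule knuth_triple; force simp: less_eq_letter_def)+)
qed

lemma compatible_K2:
  assumes "\<alpha> \<in> letters n" "\<beta> \<in> letters n" "\<gamma> \<in> letters n" "\<gamma> \<le> \<alpha>" "\<alpha> < \<beta>" "\<beta> \<noteq> bar \<gamma>"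
  shows "crystal_compatible n [\<alpha>, \<beta>, \<gamma>] [\<alpha>, \<gamma>, \<beta>]"
  unfolding crystal_compatible_def
proof (intro ballI conjI impI)
  fix i assume i: "i \<in> {1..n}"
  show "eps i [\<alpha>, \<beta>, \<gamma>] = eps i [\<alpha>, \<gamma>, \<beta>]"
    using assms i by (cases \<alpha>; cases \<beta>; cases \<gamma>) (auto simp: less_eq_letter_def)
  show "phi i [\<alpha>, \<beta>, \<gamma>] = phi i [\<alpha>, \<gamma>, \<beta>]"
    using assms i by (cases \<alpha>; cases \<beta>; cases \<gamma>) (auto simp: less_eq_letter_def)
  assume "eps i [\<alpha>, \<beta>, \<gamma>] > 0"
  then show "knuth n (up n i [\<alpha>, \<beta>, \<gamma>]) (up n i [\<alpha>, \<gamma>, \<beta>])"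
    using assms i
    by (cases \<alpha>; cases \<beta>; cases \<gamma>)
      (auto simp: less_eq_letter_def split: if_splits,
        (rule knuth_triple; force simp: less_eq_letter_def)+)
qed

lemma compatible_K3:
  assumes "1 \<le> y" "y < n" "\<beta> \<in> letters n" "Pos y < \<beta>" "\<beta> < Bar y"
  shows "crystal_compatible n [Pos (Suc y), Bar (Suc y), \<beta>] [Bar y, Pos y, \<beta>]"
  unfolding crystal_compatible_def
proof (intro ballI conjI impI)
  fix i assume i: "i \<in> {1..n}"
  show "eps i [Pos (Suc y), Bar (Suc y), \<beta>] = eps i [Bar y, Pos y, \<beta>]"
    using assms i by (cases \<beta>) (auto simp: less_eq_letter_def)
  show "phi i [Pos (Suc y), Bar (Suc y), \<beta>] = phi i [Bar y, Pos y, \<beta>]"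
    using assms i by (cases \<beta>) (auto simp: less_eq_letter_def)
  assume "eps i [Pos (Suc y), Bar (Suc y), \<beta>] > 0"
  then show "knuth n (up n i [Pos (Suc y), Bar (Suc y), \<beta>]) (up n i [Bar y, Pos y, \<beta>])"
    using assms i
    by (cases \<beta>)
      (auto simp: less_eq_letter_def split: if_splits,
        (rule knuth_triple; force simp: less_eq_letter_def)+)
qed

lemma compatible_K4:
  assumes "1 \<le> y" "y < n" "\<beta> \<in> letters n" "Pos y < \<beta>" "\<beta> < Bar y"
  shows "crystal_compatible n [\<beta>, Bar y, Pos y] [\<beta>, Pos (Suc y), Bar (Suc y)]"
  unfolding crystal_compatible_def
proof (intro ballI conjI impI)
  fix i assume i: "i \<in> {1..n}"
  show "eps i [\<beta>, Bar y, Pos y] = eps i [\<beta>, Pos (Suc y), Bar (Suc y)]"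
    using assms i by (cases \<beta>) (auto simp: less_eq_letter_def)
  show "phi i [\<beta>, Bar y, Pos y] = phi i [\<beta>, Pos (Suc y), Bar (Suc y)]"
    using assms i by (cases \<beta>) (auto simp: less_eq_letter_def)
  assume "eps i [\<beta>, Bar y, Pos y] > 0"
  then show "knuth n (up n i [\<beta>, Bar y, Pos y]) (up n i [\<beta>, Pos (Suc y), Bar (Suc y)])"
    using assms i
    by (cases \<beta>)
      (auto simp: less_eq_letter_def split: if_splits,
        (rule knuth_triple; force simp: less_eq_letter_def)+)
qed

section \<open>Columns\<close>

lemma columnD: "column n C \<Longrightarrow> C \<in> words n" "column n C \<Longrightarrow> sorted_wrt (<) C"
  by (auto simp: column_def)

lemma column_eq: "column n C \<Longrightarrow> column n D \<Longrightarrow> set C = set D \<Longrightarrow> C = D"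
  by (auto simp: column_def intro: strict_sorted_equal)

lemma column_sorted_list_of_set: "A \<subseteq> letters n \<Longrightarrow> column n (sorted_list_of_set A) \<and> set (sorted_list_of_set A) = A"
  using finite_subset[of A "letters n"]
  by (auto simp: column_def words_iff letters_def)

text \<open>Seven consecutive slots, four of them optional single letters. Any choice of the
  optional letters is sorted, which covers a column both before and after an operator has
  acted.\<close>

lemma sorted_pieces:
  fixes p q r s :: "'a::linorder"
  assumes "sorted_wrt (<) a" "sorted_wrt (<) b" "sorted_wrt (<) c" "p < q" "q < r" "r < s"
    "\<forall>x\<in>set a. x < p" "\<forall>x\<in>set b. q < x \<and> x < r" "\<forall>x\<in>set c. s < x"
  shows "sorted_wrt (<) (a @ (if P then [p] else []) @ (if Q then [q] else []) @ b
     @ (if R then [r] else []) @ (if S then [s] else []) @ c)"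
proof -
  have 1: "sorted_wrt (<) (a @ us)" if "\<forall>y\<in>set us. p \<le> y" "sorted_wrt (<) us" for us
    using that assms(1,7) by (force simp: sorted_wrt_append)
  have 2: "sorted_wrt (<) (b @ us)" if "\<forall>y\<in>set us. r \<le> y" "sorted_wrt (<) us" for us
    using that assms(2,8) by (force simp: sorted_wrt_append)
  have 3: "sorted_wrt (<) ((if X then [x] else []) @ us)" if "\<forall>y\<in>set us. x < y" "sorted_wrt (<) us" for us X and x :: 'a
    using that by auto
  have c: "\<forall>y\<in>set c. s < y" by fact
  have sc: "\<forall>y\<in>set ((if S then [s] else []) @ c). r < y"
    using assms(6,9) by (auto intro: less_trans)
  have rc: "\<forall>y\<in>set ((if R then [r] else []) @ (if S then [s] else []) @ c). r \<le> y"
    using sc by (auto split: if_splits intro: less_imp_le)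
  have bc: "\<forall>y\<in>set (b @ (if R then [r] else []) @ (if S then [s] else []) @ c). q < y"
    using rc assms(5,8) by (fastforce intro: less_le_trans)
  have qc: "\<forall>y\<in>set ((if Q then [q] else []) @ b @ (if R then [r] else []) @ (if S then [s] else []) @ c). p < y"
    using bc assms(4) by (fastforce intro: less_trans)
  have pc: "\<forall>y\<in>set ((if P then [p] else []) @ (if Q then [q] else []) @ b @ (if R then [r] else []) @ (if S then [s] else []) @ c). p \<le> y"
    using qc by (fastforce intro: less_imp_le)
  show ?thesis
    by (intro 1[OF pc] 3[OF qc] 3[OF bc] 2[OF rc] 3[OF sc] 3[OF c] assms(3))
qed

section \<open>The four letters of a column that an operator sees\<close>

definition keep :: "letter \<Rightarrow> word \<Rightarrow> word" where
  "keep x w = (if x \<in> set w then [x] else [])"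

lemma column_decomp:
  assumes "sorted_wrt (<) w"
  shows "w = filter (\<lambda>x. x < Pos i) w @ keep (Pos i) w @ keep (Pos (Suc i)) w
     @ filter (\<lambda>x. Pos (Suc i) < x \<and> x < Bar (Suc i)) w
     @ keep (Bar (Suc i)) w @ keep (Bar i) w @ filter (\<lambda>x. Bar i < x) w" (is "w = ?v")
proof (rule strict_sorted_equal)
  show "sorted_wrt (<) w" by fact
  have sf: "sorted_wrt (<) (filter P w)" for P
    using assms by (rule sorted_wrt_filter)
  show "sorted_wrt (<) ?v"
    unfolding keep_def by (rule sorted_pieces) (auto intro: sf)
  show "set w = set ?v"
  proof -
    have "x < Pos i \<or> x = Pos i \<or> x = Pos (Suc i) \<or> (Pos (Suc i) < x \<and> x < Bar (Suc i))
      \<or> x = Bar (Suc i) \<or> x = Bar i \<or> Bar i < x" for x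
      by (cases x) auto
    moreover have "set (keep x w) = {y \<in> set w. y = x}" for x
      by (auto simp: keep_def)
    ultimately show "set w = set ?v"
      by (simp only: set_append set_filter) blast
  qed
qed

lemma neutral_word:
  assumes "\<forall>x \<in> set a. sg i x = 0"
  shows "eps i (a @ v) = eps i v" "phi i (a @ v) = phi i v" "eps i a = 0" "phi i a = 0"
    "eps i v > 0 \<Longrightarrow> up n i (a @ v) = a @ up n i v" "up n i a = a"
  using assms by (induction a) auto

text \<open>Only the four single letters carry a sign, in the order +, -, +, -. The recurring
  condition on \<open>p'\<close> says that \<open>Bar i\<close> survives cancellation; being the
  rightmost minus it is then the letter that moves, and otherwise \<open>Pos (Suc i)\<close>
  moves.\<close>

lemma column_crystal:
  assumes C: "column n C" and i: "1 \<le> i" "i \<le> n"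
  defines "p \<equiv> Pos i \<in> set C" and "q \<equiv> Pos (Suc i) \<in> set C"
    and "q' \<equiv> Bar (Suc i) \<in> set C" and "p' \<equiv> Bar i \<in> set C"
  shows "eps i C = of_bool (p' \<and> \<not> q' \<and> \<not> (p \<and> \<not> q)) + of_bool (q \<and> \<not> p)"
    and "phi i C = of_bool (p \<and> \<not> q \<and> \<not> (p' \<and> \<not> q')) + of_bool (q' \<and> \<not> p')"
    and "eps i C > 0 \<Longrightarrow> column n (up n i C)"
    and "eps i C > 0 \<Longrightarrow> set (up n i C) = 
      (if p' \<and> \<not> q' \<and> \<not> (p \<and> \<not> q) then insert (upl n i (Bar i)) (set C - {Bar i})
       else insert (Pos i) (set C - {Pos (Suc i)}))"
proof -
  define a b c where "a = filter (\<lambda>x. x < Pos i) C"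
    and "b = filter (\<lambda>x. Pos (Suc i) < x \<and> x < Bar (Suc i)) C"
    and "c = filter (\<lambda>x. Bar i < x) C"
  have sC: "sorted_wrt (<) C" and wC: "set C \<subseteq> letters n"
    using C by (auto simp: column_def words_iff)
  have neut: "\<forall>x\<in>set a. sg i x = 0" "\<forall>x\<in>set b. sg i x = 0" "\<forall>x\<in>set c. sg i x = 0"
    by (auto simp: a_def b_def c_def sg_def split: letter.splits)
  have abc: "\<forall>x\<in>set a. x < Pos i" "\<forall>x\<in>set b. Pos (Suc i) < x \<and> x < Bar (Suc i)"
    "\<forall>x\<in>set c. Bar i < x"
    by (auto simp: a_def b_def c_def)
  have sabc: "sorted_wrt (<) a" "sorted_wrt (<) b" "sorted_wrt (<) c"
    using sC by (auto simp: a_def b_def c_def intro: sorted_wrt_filter)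
  have wabc: "set a \<subseteq> letters n" "set b \<subseteq> letters n" "set c \<subseteq> letters n"
    using wC by (auto simp: a_def b_def c_def)
  \<comment> \<open>When \<open>Bar n\<close> becomes \<open>Pos n\<close>, it passes from a slot
    behind \<open>b\<close> to a slot in front of it; the word is unchanged elsewhere only because
    \<open>b\<close> is empty.\<close>
  have nn: "i = n \<Longrightarrow> b = []"
  proof -
    assume "i = n"
    then have "x \<notin> set b" for x
      using wabc abc by (cases x) fastforce+
    then show "b = []" by (cases b) auto
  qed
  have Cd: "C = a @ (if p then [Pos i] else []) @ (if q then [Pos (Suc i)] else []) @ b
     @ (if q' then [Bar (Suc i)] else []) @ (if p' then [Bar i] else []) @ c"
    using column_decomp[OF sC, of i] unfolding a_def b_def c_def p_def q_def q'_def p'_def keep_def .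
  have qn: "q \<Longrightarrow> i < n" "q' \<Longrightarrow> i < n"
    using wC by (auto simp: q_def q'_def)
  have E: "eps i C = of_bool (p' \<and> \<not> q' \<and> \<not> (p \<and> \<not> q)) + of_bool (q \<and> \<not> p)"
    apply (subst Cd)
    using neut by (auto simp: neutral_word)
  show "eps i C = of_bool (p' \<and> \<not> q' \<and> \<not> (p \<and> \<not> q)) + of_bool (q \<and> \<not> p)" by (fact E)
  show "phi i C = of_bool (p \<and> \<not> q \<and> \<not> (p' \<and> \<not> q')) + of_bool (q' \<and> \<not> p')"
    apply (subst Cd)
    using neut by (auto simp: neutral_word)
  \<comment> \<open>The presence of the four optional letters after raising, in the order of the
    slots.\<close>
  define P Q B D where "P \<longleftrightarrow> p \<or> q \<and> \<not> (p' \<and> \<not> q' \<and> \<not> (p \<and> \<not> q)) \<or> (p' \<and> \<not> q' \<and> \<not> (p \<and> \<not> q) \<and> i = n)"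
    and "Q \<longleftrightarrow> q \<and> (p \<or> p' \<and> \<not> q' \<and> \<not> (p \<and> \<not> q))"
    and "B \<longleftrightarrow> q' \<or> (p' \<and> \<not> q' \<and> \<not> (p \<and> \<not> q) \<and> i \<noteq> n)"
    and "D \<longleftrightarrow> p' \<and> \<not> (p' \<and> \<not> q' \<and> \<not> (p \<and> \<not> q))"
  assume "eps i C > 0"
  then have pos: "(p' \<and> \<not> q' \<and> \<not> (p \<and> \<not> q)) \<or> (q \<and> \<not> p)"
    by (auto simp: E split: if_splits)
  have up: "up n i C = a @ (if P then [Pos i] else []) @ (if Q then [Pos (Suc i)] else []) @ b
     @ (if B then [Bar (Suc i)] else []) @ (if D then [Bar i] else []) @ c"
    apply (subst Cd)
    using neut pos qn nn by (auto simp: neutral_word P_def Q_def B_def D_def)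
  have BQ: "B \<Longrightarrow> i < n" "Q \<Longrightarrow> i < n" "P \<or> D \<Longrightarrow> i \<le> n"
    using qn i by (auto simp: B_def Q_def)
  show "column n (up n i C)"
    unfolding up column_def words_iff using wabc BQ i
    by (intro conjI sorted_pieces) (use abc sabc in \<open>auto split: if_splits\<close>)
  have "set C = set a \<union> (if p then {Pos i} else {}) \<union> (if q then {Pos (Suc i)} else {}) \<union> set b
     \<union> (if q' then {Bar (Suc i)} else {}) \<union> (if p' then {Bar i} else {}) \<union> set c"
    by (subst Cd) auto
  moreover have "Pos i \<notin> set a \<union> set b \<union> set c" "Bar i \<notin> set a \<union> set b \<union> set c"
     "Pos (Suc i) \<notin> set a \<union> set b \<union> set c" "Bar (Suc i) \<notin> set a \<union> set b \<union> set c"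
    using abc by auto
  ultimately show "set (up n i C) = 
      (if p' \<and> \<not> q' \<and> \<not> (p \<and> \<not> q) then insert (upl n i (Bar i)) (set C - {Bar i})
       else insert (Pos i) (set C - {Pos (Suc i)}))"
    unfolding up P_def Q_def B_def D_def using pos qn
    by (cases p; cases q; cases p'; cases q'; cases "i = n"; simp; blast)
qed

section \<open>The split form of a column\<close>

text \<open>
  The number of letters $z$ with $z, \overline z \in A$ and $z \ge x$ that still wait for their
  replacement $t$ when the values are scanned downwards from \<open>n\<close> to \<open>x\<close>: each unused value
  met while somebody waits is a replacement. In contrast to the greedy definition this is local,
  which is what makes the action of \<open>up n i\<close> on the left and right columns computable.
\<close>

function cnt :: "nat \<Rightarrow> letter set \<Rightarrow> nat \<Rightarrow> nat" where
  "cnt n A x = (if n < x then 0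
     else if Pos x \<in> A \<and> Bar x \<in> A then Suc (cnt n A (Suc x))
     else if Pos x \<notin> A \<and> Bar x \<notin> A then cnt n A (Suc x) - 1
     else cnt n A (Suc x))"
  by pat_completeness auto
termination by (relation "measure (\<lambda>(n, A, x). Suc n - x)") auto

declare cnt.simps [simp del]

lemma cnt_beyond [simp]: "n < x \<Longrightarrow> cnt n A x = 0"
  by (simp add: cnt.simps)

definition repl :: "nat \<Rightarrow> letter set \<Rightarrow> nat set" where
  "repl n A = {x \<in> {1..n}. Pos x \<notin> A \<and> Bar x \<notin> A \<and> cnt n A (Suc x) > 0}"

definition rset :: "nat \<Rightarrow> letter set \<Rightarrow> letter set" where
  "rset n A = {x. case x of Pos j \<Rightarrow> Pos j \<in> A
     | Bar j \<Rightarrow> Bar j \<in> A \<and> Pos j \<notin> A \<or> j \<in> repl n A}"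

definition lset :: "nat \<Rightarrow> letter set \<Rightarrow> letter set" where
  "lset n A = {x. case x of Bar j \<Rightarrow> Bar j \<in> A
     | Pos j \<Rightarrow> Pos j \<in> A \<and> Bar j \<notin> A \<or> j \<in> repl n A}"

lemma rset_simps [simp]: "Pos j \<in> rset n A \<longleftrightarrow> Pos j \<in> A"
  "Bar j \<in> rset n A \<longleftrightarrow> Bar j \<in> A \<and> Pos j \<notin> A \<or> j \<in> repl n A"
  by (auto simp: rset_def)

lemma lset_simps [simp]: "Bar j \<in> lset n A \<longleftrightarrow> Bar j \<in> A"
  "Pos j \<in> lset n A \<longleftrightarrow> Pos j \<in> A \<and> Bar j \<notin> A \<or> j \<in> repl n A"
  by (auto simp: lset_def)

text \<open>Defined by membership and for every column, since doubling is carried out for arbitrary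
  columns. Agreement with \<open>right_col\<close> on admissible columns is
  \<open>right_left_col\<close>.\<close>

definition rcol :: "nat \<Rightarrow> word \<Rightarrow> word" where
  "rcol n C = sorted_list_of_set (rset n (set C))"

definition lcol :: "nat \<Rightarrow> word \<Rightarrow> word" where
  "lcol n C = sorted_list_of_set (lset n (set C))"

lemma repl_subset: "j \<in> repl n A \<Longrightarrow> 1 \<le> j \<and> j \<le> n \<and> Pos j \<notin> A \<and> Bar j \<notin> A"
  by (auto simp: repl_def)

lemma rset_lset_letters:
  assumes "A \<subseteq> letters n"
  shows "rset n A \<subseteq> letters n" "lset n A \<subseteq> letters n"
proof -
  show "rset n A \<subseteq> letters n"
  proof
    fix x assume "x \<in> rset n A"
    then show "x \<in> letters n" using assms repl_subset[of _ n A] by (cases x) auto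
  qed
  show "lset n A \<subseteq> letters n"
  proof
    fix x assume "x \<in> lset n A"
    then show "x \<in> letters n" using assms repl_subset[of _ n A] by (cases x) auto
  qed
qed

lemma column_set: "column n C \<Longrightarrow> set C \<subseteq> letters n"
  by (auto simp: column_def words_iff)

lemma rcol_column: "column n C \<Longrightarrow> column n (rcol n C) \<and> set (rcol n C) = rset n (set C)"
  unfolding rcol_def by (intro column_sorted_list_of_set rset_lset_letters column_set)

lemma lcol_column: "column n C \<Longrightarrow> column n (lcol n C) \<and> set (lcol n C) = lset n (set C)"
  unfolding lcol_def by (intro column_sorted_list_of_set rset_lset_letters column_set)

definition pair_free :: "letter set \<Rightarrow> bool" where
  "pair_free A \<longleftrightarrow> (\<forall>j. \<not> (Pos j \<in> A \<and> Bar j \<in> A))"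

lemma pair_free_rset: "pair_free (rset n A)" and pair_free_lset: "pair_free (lset n A)"
  using repl_subset[of _ n A] by (auto simp: pair_free_def)

text \<open>The simple reflection of the Weyl group of type C, acting on letters. It is an
  involution on \<open>letters n\<close> only.\<close>

fun rfl :: "nat \<Rightarrow> nat \<Rightarrow> letter \<Rightarrow> letter" where
  "rfl n i (Pos j) = (if j = i then (if i = n then Bar n else Pos (Suc i))
     else if j = Suc i then Pos i else Pos j)"
| "rfl n i (Bar j) = (if j = i then (if i = n then Pos n else Bar (Suc i))
     else if j = Suc i then Bar i else Bar j)"

lemma rfl_image_iff:
  assumes "S \<subseteq> letters n" "1 \<le> i" "i \<le> n"
  shows "y \<in> rfl n i ` S \<longleftrightarrow> y \<in> letters n \<and> rfl n i y \<in> S"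
proof -
  have 1: "x \<in> letters n \<Longrightarrow> rfl n i x \<in> letters n \<and> rfl n i (rfl n i x) = x" for x
    using assms by (cases x) auto
  show ?thesis
  proof
    assume "y \<in> rfl n i ` S"
    then obtain x where "x \<in> S" "y = rfl n i x" by blast
    then show "y \<in> letters n \<and> rfl n i y \<in> S" using 1[of x] assms(1) by auto
  next
    assume "y \<in> letters n \<and> rfl n i y \<in> S"
    then show "y \<in> rfl n i ` S" using 1[of y] by (intro image_eqI[of _ _ "rfl n i y"]) auto
  qed
qed

lemma column_up_mem:
  assumes C: "column n C" and i: "1 \<le> i" "i \<le> n" and e: "eps i C > 0"
  defines "p \<equiv> Pos i \<in> set C" and "q \<equiv> Pos (Suc i) \<in> set C"
    and "q' \<equiv> Bar (Suc i) \<in> set C" and "p' \<equiv> Bar i \<in> set C"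
  shows "j \<noteq> i \<Longrightarrow> j \<noteq> Suc i \<Longrightarrow> Pos j \<in> set (up n i C) \<longleftrightarrow> Pos j \<in> set C"
    and "j \<noteq> i \<Longrightarrow> j \<noteq> Suc i \<Longrightarrow> Bar j \<in> set (up n i C) \<longleftrightarrow> Bar j \<in> set C"
    and "Pos i \<in> set (up n i C) \<longleftrightarrow> p \<or> \<not> (p' \<and> \<not> q' \<and> \<not> (p \<and> \<not> q)) \<or> i = n"
    and "Pos (Suc i) \<in> set (up n i C) \<longleftrightarrow> q \<and> p' \<and> \<not> q' \<and> \<not> (p \<and> \<not> q)"
    and "Bar (Suc i) \<in> set (up n i C) \<longleftrightarrow> q' \<or> (p' \<and> \<not> q' \<and> \<not> (p \<and> \<not> q) \<and> i \<noteq> n)"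
    and "Bar i \<in> set (up n i C) \<longleftrightarrow> p' \<and> \<not> (p' \<and> \<not> q' \<and> \<not> (p \<and> \<not> q))"
proof -
  have s: "set (up n i C) = (if p' \<and> \<not> q' \<and> \<not> (p \<and> \<not> q) then insert (upl n i (Bar i)) (set C - {Bar i})
       else insert (Pos i) (set C - {Pos (Suc i)}))"
    using column_crystal(4)[OF C i e] by (simp only: p_def q_def p'_def q'_def)
  show "j \<noteq> i \<Longrightarrow> j \<noteq> Suc i \<Longrightarrow> Pos j \<in> set (up n i C) \<longleftrightarrow> Pos j \<in> set C"
    "j \<noteq> i \<Longrightarrow> j \<noteq> Suc i \<Longrightarrow> Bar j \<in> set (up n i C) \<longleftrightarrow> Bar j \<in> set C"
    by (simp_all add: s)
  show "Pos i \<in> set (up n i C) \<longleftrightarrow> p \<or> \<not> (p' \<and> \<not> q' \<and> \<not> (p \<and> \<not> q)) \<or> i = n"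
    unfolding s by (cases "p' \<and> \<not> q' \<and> \<not> (p \<and> \<not> q)") (auto simp: p_def)
  show "Pos (Suc i) \<in> set (up n i C) \<longleftrightarrow> q \<and> p' \<and> \<not> q' \<and> \<not> (p \<and> \<not> q)"
    unfolding s by (cases "p' \<and> \<not> q' \<and> \<not> (p \<and> \<not> q)") (auto simp: q_def)
  show "Bar (Suc i) \<in> set (up n i C) \<longleftrightarrow> q' \<or> (p' \<and> \<not> q' \<and> \<not> (p \<and> \<not> q) \<and> i \<noteq> n)"
    unfolding s by (cases "p' \<and> \<not> q' \<and> \<not> (p \<and> \<not> q)") (auto simp: q'_def)
  show "Bar i \<in> set (up n i C) \<longleftrightarrow> p' \<and> \<not> (p' \<and> \<not> q' \<and> \<not> (p \<and> \<not> q))"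
    unfolding s by (cases "p' \<and> \<not> q' \<and> \<not> (p \<and> \<not> q)") (auto simp: p'_def)
qed

lemma letter_set_eqI:
  assumes "\<And>j. j \<noteq> i \<Longrightarrow> j \<noteq> Suc i \<Longrightarrow> (Pos j \<in> A \<longleftrightarrow> Pos j \<in> B) \<and> (Bar j \<in> A \<longleftrightarrow> Bar j \<in> B)"
    "Pos i \<in> A \<longleftrightarrow> Pos i \<in> B" "Pos (Suc i) \<in> A \<longleftrightarrow> Pos (Suc i) \<in> B"
    "Bar (Suc i) \<in> A \<longleftrightarrow> Bar (Suc i) \<in> B" "Bar i \<in> A \<longleftrightarrow> Bar i \<in> B"
  shows "A = B"
proof (rule set_eqI)
  fix x show "x \<in> A \<longleftrightarrow> x \<in> B"
    using assms by (cases x; cases "labs x = i"; cases "labs x = Suc i"; simp)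
qed

lemma rfl_image_mem:
  assumes S: "S \<subseteq> letters n" and i: "1 \<le> i" "i \<le> n"
  shows "j \<noteq> i \<Longrightarrow> j \<noteq> Suc i \<Longrightarrow> Pos j \<in> rfl n i ` S \<longleftrightarrow> Pos j \<in> S"
    and "j \<noteq> i \<Longrightarrow> j \<noteq> Suc i \<Longrightarrow> Bar j \<in> rfl n i ` S \<longleftrightarrow> Bar j \<in> S"
    and "Pos i \<in> rfl n i ` S \<longleftrightarrow> (if i = n then Bar n \<in> S else Pos (Suc i) \<in> S)"
    and "Bar i \<in> rfl n i ` S \<longleftrightarrow> (if i = n then Pos n \<in> S else Bar (Suc i) \<in> S)"
    and "Pos (Suc i) \<in> rfl n i ` S \<longleftrightarrow> i \<noteq> n \<and> Pos i \<in> S"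
    and "Bar (Suc i) \<in> rfl n i ` S \<longleftrightarrow> i \<noteq> n \<and> Bar i \<in> S"
  unfolding rfl_image_iff[OF S i] using S i by auto

text \<open>Columns without pairs are extremal: their uncancelled signs at \<open>i\<close> are all
  of one kind. There are at most two to raise, and raising all of them is the simple
  reflection.\<close>

lemma pair_free_up:
  assumes X: "column n X" "pair_free (set X)" and i: "1 \<le> i" "i \<le> n"
  shows "eps i X = 1 \<Longrightarrow> column n (up n i X) \<and> set (up n i X) = rfl n i ` set X"
    and "eps i X = 2 \<Longrightarrow> column n (up n i (up n i X)) \<and> set (up n i (up n i X)) = rfl n i ` set X"
    and "eps i X \<le> 2" and "eps i X > 0 \<Longrightarrow> phi i X = 0"
proof -
  have L: "set X \<subseteq> letters n" by (rule column_set[OF X(1)])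
  define p q q' p' where "p \<longleftrightarrow> Pos i \<in> set X" and "q \<longleftrightarrow> Pos (Suc i) \<in> set X"
    and "q' \<longleftrightarrow> Bar (Suc i) \<in> set X" and "p' \<longleftrightarrow> Bar i \<in> set X"
  note pq = p_def[symmetric] q_def[symmetric] q'_def[symmetric] p'_def[symmetric]
  have nn: "i = n \<Longrightarrow> \<not> q" "i = n \<Longrightarrow> \<not> q'" using L by (auto simp: q_def q'_def)
  have nn2: "i = n \<Longrightarrow> Bar n \<in> set X \<longleftrightarrow> p'" "i = n \<Longrightarrow> Pos n \<in> set X \<longleftrightarrow> p" by (auto simp: p_def p'_def)
  have pf: "\<not> (p \<and> p')" "\<not> (q \<and> q')"
    using X(2) by (auto simp: pair_free_def p_def q_def q'_def p'_def)
  note cc = column_crystal[OF X(1) i, unfolded pq]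
  note rm = rfl_image_mem[OF L i]
  show "eps i X \<le> 2" by (simp add: cc(1) of_bool_def)
  show "eps i X > 0 \<Longrightarrow> phi i X = 0"
    using pf unfolding cc(1,2) by (cases p; cases q; cases p'; cases q'; simp)
  { assume e: "eps i X = 1"
    then have e0: "eps i X > 0" by simp
    note um = column_up_mem[OF X(1) i e0]
    show "column n (up n i X) \<and> set (up n i X) = rfl n i ` set X"
    proof (intro conjI letter_set_eqI[of i])
      show "column n (up n i X)" using cc(3) e by simp
    qed (use e pf nn in \<open>unfold cc(1) um rm pq,
      (cases p; cases q; cases p'; cases q'; cases "i = n"; simp add: nn2)\<close>)+ }
  { assume e: "eps i X = 2"
    then have e0: "eps i X > 0" by simp
    note um = column_up_mem[OF X(1) i e0]
    have c1: "column n (up n i X)" using cc(3) e by simp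
    have "(p' \<and> \<not> q' \<and> \<not> (p \<and> \<not> q)) \<and> q \<and> \<not> p"
      using e unfolding cc(1) of_bool_def by (simp split: if_splits)
    then have m: "q" "p'" "\<not> p" "\<not> q'" "i \<noteq> n"
      using nn by auto
    note cc2 = column_crystal[OF c1 i]
    have e2: "eps i (up n i X) = 1" using eps_up[OF columnD(1)[OF X(1)] i e0] e by simp
    then have e20: "eps i (up n i X) > 0" by simp
    note um2 = column_up_mem[OF c1 i e20]
    show "column n (up n i (up n i X)) \<and> set (up n i (up n i X)) = rfl n i ` set X"
    proof (intro conjI letter_set_eqI[of i])
      show "column n (up n i (up n i X))" using cc2(3) e2 by simp
    qed (use m in \<open>simp_all add: um2 um rm pq\<close>) }
qed

lemma cnt_cong: "(\<And>y. x \<le> y \<Longrightarrow> y \<le> n \<Longrightarrow> (Pos y \<in> A \<longleftrightarrow> Pos y \<in> B) \<and> (Bar y \<in> A \<longleftrightarrow> Bar y \<in> B))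
   \<Longrightarrow> cnt n A x = cnt n B x"
proof (induction "Suc n - x" arbitrary: x)
  case 0
  then show ?case by (simp add: cnt.simps[of n _ x])
next
  case (Suc m)
  have "cnt n A (Suc x) = cnt n B (Suc x)"
    by (rule Suc.hyps(1)) (use Suc.hyps(2) Suc.prems in auto)
  moreover have "(Pos x \<in> A \<longleftrightarrow> Pos x \<in> B)" "(Bar x \<in> A \<longleftrightarrow> Bar x \<in> B)"
    using Suc.prems[of x] Suc.hyps(2) by auto
  ultimately show ?case by (simp add: cnt.simps[of n _ x])
qed

lemma cnt_up:
  assumes C: "column n C" and i: "1 \<le> i" "i \<le> n" and e: "eps i C > 0" and x: "x \<noteq> Suc i"
  shows "cnt n (set (up n i C)) x = cnt n (set C) x"
proof (cases "x > Suc i")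
  case True
  then show ?thesis
    by (intro cnt_cong) (auto simp: column_up_mem[OF C i e])
next
  case False
  then have "x \<le> i" using x by simp
  then show ?thesis
  proof (induction rule: inc_induct)
    case base
    have 2: "cnt n (set (up n i C)) (Suc (Suc i)) = cnt n (set C) (Suc (Suc i))"
      by (intro cnt_cong) (auto simp: column_up_mem[OF C i e])
    define p q q' p' where "p \<longleftrightarrow> Pos i \<in> set C" and "q \<longleftrightarrow> Pos (Suc i) \<in> set C"
      and "q' \<longleftrightarrow> Bar (Suc i) \<in> set C" and "p' \<longleftrightarrow> Bar i \<in> set C"
    note pq = p_def[symmetric] q_def[symmetric] q'_def[symmetric] p'_def[symmetric]
    have nn: "i = n \<Longrightarrow> \<not> q" "i = n \<Longrightarrow> \<not> q'" using column_set[OF C] by (auto simp: q_def q'_def)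
    have n0: "i = n \<Longrightarrow> cnt n A (Suc i) = 0" for A by (simp add: cnt.simps)
    show ?case
      using e nn n0 i unfolding column_crystal(1)[OF C i, unfolded pq] cnt.simps[of n _ i]
        column_up_mem[OF C i e, unfolded pq]  pq
      by (cases p; cases q; cases p'; cases q'; cases "i = n";
        simp add: cnt.simps[of n _ "Suc i"] 2 column_up_mem[OF C i e, unfolded pq] pq)
  next
    case (step m)
    then show ?case
      using column_up_mem(1,2)[OF C i e, of m] by (simp add: cnt.simps[of n _ m])
  qed
qed

lemma repl_local:
  assumes A: "A \<subseteq> letters n" and i: "1 \<le> i" "i \<le> n"
  defines "p \<equiv> Pos i \<in> A" and "q \<equiv> Pos (Suc i) \<in> A"
    and "q' \<equiv> Bar (Suc i) \<in> A" and "p' \<equiv> Bar i \<in> A" and "c \<equiv> cnt n A (Suc (Suc i))"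
  shows "Suc i \<in> repl n A \<longleftrightarrow> \<not> q \<and> \<not> q' \<and> c > 0"
    and "i \<in> repl n A \<longleftrightarrow> \<not> p \<and> \<not> p' \<and>
      (if q \<and> q' then True else if \<not> q \<and> \<not> q' then c > 1 else c > 0)"
proof -
  have n0: "cnt n A (Suc i) = 0" "c = 0" "\<not> q" "\<not> q'" if "n \<le> i"
    using A that by (auto simp: c_def q_def q'_def cnt.simps)
  show "Suc i \<in> repl n A \<longleftrightarrow> \<not> q \<and> \<not> q' \<and> c > 0"
    by (cases "n \<le> i") (simp_all add: n0 repl_def flip: q_def q'_def c_def)
  have "cnt n A (Suc i) = (if n \<le> i then 0 else if q \<and> q' then Suc c else if \<not> q \<and> \<not> q' then c - 1 else c)"
    by (subst cnt.simps) (simp add: q_def q'_def c_def)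
  then show "i \<in> repl n A \<longleftrightarrow> \<not> p \<and> \<not> p' \<and>
      (if q \<and> q' then True else if \<not> q \<and> \<not> q' then c > 1 else c > 0)"
    using i by (cases "n \<le> i") (simp_all add: n0 repl_def flip: p_def p'_def)
qed

text \<open>Besides the four letters, only the number \<open>c\<close> of pairs waiting before
  \<open>i + 1\<close> is scanned matters, and only whether it is 0, 1 or larger, since two values
  can serve at most two pairs.\<close>

lemma eps_phi_split:
  assumes C: "column n C" and i: "1 \<le> i" "i \<le> n"
  shows "eps i (rcol n C @ lcol n C) = 2 * eps i C" "phi i (rcol n C @ lcol n C) = 2 * phi i C"
proof -
  define p q q' p' c where "p \<longleftrightarrow> Pos i \<in> set C" and "q \<longleftrightarrow> Pos (Suc i) \<in> set C"
    and "q' \<longleftrightarrow> Bar (Suc i) \<in> set C" and "p' \<longleftrightarrow> Bar i \<in> set C"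
    and "c = cnt n (set C) (Suc (Suc i))"
  note pq = p_def[symmetric] q_def[symmetric] q'_def[symmetric] p'_def[symmetric] c_def[symmetric]
  note rl = repl_local[OF column_set[OF C] i, unfolded pq]
  note R = rcol_column[OF C] and L = lcol_column[OF C]
  have sets: "set (rcol n C) = rset n (set C)" "set (lcol n C) = lset n (set C)"
    using R L by auto
  note cr = column_crystal[OF R[THEN conjunct1] i, unfolded sets rset_simps rl pq]
  note cl = column_crystal[OF L[THEN conjunct1] i, unfolded sets lset_simps rl pq]
  note cc = column_crystal[OF C i, unfolded pq]
  show "eps i (rcol n C @ lcol n C) = 2 * eps i C"
    unfolding eps_append cr(1,2) cl(1,2) cc(1,2)
    by (cases p; cases q; cases p'; cases q'; cases "c = 0"; cases "c = 1"; simp)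
  show "phi i (rcol n C @ lcol n C) = 2 * phi i C"
    unfolding phi_append cr(1,2) cl(1,2) cc(1,2)
    by (cases p; cases q; cases p'; cases q'; cases "c = 0"; cases "c = 1"; simp)
qed

lemma repl_up:
  assumes C: "column n C" and i: "1 \<le> i" "i \<le> n" and e: "eps i C > 0" and j: "j \<noteq> i" "j \<noteq> Suc i"
  shows "j \<in> repl n (set (up n i C)) \<longleftrightarrow> j \<in> repl n (set C)"
  using column_up_mem(1,2)[OF C i e j] cnt_up[OF C i e, of "Suc j"] j by (auto simp: repl_def)

text \<open>The two raisings of the doubled word fall both on the left column, one on each, or both
  on the right column. Always \<open>phi i r = 0\<close>, so no sign of \<open>l\<close> is
  cancelled by \<open>r\<close>.\<close>

lemma split_up_cases:
  assumes C: "column n C" and i: "1 \<le> i" "i \<le> n" and e: "eps i C > 0"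
  defines "r \<equiv> rcol n C" and "l \<equiv> lcol n C"
  obtains "phi i r = 0" "eps i l = 2" "rset n (set (up n i C)) = set r"
      "lset n (set (up n i C)) = rfl n i ` set l"
  | "phi i r = 0" "eps i r = 1" "eps i l = 1" "rset n (set (up n i C)) = rfl n i ` set r"
      "lset n (set (up n i C)) = rfl n i ` set l"
  | "phi i r = 0" "eps i r = 2" "eps i l = 0" "rset n (set (up n i C)) = rfl n i ` set r"
      "lset n (set (up n i C)) = set l"
proof -
  define p q q' p' c where "p \<longleftrightarrow> Pos i \<in> set C" and "q \<longleftrightarrow> Pos (Suc i) \<in> set C"
    and "q' \<longleftrightarrow> Bar (Suc i) \<in> set C" and "p' \<longleftrightarrow> Bar i \<in> set C"
    and "c = cnt n (set C) (Suc (Suc i))"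
  define m where "m \<longleftrightarrow> i = n"
  note pq = p_def[symmetric] q_def[symmetric] q'_def[symmetric] p'_def[symmetric] c_def[symmetric]
    m_def[symmetric]
  have nn: "m \<Longrightarrow> \<not> q" "m \<Longrightarrow> \<not> q'" "m \<Longrightarrow> c = 0"
    using column_set[OF C] by (auto simp: m_def q_def q'_def c_def)
  have CU: "column n (up n i C)" using column_crystal(3)[OF C i e] .
  have cU: "cnt n (set (up n i C)) (Suc (Suc i)) = c"
    using cnt_up[OF C i e, of "Suc (Suc i)"] by (simp add: c_def)
  note rl = repl_local[OF column_set[OF C] i, unfolded pq]
  note R = rcol_column[OF C] and L = lcol_column[OF C]
  have sets: "set r = rset n (set C)" "set l = lset n (set C)"
    using R L by (auto simp: r_def l_def)
  note cr = column_crystal[OF R[THEN conjunct1] i, folded r_def, unfolded sets rset_simps rl pq]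
  note cl = column_crystal[OF L[THEN conjunct1] i, folded l_def, unfolded sets lset_simps rl pq]
  note cc = column_crystal[OF C i, unfolded pq]
  note um = column_up_mem[OF C i e, unfolded pq]
  note rlU = repl_local[OF column_set[OF CU] i, unfolded cU um]
  note ru = repl_up[OF C i e]
  note rmR = rfl_image_mem[OF rset_lset_letters(1)[OF column_set[OF C]] i]
  note rmL = rfl_image_mem[OF rset_lset_letters(2)[OF column_set[OF C]] i]
  have e': "(p' \<and> \<not> q' \<and> \<not> (p \<and> \<not> q)) \<or> (q \<and> \<not> p)"
    using e unfolding cc(1) of_bool_def by (simp split: if_splits)
  have nnm: "m \<Longrightarrow> Pos n \<in> set C \<longleftrightarrow> p" "m \<Longrightarrow> Bar n \<in> set C \<longleftrightarrow> p'"
     "m \<Longrightarrow> n \<in> repl n (set C) \<longleftrightarrow> \<not> p \<and> \<not> p' \<and>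
      (if q \<and> q' then True else if \<not> q \<and> \<not> q' then c > 1 else c > 0)"
    using rl(2) by (auto simp: m_def p_def p'_def)
  note all = um ru rlU rmR rmL rl pq nnm
  have num: "phi i r = 0 \<and> (eps i l = 2 \<or> eps i l = 1 \<and> eps i r = 1 \<or> eps i l = 0 \<and> eps i r = 2)"
    using e' unfolding cr(1,2) cl(1)
    by (cases p; cases q; cases p'; cases q'; cases "c = 0"; cases "c = 1"; simp)
  have rs: "rset n (set (up n i C)) = (if eps i l = 2 then set r else rfl n i ` set r)"
    unfolding sets
  proof (rule letter_set_eqI[of i])
    fix j assume "j \<noteq> i" "j \<noteq> Suc i"
    then show "(Pos j \<in> rset n (set (up n i C)) \<longleftrightarrow> Pos j \<in> (if eps i l = 2 then rset n (set C) else rfl n i ` rset n (set C)))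
      \<and> (Bar j \<in> rset n (set (up n i C)) \<longleftrightarrow> Bar j \<in> (if eps i l = 2 then rset n (set C) else rfl n i ` rset n (set C)))"
      by (simp add: um ru rmR)
  qed ((insert e' nn, unfold cl(1))[1],
     (cases p; cases q; cases p'; cases q'; cases m; cases "c = 0"; cases "c = 1"; simp add: all; fail))+
  have ls: "lset n (set (up n i C)) = (if eps i l = 0 then set l else rfl n i ` set l)"
    unfolding sets
  proof (rule letter_set_eqI[of i])
    fix j assume "j \<noteq> i" "j \<noteq> Suc i"
    then show "(Pos j \<in> lset n (set (up n i C)) \<longleftrightarrow> Pos j \<in> (if eps i l = 0 then lset n (set C) else rfl n i ` lset n (set C)))
      \<and> (Bar j \<in> lset n (set (up n i C)) \<longleftrightarrow> Bar j \<in> (if eps i l = 0 then lset n (set C) else rfl n i ` lset n (set C)))"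
      by (simp add: um ru rmL)
  qed ((insert e' nn, unfold cl(1))[1],
     (cases p; cases q; cases p'; cases q'; cases m; cases "c = 0"; cases "c = 1"; simp add: all; fail))+
  show thesis
    using num rs ls that by (auto split: if_splits)
qed

lemma split_up_words:
  assumes C: "column n C" and i: "1 \<le> i" "i \<le> n" and e: "eps i C > 0"
  defines "r \<equiv> rcol n C" and "l \<equiv> lcol n C"
  obtains "phi i r = 0" "eps i l = 2" "rcol n (up n i C) = r" "lcol n (up n i C) = up n i (up n i l)"
  | "phi i r = 0" "eps i r = 1" "eps i l = 1" "rcol n (up n i C) = up n i r" "lcol n (up n i C) = up n i l"
  | "phi i r = 0" "eps i r = 2" "eps i l = 0" "rcol n (up n i C) = up n i (up n i r)" "lcol n (up n i C) = l"
proof -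
  note R = rcol_column[OF C, folded r_def] and L = lcol_column[OF C, folded l_def]
  have pf: "pair_free (set r)" "pair_free (set l)"
    using R L pair_free_rset pair_free_lset by auto
  have CU: "column n (up n i C)" using column_crystal(3)[OF C i e] .
  note RU = rcol_column[OF CU] and LU = lcol_column[OF CU]
  note pr = pair_free_up[OF R[THEN conjunct1] pf(1) i]
  note pl = pair_free_up[OF L[THEN conjunct1] pf(2) i]
  from split_up_cases[OF C i e, folded r_def l_def] show thesis
  proof cases
    case 1
    have "rcol n (up n i C) = r" by (rule column_eq) (use R RU 1 in auto)
    moreover have "lcol n (up n i C) = up n i (up n i l)"
      by (rule column_eq) (use LU 1 pl in auto)
    ultimately show thesis using that(1) 1 by blast
  next
    case 2
    have "rcol n (up n i C) = up n i r" by (rule column_eq) (use RU 2 pr in auto)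
    moreover have "lcol n (up n i C) = up n i l" by (rule column_eq) (use LU 2 pl in auto)
    ultimately show thesis using that(2) 2 by blast
  next
    case 3
    have "rcol n (up n i C) = up n i (up n i r)" by (rule column_eq) (use RU 3 pr in auto)
    moreover have "lcol n (up n i C) = l" by (rule column_eq) (use L LU 3 in auto)
    ultimately show thesis using that(3) 3 by blast
  qed
qed

lemma up_split_word:
  assumes C: "column n C" and i: "1 \<le> i" "i \<le> n" and e: "eps i C > 0"
  shows "up n i (up n i (rcol n C @ lcol n C)) = rcol n (up n i C) @ lcol n (up n i C)"
proof -
  have w: "rcol n C \<in> words n" "lcol n C \<in> words n"
    using rcol_column[OF C] lcol_column[OF C] columnD(1) by blast+
  from split_up_words[OF C i e] show ?thesis
    by cases (simp_all add: up_append_right up_append_left eps_up[OF w(1) i] eps_up[OF w(2) i])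
qed

section \<open>Admissibility\<close>

definition nle :: "word \<Rightarrow> nat \<Rightarrow> nat" where
  "nle w x = length (filter (\<lambda>y. labs y \<le> x) w)"

lemma nle_Suc:
  assumes "distinct w"
  shows "nle w (Suc x) = nle w x + of_bool (Pos (Suc x) \<in> set w) + of_bool (Bar (Suc x) \<in> set w)"
  using assms
proof (induction w)
  case (Cons y w)
  then show ?case
    by (cases y; cases "labs y = Suc x") (auto simp: nle_def)
qed (simp add: nle_def)

lemma column_distinct: "column n C \<Longrightarrow> distinct C"
  by (auto simp: column_def strict_sorted_iff)

lemma nle_0: "column n C \<Longrightarrow> nle C 0 = 0"
proof -
  assume "column n C"
  then have "\<forall>y \<in> set C. labs y \<ge> 1" using column_set[of n C] by (force simp: letters_def)
  then show ?thesis by (auto simp: nle_def filter_empty_conv)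
qed

text \<open>Going down from \<open>x\<close>, an excess persists past every value that is not a
  pair, because such a value contributes at most one letter.\<close>

lemma excess_pair:
  assumes "column n C" "x < nle C x"
  shows "\<exists>z. 1 \<le> z \<and> z \<le> x \<and> Pos z \<in> set C \<and> Bar z \<in> set C \<and> z < nle C z"
  using assms(2)
proof (induction x)
  case 0
  then show ?case using nle_0[OF assms(1)] by simp
next
  case (Suc x)
  show ?case
  proof (cases "Pos (Suc x) \<in> set C \<and> Bar (Suc x) \<in> set C")
    case True
    with Suc.prems show ?thesis by (intro exI[of _ "Suc x"]) auto
  next
    case False
    then have "x < nle C x" using Suc.prems nle_Suc[OF column_distinct[OF assms(1)], of x]
      by (auto simp: of_bool_def split: if_splits)
    from Suc.IH[OF this] show ?thesis using le_Suc_eq by blast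
  qed
qed

lemma sorted_filter_le:
  fixes C :: "'a::linorder list"
  assumes "sorted_wrt (<) C" "a < length C"
  shows "length (filter (\<lambda>y. y \<le> C ! a) C) = Suc a"
    and "length (filter (\<lambda>y. C ! a \<le> y) C) = length C - a"
proof -
  have C: "C = take a C @ C ! a # drop (Suc a) C" using assms(2) by (rule id_take_nth_drop)
  have s: "sorted_wrt (<) (take a C @ C ! a # drop (Suc a) C)"
    using assms(1) C by simp
  have 1: "\<forall>y\<in>set (take a C). y < C ! a" "\<forall>y\<in>set (drop (Suc a) C). C ! a < y"
    using s by (auto simp: sorted_wrt_append)
  have "filter (\<lambda>y. y \<le> C ! a) (take a C) = take a C" "filter (\<lambda>y. y \<le> C ! a) (drop (Suc a) C) = []"
    using 1 by (auto simp: filter_id_conv filter_empty_conv)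
  then have "filter (\<lambda>y. y \<le> C ! a) (take a C @ C ! a # drop (Suc a) C) = take a C @ [C ! a]" by simp
  then show "length (filter (\<lambda>y. y \<le> C ! a) C) = Suc a"
    using C assms(2) by (metis length_append_singleton length_take min.absorb4)
  have "filter (\<lambda>y. C ! a \<le> y) (take a C) = []" "filter (\<lambda>y. C ! a \<le> y) (drop (Suc a) C) = drop (Suc a) C"
    using 1 by (auto simp: filter_id_conv filter_empty_conv)
  then have "filter (\<lambda>y. C ! a \<le> y) (take a C @ C ! a # drop (Suc a) C) = C ! a # drop (Suc a) C" by simp
  then have "length (filter (\<lambda>y. C ! a \<le> y) C) = length (C ! a # drop (Suc a) C)"
    using C by metis
  then show "length (filter (\<lambda>y. C ! a \<le> y) C) = length C - a"
    using assms(2) by simp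
qed

text \<open>The letters of absolute value at most \<open>i\<close> are those weakly above
  \<open>Pos i\<close> and those weakly below \<open>Bar i\<close>, which the two row numbers
  count.\<close>

lemma nle_rows:
  assumes C: "column n C" and "a < length C" "b < length C" "C ! a = Pos i" "rev C ! b = Bar i"
  shows "nle C i = Suc a + Suc b"
proof -
  have "nle D i = length (filter (\<lambda>y. y \<le> Pos i) D) + length (filter (\<lambda>y. Bar i \<le> y) D)" for D
  proof (induction D)
    case (Cons y D)
    then show ?case by (cases y) (auto simp: nle_def less_eq_letter_def)
  qed (simp add: nle_def)
  moreover have "C ! (length C - Suc b) = Bar i" using assms by (simp add: rev_nth)
  then have "length (filter (\<lambda>y. Bar i \<le> y) C) = Suc b"
    using sorted_filter_le(2)[OF columnD(2)[OF C], of "length C - Suc b"] assms(3) by simp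
  ultimately show ?thesis
    using sorted_filter_le(1)[OF columnD(2)[OF C] assms(2)] assms(4) by simp
qed

lemma admissible_iff_nle: "admissible n C \<longleftrightarrow> column n C \<and> (\<forall>x \<le> n. nle C x \<le> x)"
proof (intro iffI conjI allI impI)
  assume a: "admissible n C"
  then show C: "column n C" by (simp add: admissible_def)
  fix x assume "x \<le> n"
  show "nle C x \<le> x"
  proof (rule ccontr)
    assume "\<not> nle C x \<le> x"
    then obtain z where z: "Pos z \<in> set C" "Bar z \<in> set C" "z < nle C z"
      using excess_pair[OF C, of x] by auto
    from z(1) obtain k where k: "k < length C" "C ! k = Pos z" by (auto simp: in_set_conv_nth)
    from z(2) have "Bar z \<in> set (rev C)" by simp
    then obtain b where b: "b < length C" "rev C ! b = Bar z" by (metis in_set_conv_nth length_rev)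
    have "Suc k + Suc b \<le> z" using a k b unfolding admissible_def by blast
    with nle_rows[OF C k(1) b(1) k(2) b(2)] z(3) show False by simp
  qed
next
  assume "column n C \<and> (\<forall>x \<le> n. nle C x \<le> x)"
  then have C: "column n C" and x: "\<And>x. x \<le> n \<Longrightarrow> nle C x \<le> x" by auto
  show "admissible n C"
    unfolding admissible_def
  proof (intro conjI allI impI C)
    fix i a b assume "a < length C" "b < length C" "C ! a = Pos i" "rev C ! b = Bar i"
    moreover from this have "Pos i \<in> set C" by (metis nth_mem)
    then have "i \<le> n" using column_set[OF C] by auto
    ultimately show "Suc a + Suc b \<le> i" using nle_rows[OF C] x by metis
  qed
qed

text \<open>Truncation at 0 makes \<open>cnt\<close> a running maximum: it is the maximum of
  \<open>nle C y - y\<close> over \<open>u \<le> y \<le> n\<close>, minus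
  \<open>nle C u - u\<close>. The inequality is written with sums to stay within the
  naturals.\<close>

lemma cnt_le_iff:
  assumes C: "column n C" and "u \<le> n"
  shows "cnt n (set C) (Suc u) \<le> k \<longleftrightarrow> (\<forall>y. u \<le> y \<and> y \<le> n \<longrightarrow> nle C y + u \<le> nle C u + y + k)"
  using assms(2)
proof (induction u arbitrary: k rule: inc_induct)
  case base
  then show ?case by auto
next
  case (step u)
  let ?d = "of_bool (Pos (Suc u) \<in> set C) + of_bool (Bar (Suc u) \<in> set C) :: nat"
    and ?c = "cnt n (set C) (Suc (Suc u))"
  have N: "nle C (Suc u) = nle C u + ?d" by (simp add: nle_Suc[OF column_distinct[OF C]])
  have c: "cnt n (set C) (Suc u) \<le> k \<longleftrightarrow> ?c + ?d \<le> Suc k"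
    using step.hyps by (auto simp: cnt.simps[of n _ "Suc u"])
  show ?case
  proof (cases "?d \<le> Suc k")
    case True
    have "?c + ?d \<le> Suc k \<longleftrightarrow> ?c \<le> Suc k - ?d" using True by linarith
    also have "\<dots> \<longleftrightarrow> (\<forall>y. Suc u \<le> y \<and> y \<le> n \<longrightarrow> nle C y + Suc u \<le> nle C (Suc u) + y + (Suc k - ?d))"
      by (rule step.IH)
    also have "\<dots> \<longleftrightarrow> (\<forall>y. Suc u \<le> y \<and> y \<le> n \<longrightarrow> nle C y + u \<le> nle C u + y + k)"
      unfolding N using True by auto
    also have "\<dots> \<longleftrightarrow> (\<forall>y. u \<le> y \<and> y \<le> n \<longrightarrow> nle C y + u \<le> nle C u + y + k)"
      using step.hyps by (auto simp: le_eq_less_or_eq[of u] Suc_le_eq)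
    finally show ?thesis unfolding c .
  next
    case False
    then have "\<not> nle C (Suc u) + u \<le> nle C u + Suc u + k" unfolding N by linarith
    then show ?thesis unfolding c using False step.hyps by (auto intro!: exI[of _ "Suc u"])
  qed
qed

text \<open>Admissibility means that nobody waits when the scan ends. In this form
  \<open>cnt_up\<close> makes it invariant under the operators.\<close>

lemma admissible_iff_cnt: "admissible n C \<longleftrightarrow> column n C \<and> cnt n (set C) 1 = 0"
proof (cases "column n C")
  case True
  then show ?thesis
    using cnt_le_iff[OF True, of 0 0] nle_0[OF True] by (simp add: admissible_iff_nle)
qed (simp add: admissible_def)

lemma admissible_up_iff:
  assumes C: "column n C" and i: "1 \<le> i" "i \<le> n" and e: "eps i C > 0"
  shows "admissible n (up n i C) \<longleftrightarrow> admissible n C"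
  using column_crystal(3)[OF C i e] cnt_up[OF C i e, of 1] C i by (auto simp: admissible_iff_cnt)


section \<open>The greedy replacements\<close>

text \<open>Bookkeeping of the scan: every pair met so far has either been served or still
  waits.\<close>

lemma card_pairs_ge:
  assumes "1 \<le> x" "x \<le> Suc n"
  shows "card {z \<in> {1..n}. Pos z \<in> A \<and> Bar z \<in> A \<and> x \<le> z} = card {t \<in> repl n A. x \<le> t} + cnt n A x"
  using assms(2,1)
proof (induction x rule: inc_induct)
  case base
  have "{z \<in> {1..n}. Pos z \<in> A \<and> Bar z \<in> A \<and> Suc n \<le> z} = {}" "{t \<in> repl n A. Suc n \<le> t} = {}"
    by (auto simp: repl_def)
  then show ?case by (simp only: card.empty cnt_beyond lessI)
next
  case (step x)
  let ?Z = "\<lambda>x. {z \<in> {1..n}. Pos z \<in> A \<and> Bar z \<in> A \<and> x \<le> z}" and ?T = "\<lambda>x. {t \<in> repl n A. x \<le> t}"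
  have fin: "finite (?Z y)" "finite (?T y)" for y
    by (auto simp: repl_def)
  have Z: "?Z x = (if Pos x \<in> A \<and> Bar x \<in> A then insert x (?Z (Suc x)) else ?Z (Suc x))"
    using step.hyps step.prems by (auto simp: le_eq_less_or_eq Suc_le_eq)
  have T: "?T x = (if x \<in> repl n A then insert x (?T (Suc x)) else ?T (Suc x))"
    by (auto simp: le_eq_less_or_eq Suc_le_eq)
  have cZ: "card (?Z x) = card (?Z (Suc x)) + of_bool (Pos x \<in> A \<and> Bar x \<in> A)"
    unfolding Z using fin(1)[of "Suc x"] by simp
  have cT: "card (?T x) = card (?T (Suc x)) + of_bool (x \<in> repl n A)"
    unfolding T using fin(2)[of "Suc x"] by simp
  have "card (?Z (Suc x)) = card (?T (Suc x)) + cnt n A (Suc x)"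
    using step by simp
  moreover have "x \<in> repl n A \<longleftrightarrow> Pos x \<notin> A \<and> Bar x \<notin> A \<and> cnt n A (Suc x) > 0"
    using step by (simp add: repl_def)
  ultimately show ?case
    unfolding cZ cT using step.hyps by (auto simp: cnt.simps[of n A x])
qed

text \<open>The invariant is that as many pairs were handled as there are replacements at or above
  \<open>b\<close>. It forces the greedy choice to be the largest element of \<open>T\<close> below
  \<open>b\<close>. Only the two sets are compared, not which pair receives which
  replacement.\<close>

lemma set_replacements_aux:
  fixes n C
  defines "Z \<equiv> {z \<in> {1..n}. Pos z \<in> set C \<and> Bar z \<in> set C}" and "T \<equiv> repl n (set C)"
  assumes "sorted_wrt (>) zs" "set zs \<subseteq> Z" "\<And>z z'. z \<in> Z - set zs \<Longrightarrow> z' \<in> set zs \<Longrightarrow> z' < z"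
    and "card (Z - set zs) = card {t \<in> T. b \<le> t}" "card Z = card T"
  shows "set (replacements_aux n C b zs) = {t \<in> T. t < b}"
  using assms(3-6)
proof (induction zs arbitrary: b)
  have fin: "finite Z" "finite T" by (auto simp: Z_def T_def repl_def)
  have ge: "card {z \<in> Z. x \<le> z} = card {t \<in> T. x \<le> t} + cnt n (set C) x" if "1 \<le> x" "x \<le> Suc n" for x
    using card_pairs_ge[OF that, of "set C"] by (simp add: Z_def T_def conj_assoc)
  { case Nil
    have "{t \<in> T. b \<le> t} = T"
      using Nil fin assms(7) by (intro card_subset_eq) auto
    then show ?case by (auto simp flip: not_less) }
  { case (Cons z zs)
    let ?V = "Z - set (z # zs)"
    have dz: "z \<notin> set zs" "\<And>y. y \<in> set zs \<Longrightarrow> y < z" using Cons.prems(1) by auto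
    have zZ: "z \<in> Z" using Cons.prems(2) by simp
    have "card ?V < card Z"
      using zZ fin by (intro psubset_card_mono) auto
    then have "{t \<in> T. b \<le> t} \<noteq> T"
      using Cons.prems(4) assms(7) by auto
    then have ne: "{t \<in> T. t < b} \<noteq> {}" by (auto simp: not_le)
    define s where "s = Max {t \<in> T. t < b}"
    have s: "s \<in> T" "s < b" and smax: "\<And>t. t \<in> T \<Longrightarrow> t < b \<Longrightarrow> t \<le> s"
      using Max_in[OF _ ne] Max_ge[of "{t \<in> T. t < b}"] fin by (auto simp: s_def)
    have sn: "1 \<le> s" "s \<le> n" "Pos s \<notin> set C" "Bar s \<notin> set C" using s(1) repl_subset by (auto simp: T_def)
    have Ts: "{t \<in> T. s \<le> t} = insert s {t \<in> T. b \<le> t}"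
      using s smax by (force simp: not_less)
    have cTs: "card {t \<in> T. s \<le> t} = Suc (card {t \<in> T. b \<le> t})"
      unfolding Ts using fin s by simp
    \<comment> \<open>Otherwise all pairs at or above \<open>s\<close> were already handled, whereas
      by \<open>card_pairs_ge\<close> there is at least one more of them.\<close>
    have sz: "s < z"
    proof (rule ccontr)
      assume "\<not> s < z"
      moreover have "z \<noteq> s" using zZ sn by (auto simp: Z_def)
      ultimately have zs: "z < s" by simp
      have "{y \<in> Z. s \<le> y} \<subseteq> ?V"
        using zs by (auto dest!: dz(2))
      then have "card {y \<in> Z. s \<le> y} \<le> card ?V"
        using fin by (intro card_mono) auto
      then show False using ge[of s] sn cTs Cons.prems(4) by simp
    qed
    have gr: "(GREATEST t. t \<in> {1..n} \<and> t < min b z \<and> Pos t \<notin> set C \<and> Bar t \<notin> set C) = s"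
    proof (rule Greatest_equality)
      show "s \<in> {1..n} \<and> s < min b z \<and> Pos s \<notin> set C \<and> Bar s \<notin> set C"
        using sn sz s by simp
      fix y assume y: "y \<in> {1..n} \<and> y < min b z \<and> Pos y \<notin> set C \<and> Bar y \<notin> set C"
      show "y \<le> s"
      proof (rule ccontr)
        assume "\<not> y \<le> s"
        then have "y \<notin> T" using smax y by auto
        then have c0: "cnt n (set C) (Suc y) = 0" using y by (auto simp: T_def repl_def)
        have "{t \<in> T. Suc y \<le> t} \<subseteq> {t \<in> T. b \<le> t}"
          using smax \<open>\<not> y \<le> s\<close> by (force simp: not_less)
        then have "card {t \<in> T. Suc y \<le> t} \<le> card ?V"
          unfolding Cons.prems(4) using fin by (intro card_mono) auto
        moreover have "card (insert z ?V) \<le> card {x \<in> Z. Suc y \<le> x}"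
          using fin y zZ Cons.prems(3)[of _ z]
          by (intro card_mono) (auto simp: Suc_le_eq intro: less_trans[of y z])
        moreover have "card (insert z ?V) = Suc (card ?V)"
          using fin by simp
        ultimately show False using ge[of "Suc y"] y c0 by auto
      qed
    qed
    have VV: "Z - set zs = insert z ?V" using zZ dz by auto
    have "set (replacements_aux n C s zs) = {t \<in> T. t < s}"
    proof (rule Cons.IH)
      show "sorted_wrt (>) zs" "set zs \<subseteq> Z" using Cons.prems by auto
      show "z' < y" if "y \<in> Z - set zs" "z' \<in> set zs" for y z'
        using that Cons.prems(3)[of y z'] dz(2) by (cases "y = z") auto
      show "card (Z - set zs) = card {t \<in> T. s \<le> t}"
        unfolding VV cTs Cons.prems(4)[symmetric] using fin by simp
    qed
    moreover have "{t \<in> T. t < b} = insert s {t \<in> T. t < s}"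
      using s smax by (auto dest: le_neq_implies_less)
    ultimately show ?case
      by (simp only: replacements_aux.simps gr Let_def list.set) }
qed

lemma set_replacements:
  assumes "admissible n C"
  shows "set (replacements n C) = repl n (set C)"
proof -
  let ?Z = "{z \<in> {1..n}. Pos z \<in> set C \<and> Bar z \<in> set C}"
  have c: "cnt n (set C) 1 = 0" using assms by (simp add: admissible_iff_cnt)
  have Z1: "{z \<in> {1..n}. Pos z \<in> set C \<and> Bar z \<in> set C \<and> 1 \<le> z} = ?Z" by auto
  have T1: "{t \<in> repl n (set C). 1 \<le> t} = repl n (set C)" by (auto simp: repl_def)
  have "card ?Z = card (repl n (set C))"
    using card_pairs_ge[of 1 n "set C", unfolded Z1 T1 c] by simp
  moreover have "card {t \<in> repl n (set C). n + 1 \<le> t} = 0" by (auto simp: repl_def)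
  ultimately have "set (replacements_aux n C (n + 1) (paired n C)) = {t \<in> repl n (set C). t < n + 1}"
    by (intro set_replacements_aux)
      (simp_all add: paired_def sorted_wrt_rev strict_sorted_list_of_set)
  also have "\<dots> = repl n (set C)" by (auto simp: repl_def)
  finally show ?thesis by (simp add: replacements_def)
qed

lemma right_left_col:
  assumes "admissible n C"
  shows "right_col n C = rcol n C" "left_col n C = lcol n C"
proof -
  have L: "set C \<subseteq> letters n" using assms column_set by (auto simp: admissible_def)
  have p: "set (paired n C) = {z \<in> {1..n}. Pos z \<in> set C \<and> Bar z \<in> set C}" by (simp add: paired_def)
  have "(set C - Bar ` set (paired n C)) \<union> Bar ` repl n (set C) = rset n (set C)"
  proof (rule set_eqI)
    fix x show "x \<in> (set C - Bar ` set (paired n C)) \<union> Bar ` repl n (set C) \<longleftrightarrow> x \<in> rset n (set C)"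
      using L unfolding p by (cases x) auto
  qed
  then show "right_col n C = rcol n C"
    by (simp only: right_col_def rcol_def set_replacements[OF assms])
  have "(set C - Pos ` set (paired n C)) \<union> Pos ` repl n (set C) = lset n (set C)"
  proof (rule set_eqI)
    fix x show "x \<in> (set C - Pos ` set (paired n C)) \<union> Pos ` repl n (set C) \<longleftrightarrow> x \<in> lset n (set C)"
      using L unfolding p by (cases x) auto
  qed
  then show "left_col n C = lcol n C"
    by (simp only: left_col_def lcol_def set_replacements[OF assms])
qed

section \<open>The contraction relation\<close>

lemma up_append:
  assumes "eps i (u @ v) > 0"
  obtains "eps i v > 0" "up n i (u @ v) = u @ up n i v" | "eps i u > 0" "up n i (u @ v) = up n i u @ v"
  using assms up_append_left[of i v u n] up_append_right[of i u v n]
  by (cases "eps i v > phi i u") (auto simp: eps_append)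

text \<open>One letter changes, and by the tensor product rule the operator acts on any factor
  either trivially or as the operator of that factor. This carries minimality of a non-admissible
  column along.\<close>

lemma factor_of_up:
  assumes e: "eps i w > 0" and u: "strict_sublist u (up n i w)"
  shows "\<exists>u'. strict_sublist u' w \<and> (u = u' \<or> eps i u' > 0 \<and> u = up n i u')"
proof -
  obtain a c where ac: "up n i w = a @ u @ c" and ne: "u \<noteq> up n i w"
    using u by (auto simp: strict_sublist_def sublist_def)
  define a' u' c' where "a' = take (length a) w" and "u' = take (length u) (drop (length a) w)"
    and "c' = drop (length a + length u) w"
  have len: "length w = length a + length u + length c"
    using arg_cong[OF ac, of length] by simp
  have w: "w = a' @ u' @ c'"
    unfolding a'_def u'_def c'_def by (metis append_take_drop_id drop_drop add.commute)
  have lens: "length a' = length a" "length u' = length u" "length c' = length c"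
    using len by (auto simp: a'_def u'_def c'_def)
  have su: "strict_sublist u' w"
  proof -
    have "length u \<noteq> length w" using ne ac len by auto
    then have "u' \<noteq> w" using lens by auto
    then show ?thesis using w unfolding strict_sublist_def sublist_def by blast
  qed
  have "eps i (a' @ u' @ c') > 0" using e w by simp
  then have "u = u' \<or> eps i u' > 0 \<and> u = up n i u'"
  proof (rule up_append[where n = n])
    assume e2: "eps i (u' @ c') > 0" and eq: "up n i (a' @ u' @ c') = a' @ up n i (u' @ c')"
    from e2 show ?thesis
    proof (rule up_append[where n = n])
      assume "up n i (u' @ c') = u' @ up n i c'"
      then have "a @ u @ c = a' @ u' @ up n i c'" using eq ac w by simp
      then show ?thesis using lens by simp
    next
      assume e3: "eps i u' > 0" and "up n i (u' @ c') = up n i u' @ c'"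
      then have "a @ u @ c = a' @ up n i u' @ c'" using eq ac w by simp
      then show ?thesis using lens e3 by simp
    qed
  next
    assume "up n i (a' @ u' @ c') = up n i a' @ u' @ c'"
    then have "a @ u @ c = up n i a' @ u' @ c'" using ac w by simp
    then show ?thesis using lens by simp
  qed
  with su show ?thesis by blast
qed

definition minimal_nonadmissible :: "nat \<Rightarrow> word \<Rightarrow> bool" where
  "minimal_nonadmissible n w \<longleftrightarrow> column n w \<and> \<not> admissible n w
     \<and> (\<forall>u. strict_sublist u w \<longrightarrow> admissible n u)"

lemma minimal_nonadmissible_up:
  assumes w: "minimal_nonadmissible n w" and i: "1 \<le> i" "i \<le> n" and e: "eps i w > 0"
  shows "minimal_nonadmissible n (up n i w)"
  unfolding minimal_nonadmissible_def
proof (intro conjI allI impI)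
  have C: "column n w" using w by (simp add: minimal_nonadmissible_def)
  show "column n (up n i w)" using column_crystal(3)[OF C i e] .
  show "\<not> admissible n (up n i w)"
    using admissible_up_iff[OF C i e] w by (simp add: minimal_nonadmissible_def)
  fix u assume "strict_sublist u (up n i w)"
  from factor_of_up[OF e this] obtain u' where u': "admissible n u'" "u = u' \<or> eps i u' > 0 \<and> u = up n i u'"
    using w by (auto simp: minimal_nonadmissible_def)
  moreover from u'(1) have "column n u'" by (simp add: admissible_def)
  ultimately show "admissible n u" using admissible_up_iff[of n u' i] i by auto
qed

text \<open>Deleting the first letter leaves an admissible factor and lowers the count by at most
  one.\<close>

lemma minimal_nonadmissible_nle:
  assumes "minimal_nonadmissible n w" "x \<le> n"
  shows "nle w x \<le> Suc x"
proof (cases w)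
  case (Cons a v)
  have "strict_sublist v w"
    unfolding Cons strict_sublist_def sublist_def by (auto intro: exI[of _ "[a]"])
  then have "admissible n v" using assms by (simp add: minimal_nonadmissible_def)
  then have "nle v x \<le> x" using assms(2) by (simp add: admissible_iff_nle)
  then show ?thesis by (simp add: Cons nle_def)
qed (simp add: nle_def)

lemma contraction_letter_eqI:
  assumes "column n w" "Pos z \<in> set w" "Bar z \<in> set w" "z < nle w z"
    "\<And>y. y < z \<Longrightarrow> Pos y \<in> set w \<Longrightarrow> Bar y \<in> set w \<Longrightarrow> y < nle w y \<Longrightarrow> False"
  shows "contraction_letter n w = z"
  unfolding contraction_letter_def nle_def[symmetric]
proof (rule Least_equality)
  show "z \<in> {1..n} \<and> Pos z \<in> set w \<and> Bar z \<in> set w \<and> z < nle w z"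
    using assms column_set[OF assms(1)] by auto
  fix y assume "y \<in> {1..n} \<and> Pos y \<in> set w \<and> Bar y \<in> set w \<and> y < nle w y"
  then show "z \<le> y" using assms(5)[of y] by (auto simp: not_le[symmetric])
qed

lemma contraction_letter_props:
  assumes w: "minimal_nonadmissible n w" and z: "z = contraction_letter n w"
  shows "1 \<le> z" "z \<le> n" "Pos z \<in> set w" "Bar z \<in> set w" "nle w z = Suc z" "\<And>y. y < z \<Longrightarrow> nle w y \<le> y"
proof -
  have C: "column n w" using w by (simp add: minimal_nonadmissible_def)
  let ?P = "\<lambda>z. z \<in> {1..n} \<and> Pos z \<in> set w \<and> Bar z \<in> set w \<and> z < nle w z"
  obtain x where x: "x \<le> n" "x < nle w x"
    using w C by (auto simp: minimal_nonadmissible_def admissible_iff_nle not_le)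
  then obtain y where "1 \<le> y" "y \<le> x" "Pos y \<in> set w" "Bar y \<in> set w" "y < nle w y"
    using excess_pair[OF C x(2)] by auto
  then have "?P y" using x by simp
  then have Pz: "?P z" unfolding z contraction_letter_def nle_def[symmetric] by (rule LeastI)
  then show "1 \<le> z" "z \<le> n" "Pos z \<in> set w" "Bar z \<in> set w" by auto
  show "nle w z = Suc z" using Pz minimal_nonadmissible_nle[OF w, of z] by auto
  fix y assume y: "y < z"
  show "nle w y \<le> y"
  proof (rule ccontr)
    assume "\<not> nle w y \<le> y"
    then obtain y' where y': "1 \<le> y'" "y' \<le> y" "Pos y' \<in> set w" "Bar y' \<in> set w" "y' < nle w y'"
      using excess_pair[OF C, of y] by auto
    then have "?P y'" using y Pz by auto
    then have "z \<le> y'" unfolding z contraction_letter_def nle_def[symmetric] by (rule Least_le)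
    then show False using y y' by simp
  qed
qed

text \<open>A letter moves between the absolute values \<open>i\<close> and \<open>i + 1\<close>, or
  keeps the absolute value \<open>n\<close>, so only the count at \<open>i\<close> can
  change.\<close>

lemma nle_up:
  assumes C: "column n w" and i: "1 \<le> i" "i \<le> n" and e: "eps i w > 0"
  shows "x \<noteq> i \<Longrightarrow> nle (up n i w) x = nle w x"
    and "nle (up n i w) i + of_bool (Pos i \<in> set w) + of_bool (Bar i \<in> set w)
      = nle w i + of_bool (Pos i \<in> set (up n i w)) + of_bool (Bar i \<in> set (up n i w))"
proof -
  have CU: "column n (up n i w)" using column_crystal(3)[OF C i e] .
  note N = nle_Suc[OF column_distinct[OF C]] and NU = nle_Suc[OF column_distinct[OF CU]]
  note um = column_up_mem[OF C i e]
  have lt: "x < i \<Longrightarrow> nle (up n i w) x = nle w x" for x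
  proof (induction x)
    case 0
    then show ?case by (simp add: nle_0[OF C] nle_0[OF CU])
  next
    case (Suc x)
    then show ?case by (simp add: N NU um)
  qed
  obtain k where k: "i = Suc k" using i by (cases i) auto
  show "nle (up n i w) i + of_bool (Pos i \<in> set w) + of_bool (Bar i \<in> set w)
      = nle w i + of_bool (Pos i \<in> set (up n i w)) + of_bool (Bar i \<in> set (up n i w))"
    using lt[of k] N[of k, folded k] NU[of k, folded k] k by simp
  have Si: "nle (up n i w) (Suc i) = nle w (Suc i)"
  proof -
    define p q q' p' where "p \<longleftrightarrow> Pos i \<in> set w" and "q \<longleftrightarrow> Pos (Suc i) \<in> set w"
      and "q' \<longleftrightarrow> Bar (Suc i) \<in> set w" and "p' \<longleftrightarrow> Bar i \<in> set w"
    note pq = p_def[symmetric] q_def[symmetric] q'_def[symmetric] p'_def[symmetric]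
    have nn: "i = n \<Longrightarrow> \<not> q" "i = n \<Longrightarrow> \<not> q'"
      using column_set[OF C] by (auto simp: q_def q'_def)
    have 1: "nle v (Suc i) = nle v k + of_bool (Pos i \<in> set v) + of_bool (Bar i \<in> set v)
       + of_bool (Pos (Suc i) \<in> set v) + of_bool (Bar (Suc i) \<in> set v)" if "distinct v" for v
      using nle_Suc[OF that] k by simp
    show ?thesis
      unfolding 1[OF column_distinct[OF C]] 1[OF column_distinct[OF CU]]
      using lt[of k] k e nn unfolding column_crystal(1)[OF C i] um pq
      by (cases p; cases q; cases p'; cases q'; cases "i = n"; simp)
  qed
  have "Suc i \<le> x \<Longrightarrow> nle (up n i w) x = nle w x" for x
  proof (induction x rule: dec_induct)
    case base
    then show ?case by (rule Si)
  next
    case (step x)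
    then show ?case by (simp add: N NU um)
  qed
  then show "x \<noteq> i \<Longrightarrow> nle (up n i w) x = nle w x"
    using lt by (cases "x < i") auto
qed

abbreviation contract :: "nat \<Rightarrow> word \<Rightarrow> word" where
  "contract z w \<equiv> filter (\<lambda>x. x \<noteq> Pos z \<and> x \<noteq> Bar z) w"

lemma column_contract: "column n w \<Longrightarrow> column n (contract z w)"
  by (auto simp: column_def words_iff sorted_wrt_filter)

lemma knuth_contract: "minimal_nonadmissible n w \<Longrightarrow> knuth n w (contract (contraction_letter n w) w)"
  by (intro knuth.step knuth_step.K5) (auto simp: minimal_nonadmissible_def)

text \<open>The contraction letter follows the operator: when the operator acts, \<open>i\<close>
  becomes \<open>i + 1\<close>, \<open>i + 1\<close> becomes \<open>i\<close>, and every other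
  letter stays. With the new letter, contracting and raising commute.\<close>

lemma compatible_K5:
  assumes w: "minimal_nonadmissible n w" and z: "z = contraction_letter n w"
  shows "crystal_compatible n w (contract z w)"
  unfolding crystal_compatible_def
proof (intro ballI)
  fix i assume "i \<in> {1..n}"
  then have i: "1 \<le> i" "i \<le> n" by auto
  let ?v = "contract z w"
  have C: "column n w" using w by (simp add: minimal_nonadmissible_def)
  have V: "column n ?v" by (rule column_contract[OF C])
  have sv: "set ?v = set w - {Pos z, Bar z}" by auto
  note zp = contraction_letter_props[OF w z]
  note bound = minimal_nonadmissible_nle[OF w]
  define p q q' p' where "p \<longleftrightarrow> Pos i \<in> set w" and "q \<longleftrightarrow> Pos (Suc i) \<in> set w"
    and "q' \<longleftrightarrow> Bar (Suc i) \<in> set w" and "p' \<longleftrightarrow> Bar i \<in> set w"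
  note pq = p_def[symmetric] q_def[symmetric] q'_def[symmetric] p'_def[symmetric]
  have nn: "q \<Longrightarrow> i < n" "q' \<Longrightarrow> i < n"
    using column_set[OF C] by (auto simp: q_def q'_def)
  note cw = column_crystal[OF C i, unfolded pq]
  note cv = column_crystal[OF V i, unfolded sv]
  note um = column_up_mem[OF C i, unfolded pq]
  note vm = column_up_mem[OF V i, unfolded sv]
  obtain k where k: "i = Suc k" using i by (cases i) auto
  have Ni: "nle w i = nle w k + of_bool p + of_bool p'"
    "nle w (Suc i) = nle w i + of_bool q + of_bool q'"
    using nle_Suc[OF column_distinct[OF C]] k by (simp_all add: p_def p'_def q_def q'_def)
  have main: "eps i w = eps i ?v \<and> phi i w = phi i ?v \<and>
     (eps i w > 0 \<longrightarrow> (\<exists>z'. contraction_letter n (up n i w) = z' \<and> 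
        set (up n i w) - {Pos z', Bar z'} = set (up n i ?v)))"
  proof -
    consider "z = i" | "z = Suc i" | "z \<noteq> i" "z \<noteq> Suc i" by blast
    then show ?thesis
    proof cases
      case 1
      have p: "p" "p'" using zp 1 by (auto simp: p_def p'_def)
      \<comment> \<open>A further pair at \<open>i + 1\<close> would produce an excess of two, which
        minimality forbids.\<close>
      have nq: "\<not> (q \<and> q')"
        using bound[of "Suc i"] Ni(2) zp(5) 1 nn by (auto simp: of_bool_def)
      have ev: "eps i ?v = of_bool q" "phi i ?v = of_bool q'"
        unfolding cv using 1 by (simp_all add: pq)
      have ew: "eps i w = of_bool q" "phi i w = of_bool q'"
        using p nq by (auto simp: cw)
      have "\<exists>z'. contraction_letter n (up n i w) = z' \<and> 
        set (up n i w) - {Pos z', Bar z'} = set (up n i ?v)" if e: "eps i w > 0"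
      proof (intro exI conjI)
        have q: "q" "\<not> q'" "i < n" using e nq nn by (auto simp: ew)
        note um = um[OF e]
        show "contraction_letter n (up n i w) = Suc i"
        proof (rule contraction_letter_eqI)
          show "column n (up n i w)" by (rule cw(3)[OF e])
          show "Pos (Suc i) \<in> set (up n i w)" "Bar (Suc i) \<in> set (up n i w)"
            using p q by (simp_all add: um)
          show "Suc i < nle (up n i w) (Suc i)"
            using nle_up(1)[OF C i e, of "Suc i"] Ni q zp(5) 1 by simp
          fix y assume y: "y < Suc i" "Bar y \<in> set (up n i w)" "y < nle (up n i w) y"
          then have "y < i" using p q um(6) by (cases "y = i") auto
          then show False using y(3) nle_up(1)[OF C i e, of y] zp(6)[of y] 1 by simp
        qed
        have e': "eps i ?v > 0" using ew ev e by simp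
        show "set (up n i w) - {Pos (Suc i), Bar (Suc i)} = set (up n i ?v)"
          unfolding cw(4)[OF e] cv(4)[OF e'] pq using p q 1
          by (simp add: pq) (use p q in \<open>auto simp: p_def p'_def q_def q'_def\<close>)
      qed
      then show ?thesis using ev ew by simp
    next
      case 2
      have qq: "q" "q'" "i < n" using zp 2 nn by (auto simp: q_def q'_def)
      \<comment> \<open>Taking the pair at \<open>i + 1\<close> away from the excess of one leaves
        exactly \<open>i\<close> letters up to \<open>i\<close>; as there is no excess at
        \<open>k = i - 1\<close>, some letter has absolute value \<open>i\<close>.\<close>
      have "nle w i = i" "nle w k \<le> k" using Ni zp(5,6) 2 qq k by auto
      then have p: "p \<or> p'" using Ni k by (auto simp: of_bool_def split: if_splits)
      have ev: "eps i ?v = of_bool (\<not> p)" "phi i ?v = of_bool (\<not> p')"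
        unfolding cv using 2 p by (auto simp: pq)
      have ew: "eps i w = of_bool (\<not> p)" "phi i w = of_bool (\<not> p')"
        using p qq by (auto simp: cw)
      have "\<exists>z'. contraction_letter n (up n i w) = z' \<and> 
        set (up n i w) - {Pos z', Bar z'} = set (up n i ?v)" if e: "eps i w > 0"
      proof (intro exI conjI)
        have p: "\<not> p" "p'" using e p by (auto simp: ew)
        note um = um[OF e]
        show "contraction_letter n (up n i w) = i"
        proof (rule contraction_letter_eqI)
          show "column n (up n i w)" by (rule cw(3)[OF e])
          show m: "Pos i \<in> set (up n i w)" "Bar i \<in> set (up n i w)"
            using p qq by (simp_all add: um)
          show "i < nle (up n i w) i"
            using nle_up(2)[OF C i e] m p \<open>nle w i = i\<close> by (simp add: pq)
          fix y assume y: "y < i" "y < nle (up n i w) y"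
          then show False using nle_up(1)[OF C i e, of y] zp(6)[of y] 2 by simp
        qed
        have e': "eps i ?v > 0" using ew ev e by simp
        show "set (up n i w) - {Pos i, Bar i} = set (up n i ?v)"
          unfolding cw(4)[OF e] cv(4)[OF e'] pq using p qq 2
          by (simp add: pq) (use p qq in \<open>auto simp: p_def p'_def q_def q'_def\<close>)
      qed
      then show ?thesis using ev ew by simp
    next
      case 3
      have ev: "eps i w = eps i ?v" "phi i w = phi i ?v"
        unfolding cw cv using 3 by (simp_all add: pq)
      have "\<exists>z'. contraction_letter n (up n i w) = z' \<and> 
        set (up n i w) - {Pos z', Bar z'} = set (up n i ?v)" if e: "eps i w > 0"
      proof (intro exI conjI)
        note um = um[OF e]
        show "contraction_letter n (up n i w) = z"
        proof (rule contraction_letter_eqI)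
          show "column n (up n i w)" by (rule cw(3)[OF e])
          show m: "Pos z \<in> set (up n i w)" "Bar z \<in> set (up n i w)"
            using 3 zp by (simp_all add: um)
          show "z < nle (up n i w) z"
            using nle_up(1)[OF C i e, of z] 3 zp(5) by simp
          fix y assume y: "y < z" "Pos y \<in> set (up n i w)" "Bar y \<in> set (up n i w)" "y < nle (up n i w) y"
          \<comment> \<open>All other counts below \<open>z\<close> are unchanged and without
            excess.\<close>
          have yi: "y = i" using nle_up(1)[OF C i e, of y] zp(6)[OF y(1)] y(4) by force
          have "Suc i < z" using yi y 3 by simp
          then have small: "nle w i \<le> i" "nle w (Suc i) \<le> Suc i" using zp(6) by simp_all
          have "\<not> (p' \<and> \<not> q' \<and> \<not> (p \<and> \<not> q))" "p'" using y(3) yi um(6) by auto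
          then have "q \<and> \<not> p \<and> q'" using e unfolding cw(1) by (auto simp: of_bool_def split: if_splits)
          then show False
            using small Ni(2) nle_up(2)[OF C i e] y yi \<open>p'\<close> by (simp add: pq)
        qed
        have e': "eps i ?v > 0" using ev e by simp
        have zz: "i = n \<Longrightarrow> z \<noteq> n" using 3 by auto
        show "set (up n i w) - {Pos z, Bar z} = set (up n i ?v)"
          unfolding cw(4)[OF e] cv(4)[OF e'] pq using 3 zz
          by (simp add: pq) auto
      qed
      then show ?thesis using ev by simp
    qed
  qed
  show "eps i w = eps i ?v \<and> phi i w = phi i ?v \<and> (eps i w > 0 \<longrightarrow> knuth n (up n i w) (up n i ?v))"
  proof (intro conjI impI)
    show "eps i w = eps i ?v" "phi i w = phi i ?v" using main by auto
    assume e: "eps i w > 0"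
    then obtain z' where z': "contraction_letter n (up n i w) = z'"
      "set (up n i w) - {Pos z', Bar z'} = set (up n i ?v)" using main by blast
    have m: "minimal_nonadmissible n (up n i w)" by (rule minimal_nonadmissible_up[OF w i e])
    have "contract z' (up n i w) = up n i ?v"
    proof (rule column_eq)
      show "column n (contract z' (up n i w))"
        using m by (intro column_contract) (simp add: minimal_nonadmissible_def)
      show "column n (up n i ?v)" using cv(3) main e by simp
      show "set (contract z' (up n i w)) = set (up n i ?v)" using z'(2) by auto
    qed
    then show "knuth n (up n i w) (up n i ?v)"
      using knuth_contract[OF m] z'(1) by simp
  qed
qed

section \<open>Crystal invariance of Knuth equivalence\<close>

lemma crystal_compatibleD:
  assumes "crystal_compatible n u v" "1 \<le> i" "i \<le> n"
  shows "eps i u = eps i v" "phi i u = phi i v" "eps i u > 0 \<Longrightarrow> knuth n (up n i u) (up n i v)"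
  using assms by (auto simp: crystal_compatible_def)

lemma knuth_step_compatible:
  assumes "knuth_step n u v"
  shows "u \<in> words n \<and> v \<in> words n \<and> crystal_compatible n u v"
  using assms
proof cases
  case (K1 \<alpha> \<beta> \<gamma>)
  then show ?thesis using compatible_K1[of \<alpha> n \<beta> \<gamma>] by auto
next
  case (K2 \<alpha> \<beta> \<gamma>)
  then show ?thesis using compatible_K2[of \<alpha> n \<beta> \<gamma>] by auto
next
  case (K3 y \<beta>)
  then show ?thesis using compatible_K3[of y n \<beta>] by auto
next
  case (K4 y \<beta>)
  then show ?thesis using compatible_K4[of y n \<beta>] by auto
next
  case (K5 z)
  then have m: "minimal_nonadmissible n u" by (auto simp: minimal_nonadmissible_def)
  then have "u \<in> words n" by (auto simp: minimal_nonadmissible_def column_def)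
  then show ?thesis using compatible_K5[OF m K5(5)] K5 by (auto simp: words_iff)
qed

text \<open>The congruence case is the tensor product rule: equivalent middle factors have equal
  \<open>eps\<close> and \<open>phi\<close>, so in both words the operator acts on the same
  factor.\<close>

lemma knuth_compatible:
  assumes "knuth n u v"
  shows "u \<in> words n \<and> v \<in> words n \<and> crystal_compatible n u v"
  using assms
proof induction
  case (step u v)
  then show ?case by (rule knuth_step_compatible)
next
  case (refl u)
  then show ?case by (auto simp: crystal_compatible_def intro!: knuth.refl up_words)
next
  case (sym u v)
  then show ?case by (auto simp: crystal_compatible_def intro: knuth.sym)
next
  case (trans u v w)
  then show ?case unfolding crystal_compatible_def by (metis knuth.trans)
next
  case (cong u v x y)
  have "eps i (x @ u @ y) = eps i (x @ v @ y) \<and> phi i (x @ u @ y) = phi i (x @ v @ y)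
      \<and> (eps i (x @ u @ y) > 0 \<longrightarrow> knuth n (up n i (x @ u @ y)) (up n i (x @ v @ y)))"
    if i: "i \<in> {1..n}" for i
  proof (intro conjI impI)
    have i': "1 \<le> i" "i \<le> n" using i by auto
    note uv = crystal_compatibleD[OF _ i', of u v]
    have e: "eps i u = eps i v" "phi i u = phi i v" using uv cong.IH by auto
    show "eps i (x @ u @ y) = eps i (x @ v @ y)" "phi i (x @ u @ y) = phi i (x @ v @ y)"
      by (simp_all add: eps_append phi_append e)
    assume pos: "eps i (x @ u @ y) > 0"
    consider (y) "eps i (u @ y) > phi i x" "eps i y > phi i u"
      | (u) "eps i (u @ y) > phi i x" "eps i y \<le> phi i u" "eps i u > 0"
      | (x) "eps i (u @ y) \<le> phi i x" "eps i x > 0"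
      using pos by (cases "eps i (u @ y) > phi i x"; cases "eps i y > phi i u") (auto simp: eps_append)
    then show "knuth n (up n i (x @ u @ y)) (up n i (x @ v @ y))"
    proof cases
      case y
      then have "up n i (x @ u @ y) = x @ u @ up n i y" "up n i (x @ v @ y) = x @ v @ up n i y"
        by (simp_all add: up_append_right eps_append phi_append e)
      moreover have "up n i y \<in> words n" using cong.hyps i' y by (intro up_words) auto
      ultimately show ?thesis using cong by (auto intro: knuth.cong)
    next
      case u
      then have "up n i (x @ u @ y) = x @ up n i u @ y" "up n i (x @ v @ y) = x @ up n i v @ y"
        by (simp_all add: up_append_right up_append_left eps_append phi_append e)
      moreover have "knuth n (up n i u) (up n i v)" using uv u cong.IH by auto
      ultimately show ?thesis using cong by (auto intro: knuth.cong)
    next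
      case x
      then have "up n i (x @ u @ y) = up n i x @ u @ y" "up n i (x @ v @ y) = up n i x @ v @ y"
        by (simp_all add: up_append_left eps_append phi_append e)
      moreover have "up n i x \<in> words n" using cong.hyps i' x by (intro up_words) auto
      ultimately show ?thesis using cong by (auto intro: knuth.cong)
    qed
  qed
  then show ?case using cong by (auto simp: crystal_compatible_def)
qed

lemma knuth_words: "knuth n u v \<Longrightarrow> u \<in> words n" "knuth n u v \<Longrightarrow> v \<in> words n"
  using knuth_compatible by auto

lemma knuth_eps_phi:
  assumes "knuth n u v" "1 \<le> i" "i \<le> n"
  shows "eps i u = eps i v" "phi i u = phi i v"
  using knuth_compatible[OF assms(1)] crystal_compatibleD[OF _ assms(2,3)] by blast+

lemma knuth_up: "knuth n u v \<Longrightarrow> 1 \<le> i \<Longrightarrow> i \<le> n \<Longrightarrow> eps i u > 0 \<Longrightarrow> knuth n (up n i u) (up n i v)"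
  using knuth_compatible crystal_compatibleD by blast

section \<open>Duality for columns and for Knuth equivalence\<close>

lemma column_star: "column n w \<Longrightarrow> column n (star w)"
  unfolding column_def by (auto simp: star_def sorted_wrt_rev sorted_wrt_map words_iff)

lemma nle_star: "nle (star w) x = nle w x"
  by (induction w) (auto simp: nle_def)

lemma admissible_star: "admissible n w \<Longrightarrow> admissible n (star w)"
  by (auto simp: admissible_iff_nle nle_star column_star)

lemma strict_sublist_star: "strict_sublist u (star w) \<Longrightarrow> strict_sublist (star u) w"
proof -
  assume "strict_sublist u (star w)"
  then obtain a c where "star w = a @ u @ c" "u \<noteq> star w" by (auto simp: strict_sublist_def sublist_def)
  then have "w = star c @ star u @ star a" "star u \<noteq> w"
    by (metis append.assoc star_simps(3,4), metis star_simps(4))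
  then show ?thesis unfolding strict_sublist_def sublist_def by blast
qed

lemma in_star: "x \<in> set (star w) \<longleftrightarrow> bar x \<in> set w"
  by (metis bar_bar image_iff star_simps(6))

lemma minimal_nonadmissible_star: "minimal_nonadmissible n w \<Longrightarrow> minimal_nonadmissible n (star w)"
  unfolding minimal_nonadmissible_def
  by (metis admissible_star column_star star_simps(4) strict_sublist_star)

lemma contract_star: "contract z (star w) = star (contract z w)"
proof (induction w)
  case (Cons x w)
  then show ?case by (cases x) auto
qed simp

lemma contraction_letter_star: "contraction_letter n (star w) = contraction_letter n w"
proof -
  have "Pos z \<in> set (star w) \<and> Bar z \<in> set (star w) \<longleftrightarrow> Pos z \<in> set w \<and> Bar z \<in> set w" for z
    unfolding in_star by auto
  then show ?thesis
    unfolding contraction_letter_def nle_def[symmetric] nle_star by metis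
qed

text \<open>Duality exchanges (K1) with (K2) and (K3) with (K4). It preserves (K5), because pairs
  and absolute values are unchanged.\<close>

lemma knuth_star: "knuth n u v \<Longrightarrow> knuth n (star u) (star v)"
proof (induction rule: knuth.induct)
  case (step u v)
  then show ?case
  proof cases
    case (K1 \<alpha> \<beta> \<gamma>)
    then show ?thesis by (auto intro!: knuth_K2[THEN knuth.sym])
  next
    case (K2 \<alpha> \<beta> \<gamma>)
    then show ?thesis by (auto intro!: knuth_K1[THEN knuth.sym])
  next
    case (K3 y \<beta>)
    then have "Pos y < bar \<beta>" "bar \<beta> < Bar y" by (cases \<beta>; auto)+
    with K3 show ?thesis by (auto intro!: knuth_K4[THEN knuth.sym])
  next
    case (K4 y \<beta>)
    then have "Pos y < bar \<beta>" "bar \<beta> < Bar y" by (cases \<beta>; auto)+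
    with K4 show ?thesis by (auto intro!: knuth_K3[THEN knuth.sym])
  next
    case (K5 z)
    then have m: "minimal_nonadmissible n (star u)"
      by (intro minimal_nonadmissible_star) (auto simp: minimal_nonadmissible_def)
    then show ?thesis using knuth_contract[OF m] K5 by (simp only: contraction_letter_star contract_star)
  qed
next
  case (cong u v x y)
  then have "knuth n (star y @ star u @ star x) (star y @ star v @ star x)"
    by (intro knuth.cong) auto
  then show ?case by simp
qed (auto intro: knuth.refl knuth.sym knuth.trans)

lemma knuth_dn:
  assumes "knuth n u v" "1 \<le> i" "i \<le> n" "phi i u > 0"
  shows "knuth n (dn n i u) (dn n i v)"
proof -
  have "knuth n (up n i (star u)) (up n i (star v))"
    using assms by (intro knuth_up knuth_star) (auto simp: eps_star)
  moreover have "phi i v > 0" using knuth_eps_phi[OF assms(1-3)] assms(4) by simp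
  ultimately have "knuth n (star (dn n i u)) (star (dn n i v))"
    using assms(4) by (simp add: up_star)
  from knuth_star[OF this] show ?thesis by simp
qed

section \<open>Weights as Knuth invariants\<close>

fun wl :: "nat \<Rightarrow> letter \<Rightarrow> int" where
  "wl k (Pos j) = of_bool (j = k)"
| "wl k (Bar j) = - of_bool (j = k)"

definition wt :: "nat \<Rightarrow> word \<Rightarrow> int" where
  "wt k w = (\<Sum>x\<leftarrow>w. wl k x)"

lemma wt_simps [simp]: "wt k [] = 0" "wt k (x # w) = wl k x + wt k w" "wt k (u @ v) = wt k u + wt k v"
  by (auto simp: wt_def)

lemma wt_distinct: "distinct w \<Longrightarrow> wt k w = of_bool (Pos k \<in> set w) - of_bool (Bar k \<in> set w)"
proof (induction w)
  case (Cons x w)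
  then show ?case by (cases x) auto
qed simp

lemma knuth_wt: "knuth n u v \<Longrightarrow> wt k u = wt k v"
proof (induction rule: knuth.induct)
  case (step u v)
  then show ?case
  proof cases
    case (K5 z)
    have C: "column n u" by (rule K5(2))
    then have z: "Pos z \<in> set u" "Bar z \<in> set u"
      using contraction_letter_props(3,4)[of n u z] K5 by (auto simp: minimal_nonadmissible_def)
    have d: "distinct u" using column_distinct[OF C] .
    have "wt k (contract z u) = of_bool (Pos k \<in> set (contract z u)) - of_bool (Bar k \<in> set (contract z u))"
      using d by (intro wt_distinct distinct_filter)
    also have "\<dots> = of_bool (Pos k \<in> set u) - of_bool (Bar k \<in> set u)"
      using z by (cases "k = z") simp_all
    also have "\<dots> = wt k u" using d by (rule wt_distinct[symmetric])
    finally show ?thesis using K5(1) by simp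
  qed auto
qed auto

section \<open>Products of highest weight columns\<close>

definition seg :: "nat \<Rightarrow> nat \<Rightarrow> word" where
  "seg a b = map Pos [a..<Suc b]"

lemma seg_words: "1 \<le> a \<Longrightarrow> b \<le> n \<Longrightarrow> seg a b \<in> words n"
  by (auto simp: seg_def words_iff)

lemma length_seg [simp]: "length (seg 1 l) = l"
  by (simp add: seg_def)

lemmas length_seg_Suc [simp] = length_seg[unfolded One_nat_def]

lemma set_seg: "set (seg a b) = Pos ` {a..b}"
  by (auto simp: seg_def)

lemma seg_Suc: "a \<le> Suc b \<Longrightarrow> seg a (Suc b) = seg a b @ [Pos (Suc b)]"
  by (simp add: seg_def)

lemma seg_Cons: "a \<le> b \<Longrightarrow> seg a b = Pos a # seg (Suc a) b"
  by (simp add: seg_def upt_conv_Cons)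

lemma column_seg: "l \<le> n \<Longrightarrow> column n (seg 1 l)"
  unfolding column_def by (intro conjI seg_words) (simp_all add: seg_def sorted_wrt_map del: upt_Suc)

declare knuth.trans [trans]

lemma knuth_append:
  assumes "knuth n u u'" "knuth n v v'"
  shows "knuth n (u @ v) (u' @ v')"
proof -
  have "knuth n ([] @ u @ v) ([] @ u' @ v)"
    using assms knuth_words by (intro knuth.cong) auto
  moreover have "knuth n (u' @ v @ []) (u' @ v' @ [])"
    using assms knuth_words by (intro knuth.cong) auto
  ultimately show ?thesis by (auto intro: knuth.trans)
qed

lemma knuth_seg_insert_right:
  assumes "1 \<le> a" "a \<le> l" "l \<le> n"
  shows "knuth n (seg 1 l @ [Pos a]) (seg 1 a @ [Pos a] @ seg (Suc a) l)"
  using assms(2,3)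
proof (induction l rule: dec_induct)
  case base
  then show ?case using assms(1) by (auto simp: seg_def words_iff intro!: knuth.refl)
next
  case (step l)
  obtain k where k: "l = Suc k" using step.hyps assms(1) by (cases l) auto
  have "knuth n (seg 1 k @ [Pos l, Pos (Suc l), Pos a]) (seg 1 k @ [Pos l, Pos a, Pos (Suc l)])"
    using step assms(1) k
    by (intro knuth_append knuth_K2 knuth.refl seg_words) (auto simp: less_eq_letter_def)
  then have "knuth n (seg 1 (Suc l) @ [Pos a]) ((seg 1 l @ [Pos a]) @ [Pos (Suc l)])"
    by (simp add: seg_Suc k)
  also have "knuth n ((seg 1 l @ [Pos a]) @ [Pos (Suc l)]) ((seg 1 a @ [Pos a] @ seg (Suc a) l) @ [Pos (Suc l)])"
    using step by (intro knuth_append step.IH knuth.refl) auto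
  finally show ?case
    using step.hyps by (simp add: seg_Suc)
qed

lemma knuth_seg_insert_left:
  assumes "j < a" "a \<le> n"
  shows "knuth n (seg 1 j @ [Pos a] @ seg (Suc j) a) (Pos a # seg 1 a)"
  using assms(1)
proof (induction j)
  case 0
  then show ?case using assms(2) by (auto simp: seg_def words_iff intro!: knuth.refl)
next
  case (Suc j)
  have "knuth n (seg 1 j @ [Pos (Suc j), Pos a, Pos (Suc (Suc j))] @ seg (Suc (Suc (Suc j))) a)
     (seg 1 j @ [Pos a, Pos (Suc j), Pos (Suc (Suc j))] @ seg (Suc (Suc (Suc j))) a)"
    using Suc.prems assms(2)
    by (intro knuth_append knuth_K1 knuth.refl seg_words) (auto simp: less_eq_letter_def)
  then have "knuth n (seg 1 (Suc j) @ [Pos a] @ seg (Suc (Suc j)) a) (seg 1 j @ [Pos a] @ seg (Suc j) a)"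
    using Suc.prems seg_Cons[of "Suc j" a] seg_Cons[of "Suc (Suc j)" a] seg_Suc[of 1 j] by simp
  then show ?case using Suc by (auto intro: knuth.trans)
qed

text \<open>By (K2) the letter passes to the left of all larger ones and stops beside its copy in
  the column; by (K1) one of the two copies then travels to the front. All letters are unbarred, so
  the exceptional pairs of both relations do not occur.\<close>

lemma knuth_seg_commute_letter:
  assumes "1 \<le> a" "a \<le> l" "l \<le> n"
  shows "knuth n (seg 1 l @ [Pos a]) (Pos a # seg 1 l)"
proof -
  obtain k where k: "a = Suc k" using assms(1) by (cases a) auto
  have "knuth n (seg 1 k @ [Pos a] @ seg (Suc k) a) (Pos a # seg 1 a)"
    using assms k by (intro knuth_seg_insert_left) auto
  then have "knuth n (seg 1 a @ [Pos a]) (Pos a # seg 1 a)"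
    by (simp add: k seg_Suc) (simp add: seg_def)
  then have "knuth n ((seg 1 a @ [Pos a]) @ seg (Suc a) l) ((Pos a # seg 1 a) @ seg (Suc a) l)"
    using assms by (intro knuth_append knuth.refl seg_words) auto
  moreover have "seg 1 a @ seg (Suc a) l = seg 1 l"
    using upt_add_eq_append[of 1 "Suc a" "l - a"] assms by (simp add: seg_def del: upt_Suc flip: map_append)
  ultimately show ?thesis using knuth_seg_insert_right[OF assms] by (auto intro: knuth.trans)
qed

lemma knuth_seg_commute:
  assumes "set w \<subseteq> Pos ` {1..l}" "l \<le> n"
  shows "knuth n (seg 1 l @ w) (w @ seg 1 l)"
  using assms(1)
proof (induction w)
  case Nil
  then show ?case using assms(2) by (auto intro!: knuth.refl seg_words)
next
  case (Cons x w)
  then obtain a where a: "x = Pos a" "1 \<le> a" "a \<le> l" by auto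
  have w: "w \<in> words n" using Cons.prems assms(2) by (auto simp: words_iff)
  have "knuth n ((seg 1 l @ [Pos a]) @ w) ((Pos a # seg 1 l) @ w)"
    using a assms(2) w by (intro knuth_append knuth_seg_commute_letter knuth.refl) auto
  moreover have "knuth n ([Pos a] @ (seg 1 l @ w)) ([Pos a] @ (w @ seg 1 l))"
    using a assms(2) Cons by (intro knuth_append[OF knuth.refl Cons.IH]) auto
  ultimately show ?case using a by (auto intro: knuth.trans)
qed

lemma knuth_seg_swap:
  assumes "l \<le> n" "l' \<le> n"
  shows "knuth n (seg 1 l @ seg 1 l') (seg 1 l' @ seg 1 l)"
proof (cases "l' \<le> l")
  case True
  then show ?thesis using assms by (intro knuth_seg_commute) (auto simp: set_seg)
next
  case False
  then show ?thesis using assms by (intro knuth.sym[OF knuth_seg_commute]) (auto simp: set_seg)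
qed

definition hw :: "nat list \<Rightarrow> word" where
  "hw ls = concat (map (seg 1) ls)"

lemma hw_simps [simp]: "hw [] = []" "hw (l # ls) = seg 1 l @ hw ls" "hw (ks @ ls) = hw ks @ hw ls"
  by (auto simp: hw_def)

lemma hw_words: "set ls \<subseteq> {..n} \<Longrightarrow> hw ls \<in> words n"
  by (induction ls) (auto simp: seg_words)

lemma knuth_hw_move: "l \<le> n \<Longrightarrow> set ks \<subseteq> {..n} \<Longrightarrow> knuth n (seg 1 l @ hw ks) (hw ks @ seg 1 l)"
proof (induction ks)
  case Nil
  then show ?case by (auto intro!: knuth.refl seg_words)
next
  case (Cons k ks)
  have "knuth n ((seg 1 l @ seg 1 k) @ hw ks) ((seg 1 k @ seg 1 l) @ hw ks)"
    using Cons.prems by (intro knuth_append knuth_seg_swap knuth.refl hw_words) auto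
  moreover have "knuth n (seg 1 k @ (seg 1 l @ hw ks)) (seg 1 k @ (hw ks @ seg 1 l))"
    using Cons by (intro knuth_append[OF knuth.refl Cons.IH] seg_words) auto
  ultimately show ?case by (auto intro: knuth.trans)
qed

text \<open>Highest weight columns commute pairwise. Pulled back along raising paths, this permits
  rearranging the column lengths of a word.\<close>

lemma knuth_hw_perm:
  assumes "mset ls = mset ls'" "set ls \<subseteq> {..n}"
  shows "knuth n (hw ls) (hw ls')"
  using assms
proof (induction ls arbitrary: ls')
  case Nil
  then show ?case by (auto intro!: knuth.refl)
next
  case (Cons l ls)
  have "l \<in> set ls'" using Cons.prems(1) by (metis list.set_intros(1) set_mset_mset)
  then obtain ks ms where ls': "ls' = ks @ l # ms" by (metis split_list)
  have s: "set ls' \<subseteq> {..n}" using Cons.prems by (metis set_mset_mset)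
  have "mset ls = mset (ks @ ms)" using Cons.prems(1) ls' by simp
  then have "knuth n (seg 1 l @ hw ls) (seg 1 l @ hw (ks @ ms))"
    using Cons by (intro knuth_append[OF knuth.refl Cons.IH] seg_words) auto
  moreover have "knuth n ((seg 1 l @ hw ks) @ hw ms) ((hw ks @ seg 1 l) @ hw ms)"
    using Cons.prems s ls' by (intro knuth_append knuth_hw_move knuth.refl hw_words) auto
  ultimately show ?case using ls' by (auto intro: knuth.trans)
qed


section \<open>Paths of raising operators\<close>

fun raises :: "nat \<Rightarrow> nat list \<Rightarrow> word \<Rightarrow> word \<Rightarrow> bool" where
  "raises n [] w h \<longleftrightarrow> w = h"
| "raises n (i # p) w h \<longleftrightarrow> 1 \<le> i \<and> i \<le> n \<and> eps i w > 0 \<and> raises n p (up n i w) h"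

lemma raises_append: "raises n (p @ q) w h \<longleftrightarrow> (\<exists>v. raises n p w v \<and> raises n q v h)"
  by (induction p arbitrary: w) auto

lemma raises_words: "raises n p w h \<Longrightarrow> w \<in> words n \<Longrightarrow> h \<in> words n"
  by (induction p arbitrary: w) (auto simp: up_words)

lemma raises_knuth: "raises n p w h \<Longrightarrow> knuth n w w' \<Longrightarrow> \<exists>h'. raises n p w' h' \<and> knuth n h h'"
proof (induction p arbitrary: w w')
  case (Cons i p)
  then show ?case using knuth_up[of n w w' i] knuth_eps_phi(1)[of n w w' i] by auto
qed auto

text \<open>Each raising is undone by \<open>dn\<close>, which also respects equivalence; so
  equivalence at the end of a common path descends to its start.\<close>

lemma raises_knuth_rev:
  "raises n p w h \<Longrightarrow> raises n p w' h' \<Longrightarrow> knuth n h h' \<Longrightarrow> w \<in> words n \<Longrightarrow> w' \<in> words n \<Longrightarrow> knuth n w w'"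
proof (induction p arbitrary: w w')
  case (Cons i p)
  then have i: "1 \<le> i" "i \<le> n" and e: "eps i w > 0" "eps i w' > 0" by auto
  have "knuth n (up n i w) (up n i w')" using Cons by (auto simp: up_words)
  then have "knuth n (dn n i (up n i w)) (dn n i (up n i w'))"
    using i e Cons.prems by (intro knuth_dn) (auto simp: phi_up)
  then show ?case using i e Cons.prems by (simp add: dn_up)
qed auto

lemma raises_inj: "raises n p w h \<Longrightarrow> raises n p w' h \<Longrightarrow> w \<in> words n \<Longrightarrow> w' \<in> words n \<Longrightarrow> w = w'"
proof (induction p arbitrary: w w')
  case (Cons i p)
  then have i: "1 \<le> i" "i \<le> n" and e: "eps i w > 0" "eps i w' > 0" by auto
  have "up n i w = up n i w'"
    by (rule Cons.IH) (use Cons.prems in \<open>auto simp: up_words\<close>)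
  then have "dn n i (up n i w) = dn n i (up n i w')" by simp
  then show ?case using i e Cons.prems by (simp add: dn_up)
qed auto

text \<open>Pulls an equivalence of the middle factor back along the path. Since only
  \<open>eps\<close> and \<open>phi\<close> of that factor matter, the same one of the three factors
  moves after the replacement; where the middle one was raised, its substitute is lowered.\<close>

lemma raises_replace:
  assumes "raises n p (a @ y @ c) (a0 @ y0 @ c0)" "length a = length a0" "length c = length c0"
    "knuth n y0 k0" "a @ y @ c \<in> words n"
  shows "\<exists>k. knuth n y k \<and> raises n p (a @ k @ c) (a0 @ k0 @ c0)"
  using assms
proof (induction p arbitrary: a y c)
  case Nil
  then have "y = y0" "c = c0" "a = a0" by auto
  then show ?case using Nil by auto
next
  case (Cons i p)
  from Cons.prems have i: "1 \<le> i" "i \<le> n" and pos: "eps i (a @ y @ c) > 0"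
    and r: "raises n p (up n i (a @ y @ c)) (a0 @ y0 @ c0)"
    and w: "a \<in> words n" "y \<in> words n" "c \<in> words n" by auto
  note len = Cons.prems(2,3) and kn = Cons.prems(4)
  have pos': "eps i (a @ k @ c) > 0" if "knuth n y k" for k
    using pos knuth_eps_phi[OF that i] by (simp add: eps_append)
  consider (c) "eps i (y @ c) > phi i a" "eps i c > phi i y"
    | (y) "eps i (y @ c) > phi i a" "eps i c \<le> phi i y" "eps i y > 0"
    | (a) "eps i (y @ c) \<le> phi i a" "eps i a > 0"
    using pos by (cases "eps i (y @ c) > phi i a"; cases "eps i c > phi i y") (auto simp: eps_append)
  then show ?case
  proof cases
    case c
    have u: "up n i (a @ k @ c) = a @ k @ up n i c" if "eps i k = eps i y" "phi i k = phi i y" for k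
      using c that by (simp add: up_append_right eps_append)
    have "up n i c \<in> words n" using c w i by (intro up_words) auto
    then obtain k where k: "knuth n y k" "raises n p (a @ k @ up n i c) (a0 @ k0 @ c0)"
      using Cons.IH[of a y "up n i c"] r u[of y] len kn w by auto
    then show ?thesis using u[of k] knuth_eps_phi[OF k(1) i] pos' i by auto
  next
    case y
    have u: "up n i (a @ k @ c) = a @ up n i k @ c" if "eps i k = eps i y" "phi i k = phi i y" for k
      using y that by (simp add: up_append_right up_append_left eps_append)
    have "up n i y \<in> words n" using y w i by (intro up_words) auto
    then obtain k where k: "knuth n (up n i y) k" "raises n p (a @ k @ c) (a0 @ k0 @ c0)"
      using Cons.IH[of a "up n i y" c] r u[of y] len kn w by auto
    have pk: "phi i (up n i y) > 0" using y w i by (simp add: phi_up)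
    then have "phi i k > 0" using knuth_eps_phi[OF k(1) i] by simp
    then have ud: "up n i (dn n i k) = k" using k(1) knuth_words i by (intro up_dn) auto
    have "knuth n (dn n i (up n i y)) (dn n i k)" by (rule knuth_dn[OF k(1) i pk])
    then have yk: "knuth n y (dn n i k)" using y w i by (simp add: dn_up)
    then show ?thesis
      using k(2) u[of "dn n i k"] ud knuth_eps_phi[OF yk i] pos'[OF yk] i by auto
  next
    case a
    have u: "up n i (a @ k @ c) = up n i a @ k @ c" if "eps i k = eps i y" "phi i k = phi i y" for k
      using a that by (simp add: up_append_left eps_append)
    have "up n i a \<in> words n" using a w i by (intro up_words) auto
    then obtain k where k: "knuth n y k" "raises n p (up n i a @ k @ c) (a0 @ k0 @ c0)"
      using Cons.IH[of "up n i a" y c] r u[of y] len kn w by auto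
    then show ?thesis using u[of k] knuth_eps_phi[OF k(1) i] pos' i by auto
  qed
qed

section \<open>Products of columns and their weights\<close>

text \<open>Prescribing the lengths makes the factorization unique, so that factors of equal words
  can be identified.\<close>

fun colprod :: "nat \<Rightarrow> nat list \<Rightarrow> word \<Rightarrow> bool" where
  "colprod n [] w \<longleftrightarrow> w = []"
| "colprod n (l # ls) w \<longleftrightarrow> (\<exists>c v. w = c @ v \<and> column n c \<and> length c = l \<and> colprod n ls v)"

lemma colprod_Cons: "column n c \<Longrightarrow> length c = l \<Longrightarrow> colprod n ls v \<Longrightarrow> colprod n (l # ls) (c @ v)"
  by (simp, blast)

lemma colprod_append: "colprod n (ks @ ls) w \<longleftrightarrow> (\<exists>u v. w = u @ v \<and> colprod n ks u \<and> colprod n ls v)"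
  by (induction ks arbitrary: w) (auto; metis append.assoc)+

lemma colprod_words: "colprod n ls w \<Longrightarrow> w \<in> words n"
  by (induction ls arbitrary: w) (auto dest: columnD(1))

lemma colprod_length: "colprod n ls w \<Longrightarrow> length w = sum_list ls"
  by (induction ls arbitrary: w) auto

lemma column_dn:
  assumes "column n C" "1 \<le> i" "i \<le> n" "phi i C > 0"
  shows "column n (dn n i C)"
proof -
  have "column n (up n i (star C))"
    using assms by (intro column_crystal(3) column_star) (simp_all add: eps_star)
  then have "column n (star (dn n i C))" using assms(4) by (simp add: up_star)
  from column_star[OF this] show ?thesis by simp
qed

lemma colprod_up: "colprod n ls w \<Longrightarrow> 1 \<le> i \<Longrightarrow> i \<le> n \<Longrightarrow> eps i w > 0 \<Longrightarrow> colprod n ls (up n i w)"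
proof (induction ls arbitrary: w)
  case (Cons l ls)
  then obtain c v where w: "w = c @ v" "column n c" "length c = l" "colprod n ls v" by auto
  have "eps i (c @ v) > 0" using Cons.prems w by simp
  then show ?case
  proof (rule up_append[where n = n])
    assume "eps i v > 0" "up n i (c @ v) = c @ up n i v"
    then show ?thesis
      unfolding w(1) using Cons w by (auto intro!: colprod_Cons simp del: colprod.simps)
  next
    assume "eps i c > 0" "up n i (c @ v) = up n i c @ v"
    then show ?thesis
      unfolding w(1) using Cons.prems w column_crystal(3)[OF w(2)] by (auto intro!: colprod_Cons simp del: colprod.simps)
  qed
qed simp

lemma colprod_dn: "colprod n ls w \<Longrightarrow> 1 \<le> i \<Longrightarrow> i \<le> n \<Longrightarrow> phi i w > 0 \<Longrightarrow> colprod n ls (dn n i w)"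
proof (induction ls arbitrary: w)
  case (Cons l ls)
  then obtain c v where w: "w = c @ v" "column n c" "length c = l" "colprod n ls v" by auto
  show ?case
  proof (cases "phi i c > eps i v")
    case True
    then have "column n (dn n i c)" using w(2) Cons.prems by (intro column_dn) auto
    then show ?thesis
      unfolding w(1) dn_append_left[OF True] using w by (auto intro!: colprod_Cons simp del: colprod.simps)
  next
    case False
    then have "phi i v > 0" using Cons.prems(4) w by (simp add: phi_append)
    then show ?thesis
      unfolding w(1) using w dn_append_right[of i c v n] False Cons
      by (auto intro!: colprod_Cons simp del: colprod.simps)
  qed
qed simp

lemma colprod_raises_rev:
  "raises n p w h \<Longrightarrow> w \<in> words n \<Longrightarrow> colprod n ls h \<Longrightarrow> colprod n ls w"
proof (induction p arbitrary: w)
  case (Cons i p)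
  then have i: "1 \<le> i" "i \<le> n" and e: "eps i w > 0" by auto
  have "colprod n ls (up n i w)" using Cons by (auto simp: up_words)
  then have "colprod n ls (dn n i (up n i w))"
    using i e Cons.prems(2) by (intro colprod_dn) (auto simp: phi_up)
  then show ?case using i e Cons.prems by (simp add: dn_up)
qed simp

lemma colprod_hw: "set ls \<subseteq> {..n} \<Longrightarrow> colprod n ls (hw ls)"
proof (induction ls)
  case (Cons l ls)
  then show ?case unfolding hw_simps by (intro colprod_Cons column_seg length_seg) auto
qed simp

section \<open>Partial sums of weights and their bounds\<close>

definition H :: "nat \<Rightarrow> word \<Rightarrow> int" where
  "H m w = (\<Sum>k = 1..m. wt k w)"

lemma H_append [simp]: "H m (u @ v) = H m u + H m v" "H m [] = 0"
  by (simp_all add: H_def sum.distrib)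

lemma knuth_H: "knuth n u v \<Longrightarrow> H m u = H m v"
  by (simp add: H_def knuth_wt)

lemma wt_up:
  assumes "w \<in> words n" "1 \<le> i" "i \<le> n" "eps i w > 0"
  shows "wt k (up n i w) = wt k w + of_bool (k = i) + (if i = n then of_bool (k = i) else - of_bool (k = Suc i))"
  using assms
proof (induction w)
  case (Cons x w)
  show ?case
  proof (cases "sg i x = -1 \<and> eps i w = 0")
    case True
    then show ?thesis using Cons.prems by (cases x) (auto split: if_splits)
  next
    case False
    then have "eps i w > 0" using Cons.prems(4) sg_cases[of i x] by (auto split: if_splits)
    with False Cons show ?thesis by auto
  qed
qed simp

text \<open>Up to a factor at \<open>m = n\<close>, \<open>H m\<close> pairs the weight with a
  fundamental coweight, and raising adds the simple root of \<open>i\<close>. Sums with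
  \<open>m > n\<close> also grow for \<open>i = n\<close>, whence the bound on
  \<open>m\<close>.\<close>

lemma H_up:
  assumes "w \<in> words n" "1 \<le> i" "i \<le> n" "eps i w > 0"
  shows "H m w \<le> H m (up n i w)" "m \<noteq> i \<Longrightarrow> m \<le> n \<Longrightarrow> H m (up n i w) = H m w" "H i w < H i (up n i w)"
proof -
  have s: "(\<Sum>k = 1..m. of_bool (k = j)) = (of_bool (1 \<le> j \<and> j \<le> m) :: int)" for j m :: nat
    by (simp only: of_bool_def sum.delta[OF finite_atLeastAtMost] atLeastAtMost_iff)
  have "H m (up n i w) = H m w + of_bool (i \<le> m) + (if i = n then of_bool (i \<le> m) else - of_bool (Suc i \<le> m))" for m
  proof -
    have "H m (up n i w) = (\<Sum>k = 1..m. wt k w) + (\<Sum>k = 1..m. of_bool (k = i))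
        + (\<Sum>k = 1..m. if i = n then of_bool (k = i) else - of_bool (k = Suc i))"
      unfolding H_def wt_up[OF assms] sum.distrib ..
    also have "(\<Sum>k = 1..m. if i = n then of_bool (k = i) else - of_bool (k = Suc i))
      = (if i = n then (\<Sum>k = 1..m. of_bool (k = i)) else - (\<Sum>k = 1..m. of_bool (k = Suc i)) :: int)"
      by (cases "i = n") (simp_all only: sum_negf if_True if_False simp_thms)
    finally show ?thesis
      unfolding s using assms(2) by (simp add: H_def)
  qed
  then show "H m w \<le> H m (up n i w)" "m \<noteq> i \<Longrightarrow> m \<le> n \<Longrightarrow> H m (up n i w) = H m w" "H i w < H i (up n i w)"
    using assms by (auto simp: of_bool_def split: if_splits)
qed

text \<open>The value of \<open>H m\<close> on \<open>hw ls\<close>, and an upper bound for it on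
  every product of columns of lengths \<open>ls\<close>.\<close>

definition cap :: "nat list \<Rightarrow> nat \<Rightarrow> int" where
  "cap ls m = (\<Sum>l\<leftarrow>ls. int (min l m))"

lemma cap_simps [simp]: "cap [] m = 0" "cap (l # ls) m = int (min l m) + cap ls m" "cap (ks @ ls) m = cap ks m + cap ls m"
  by (simp_all add: cap_def)

lemma cap_perm: "mset ks = mset ls \<Longrightarrow> cap ks = cap ls"
  unfolding cap_def by (rule ext) (metis (no_types) mset_map sum_mset_sum_list)

lemma H_column_le:
  assumes "column n C"
  shows "H m C \<le> int (card (Pos -` set C \<inter> {1..m}))"
proof -
  have "H m C \<le> (\<Sum>k = 1..m. of_bool (Pos k \<in> set C))"
    unfolding H_def wt_distinct[OF column_distinct[OF assms]] by (intro sum_mono) simp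
  also have "\<dots> = int (card (Pos -` set C \<inter> {1..m}))"
  proof -
    have "{1..m} \<inter> {k. Pos k \<in> set C} = Pos -` set C \<inter> {1..m}" by auto
    then show ?thesis by (simp add: of_bool_def sum.If_cases)
  qed
  finally show ?thesis .
qed

lemma card_pos_le:
  assumes "column n C"
  shows "card (Pos -` set C \<inter> {1..m}) \<le> min (length C) m"
proof -
  have "card (Pos -` set C \<inter> {1..m}) = card (Pos ` (Pos -` set C \<inter> {1..m}))"
    by (intro card_image[symmetric]) (auto simp: inj_on_def)
  also have "\<dots> \<le> card (set C)" by (intro card_mono) auto
  finally have 1: "card (Pos -` set C \<inter> {1..m}) \<le> length C"
    using card_length[of C] by simp
  have "card (Pos -` set C \<inter> {1..m}) \<le> card {1..m}" by (intro card_mono) auto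
  then show ?thesis using 1 by simp
qed

lemma H_column: "column n C \<Longrightarrow> H m C \<le> int (min (length C) m)"
  using H_column_le card_pos_le by (meson order.trans of_nat_mono)

text \<open>To reach the bound at \<open>m = length C\<close>, all of \<open>1, ..., m\<close> must
  occur unbarred, which leaves no room for another letter.\<close>

lemma column_full:
  assumes C: "column n C" and f: "H (length C) C = int (length C)"
  shows "C = seg 1 (length C)" "length C \<le> n"
proof -
  let ?l = "length C"
  have "?l \<le> card (Pos -` set C \<inter> {1..?l})" using H_column_le[OF C, of ?l] f by simp
  then have "Pos -` set C \<inter> {1..?l} = {1..?l}"
    by (intro card_subset_eq) (use card_pos_le[OF C, of ?l] in auto)
  then have sub: "Pos ` {1..?l} \<subseteq> set C" by auto
  have "card (Pos ` {1..?l}) = ?l" by (simp add: card_image inj_on_def)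
  then have eq: "Pos ` {1..?l} = set C"
    using sub column_distinct[OF C] by (intro card_subset_eq) (auto simp: distinct_card)
  then show l: "?l \<le> n" 
  proof (cases "?l = 0")
    case False
    then have "Pos ?l \<in> set C" unfolding eq[symmetric] by (intro imageI) (simp add: Suc_le_eq)
    then show ?thesis using column_set[OF C] by auto
  qed simp
  show "C = seg 1 ?l"
    by (rule column_eq[OF C column_seg[OF l]]) (simp only: set_seg eq)
qed

lemma H_colprod: "colprod n ls w \<Longrightarrow> H m w \<le> cap ls m"
proof (induction ls arbitrary: w)
  case (Cons l ls)
  then obtain c v where "w = c @ v" "column n c" "length c = l" "colprod n ls v" by auto
  then show ?case using H_column[of n c m] Cons.IH[of v] by simp
qed simp

text \<open>Equality in a sum of bounds forces equality for every factor.\<close>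

lemma colprod_full: "colprod n ls w \<Longrightarrow> (\<And>m. H m w = cap ls m) \<Longrightarrow> w = hw ls \<and> set ls \<subseteq> {..n}"
proof (induction ls arbitrary: w)
  case (Cons l ls)
  then obtain c v where w: "w = c @ v" "column n c" "length c = l" "colprod n ls v" by auto
  have "H m c = int (min l m) \<and> H m v = cap ls m" for m
    using H_column[OF w(2), of m] H_colprod[OF w(4), of m] Cons.prems(2)[of m] w by simp
  then show ?case using Cons.IH[OF w(4)] column_full[OF w(2)] w by auto
qed simp

lemma H_seg: "H m (seg 1 l) = int (min l m)"
proof -
  have "distinct (seg 1 l)" by (auto simp: seg_def distinct_map inj_on_def)
  then have "H m (seg 1 l) = (\<Sum>k = 1..m. of_bool (k \<le> l))"
    unfolding H_def by (intro sum.cong) (auto simp: wt_distinct set_seg)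
  also have "\<dots> = int (card {k \<in> {1..m}. k \<le> l})"
    by (simp add: of_bool_def sum.If_cases Int_def)
  also have "{k \<in> {1..m}. k \<le> l} = {1..min l m}" by auto
  finally show ?thesis by simp
qed

lemma H_hw: "H m (hw ls) = cap ls m"
  by (induction ls) (simp_all add: H_seg del: One_nat_def)


section \<open>Maximal raising\<close>

definition em :: "nat \<Rightarrow> nat \<Rightarrow> word \<Rightarrow> word" where
  "em n i w = (up n i ^^ eps i w) w"

lemma funpow_up:
  assumes "w \<in> words n" "1 \<le> i" "i \<le> n" "k \<le> eps i w"
  shows "(up n i ^^ k) w \<in> words n \<and> eps i ((up n i ^^ k) w) = eps i w - k
     \<and> phi i ((up n i ^^ k) w) = phi i w + k"
  using assms(4)
proof (induction k)
  case (Suc k)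
  then show ?case using up_words[of _ n i] eps_up[of _ n i] phi_up[of _ n i] assms by auto
qed (use assms in auto)

lemma colprod_funpow_up:
  assumes "colprod n ls w" "1 \<le> i" "i \<le> n" "k \<le> eps i w"
  shows "colprod n ls ((up n i ^^ k) w)"
  using assms(4)
proof (induction k)
  case (Suc k)
  then show ?case
    using colprod_up[of n ls _ i] funpow_up[OF colprod_words[OF assms(1)] assms(2,3), of k] assms by auto
qed (use assms in auto)

lemma em_colprod: "colprod n ls w \<Longrightarrow> 1 \<le> i \<Longrightarrow> i \<le> n \<Longrightarrow> colprod n ls (em n i w)"
  unfolding em_def by (rule colprod_funpow_up) auto

lemma knuth_funpow_up:
  assumes "knuth n w v" "1 \<le> i" "i \<le> n" "k \<le> eps i w"
  shows "knuth n ((up n i ^^ k) w) ((up n i ^^ k) v)"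
  using assms(4)
proof (induction k)
  case (Suc k)
  then show ?case
    using knuth_up[of n _ _ i] funpow_up[OF knuth_words(1)[OF assms(1)] assms(2,3), of k] assms by auto
qed (use assms in auto)

lemma knuth_em: "knuth n w v \<Longrightarrow> 1 \<le> i \<Longrightarrow> i \<le> n \<Longrightarrow> knuth n (em n i w) (em n i v)"
  unfolding em_def using knuth_funpow_up[of n w v i "eps i w"] knuth_eps_phi(1)[of n w v i] by simp

text \<open>Raising begins in \<open>v\<close> and stays there until the surplus over
  \<open>phi i u\<close> is used up; all later raisings happen in \<open>u\<close>. The first factor
  therefore ends as \<open>em n i u\<close> whatever \<open>v\<close> is, while \<open>v\<close> may
  be raised only in part.\<close>

lemma em_append:
  assumes "u @ v \<in> words n" "1 \<le> i" "i \<le> n"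
  shows "em n i (u @ v) = em n i u @ (up n i ^^ (eps i v - phi i u)) v"
proof -
  have w: "u \<in> words n" "v \<in> words n" using assms by auto
  define d where "d = eps i v - phi i u"
  have right: "k \<le> d \<Longrightarrow> (up n i ^^ k) (u @ v) = u @ (up n i ^^ k) v" for k
  proof (induction k)
    case (Suc k)
    have "eps i ((up n i ^^ k) v) = eps i v - k"
      using funpow_up[OF w(2) assms(2,3), of k] Suc.prems by (simp add: d_def)
    then show ?case using Suc by (simp add: up_append_right d_def)
  qed simp
  define v' where "v' = (up n i ^^ d) v"
  have ev': "eps i v' \<le> phi i u"
    using funpow_up[OF w(2) assms(2,3), of d] by (simp add: v'_def d_def)
  have left: "k \<le> eps i u \<Longrightarrow> (up n i ^^ k) (u @ v') = (up n i ^^ k) u @ v'" for k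
  proof (induction k)
    case (Suc k)
    have "eps i ((up n i ^^ k) u) = eps i u - k" "phi i ((up n i ^^ k) u) = phi i u + k"
      using funpow_up[OF w(1) assms(2,3), of k] Suc.prems by simp_all
    then show ?case using Suc ev' by (simp add: up_append_left)
  qed simp
  have "em n i (u @ v) = (up n i ^^ (eps i u + d)) (u @ v)"
    by (simp add: em_def eps_append d_def)
  also have "\<dots> = (up n i ^^ eps i u) (u @ v')"
    by (simp add: funpow_add right v'_def)
  also have "\<dots> = em n i u @ v'" by (simp add: left em_def)
  finally show ?thesis by (simp add: v'_def d_def)
qed

lemma H_funpow_up:
  assumes "w \<in> words n" "1 \<le> i" "i \<le> n" "k \<le> eps i w"
  shows "H m w \<le> H m ((up n i ^^ k) w)" "m \<noteq> i \<Longrightarrow> m \<le> n \<Longrightarrow> H m ((up n i ^^ k) w) = H m w"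
    "0 < k \<Longrightarrow> H i w < H i ((up n i ^^ k) w)"
proof -
  have "H m w \<le> H m ((up n i ^^ k) w) \<and> (m \<noteq> i \<and> m \<le> n \<longrightarrow> H m ((up n i ^^ k) w) = H m w)
    \<and> (0 < k \<longrightarrow> H i w < H i ((up n i ^^ k) w))"
    using assms(4)
  proof (induction k)
    case (Suc k)
    let ?v = "(up n i ^^ k) w"
    have v: "?v \<in> words n" "eps i ?v > 0" using funpow_up[OF assms(1-3), of k] Suc.prems by auto
    note h = H_up[OF v(1) assms(2,3) v(2)] and IH = Suc.IH[OF Suc_leD[OF Suc.prems]]
    have s: "(up n i ^^ Suc k) w = up n i ?v" by simp
    show ?case
      unfolding s
    proof (intro conjI impI)
      show "H m w \<le> H m (up n i ?v)" using IH h(1)[of m] by linarith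
      show "H m (up n i ?v) = H m w" if "m \<noteq> i \<and> m \<le> n" using IH h(2)[of m] that by simp
      show "H i w < H i (up n i ?v)" using IH h(3) by (cases "k = 0") auto
    qed
  qed simp
  then show "H m w \<le> H m ((up n i ^^ k) w)" "m \<noteq> i \<Longrightarrow> m \<le> n \<Longrightarrow> H m ((up n i ^^ k) w) = H m w"
    "0 < k \<Longrightarrow> H i w < H i ((up n i ^^ k) w)" by auto
qed

text \<open>Maximal raisings are defined on every word, so one and the same path can be followed for
  a word and for its prefix; a path in the sense of \<open>raises\<close> may fail on the
  prefix.\<close>

fun empath :: "nat \<Rightarrow> nat list \<Rightarrow> word \<Rightarrow> word" where
  "empath n [] w = w"
| "empath n (i # p) w = empath n p (em n i w)"

definition highest :: "nat \<Rightarrow> word \<Rightarrow> bool" where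
  "highest n w \<longleftrightarrow> (\<forall>i \<in> {1..n}. eps i w = 0)"

lemma empath_append: "empath n (p @ q) w = empath n q (empath n p w)"
  by (induction p arbitrary: w) auto

lemma empath_colprod: "colprod n ls w \<Longrightarrow> set p \<subseteq> {1..n} \<Longrightarrow> colprod n ls (empath n p w)"
  by (induction p arbitrary: w) (auto simp: em_colprod)

lemma empath_knuth: "knuth n w v \<Longrightarrow> set p \<subseteq> {1..n} \<Longrightarrow> knuth n (empath n p w) (empath n p v)"
  by (induction p arbitrary: w v) (auto simp: knuth_em)

lemma empath_highest: "highest n w \<Longrightarrow> set p \<subseteq> {1..n} \<Longrightarrow> empath n p w = w"
  by (induction p) (auto simp: highest_def em_def)

lemma empath_prefix:
  "colprod n ks u \<Longrightarrow> colprod n ls z \<Longrightarrow> set p \<subseteq> {1..n} \<Longrightarrow>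
   \<exists>z'. colprod n ls z' \<and> empath n p (u @ z) = empath n p u @ z'"
proof (induction p arbitrary: u z)
  case (Cons i p)
  then have i: "1 \<le> i" "i \<le> n" by auto
  have "em n i (u @ z) = em n i u @ (up n i ^^ (eps i z - phi i u)) z"
    using Cons.prems i by (intro em_append) (auto dest: colprod_words)
  moreover have "colprod n ls ((up n i ^^ (eps i z - phi i u)) z)"
    using Cons.prems i by (intro colprod_funpow_up) auto
  ultimately show ?case using Cons em_colprod[of n ks u i] i by auto
qed auto

section \<open>Reaching a highest weight word\<close>

definition deficit :: "nat \<Rightarrow> nat list \<Rightarrow> word \<Rightarrow> nat" where
  "deficit n ls w = nat (\<Sum>m = 1..n. cap ls m - H m w)"

text \<open>One of the sums \<open>H i\<close> grows strictly, none decreases, and all remain below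
  \<open>cap\<close>.\<close>

lemma deficit_em:
  assumes "colprod n ls w" "1 \<le> i" "i \<le> n" "eps i w > 0"
  shows "deficit n ls (em n i w) < deficit n ls w"
proof -
  note E = em_colprod[OF assms(1-3)]
  note Hf = H_funpow_up[OF colprod_words[OF assms(1)] assms(2,3) order.refl, folded em_def]
  have "(\<Sum>m = 1..n. cap ls m - H m (em n i w)) < (\<Sum>m = 1..n. cap ls m - H m w)"
    using assms Hf by (intro sum_strict_mono_ex1) auto
  moreover have "0 \<le> (\<Sum>m = 1..n. cap ls m - H m (em n i w))"
    using H_colprod[OF E] by (intro sum_nonneg) auto
  ultimately show ?thesis by (simp add: deficit_def)
qed

lemma exists_empath_highest:
  "colprod n ls w \<Longrightarrow> \<exists>p. set p \<subseteq> {1..n} \<and> highest n (empath n p w)"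
proof (induction "deficit n ls w" arbitrary: w rule: less_induct)
  case less
  show ?case
  proof (cases "highest n w")
    case True
    then show ?thesis by (intro exI[of _ "[]"]) simp
  next
    case False
    then obtain i where i: "1 \<le> i" "i \<le> n" "eps i w > 0" by (auto simp: highest_def)
    obtain p where "set p \<subseteq> {1..n}" "highest n (empath n p (em n i w))"
      using less.hyps[OF deficit_em[OF less.prems i] em_colprod[OF less.prems i(1,2)]] by blast
    then show ?thesis using i by (intro exI[of _ "i # p"]) auto
  qed
qed

text \<open>Quantifying over all maximal paths fixes the highest weight without appeal to uniqueness
  of the highest weight word. On products of columns \<open>exists_empath_highest\<close> keeps the
  condition from being vacuous.\<close>

definition full :: "nat \<Rightarrow> (nat \<Rightarrow> int) \<Rightarrow> word \<Rightarrow> bool" where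
  "full n c w \<longleftrightarrow> (\<forall>p m. set p \<subseteq> {1..n} \<longrightarrow> highest n (empath n p w) \<longrightarrow> H m (empath n p w) = c m)"

lemma knuth_highest: "knuth n w v \<Longrightarrow> highest n w \<longleftrightarrow> highest n v"
  unfolding highest_def using knuth_eps_phi(1)[of n w v] by auto

lemma full_knuth: "full n c w \<Longrightarrow> knuth n w v \<Longrightarrow> full n c v"
  unfolding full_def using empath_knuth[of n w v] knuth_highest knuth_H by metis

lemma full_em: "full n c w \<Longrightarrow> 1 \<le> i \<Longrightarrow> i \<le> n \<Longrightarrow> full n c (em n i w)"
  unfolding full_def
proof (intro allI impI)
  fix p m assume *: "\<forall>p m. set p \<subseteq> {1..n} \<longrightarrow> highest n (empath n p w) \<longrightarrow> H m (empath n p w) = c m"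
    "1 \<le> i" "i \<le> n" "set p \<subseteq> {1..n}" "highest n (empath n p (em n i w))"
  show "H m (empath n p (em n i w)) = c m"
    using *(1)[rule_format, of "i # p" m] *(2-) by auto
qed

text \<open>A path that raises the prefix to the top extends to one for the whole word without
  moving the prefix any more. There the bounds of both factors add up to the full weight, so the
  prefix attains its own.\<close>

lemma full_prefix:
  assumes "colprod n ks u" "colprod n ls z" "full n (cap (ks @ ls)) (u @ z)"
  shows "full n (cap ks) u"
  unfolding full_def
proof (intro allI impI)
  fix p m assume p: "set p \<subseteq> {1..n}" and h: "highest n (empath n p u)"
  obtain z' where z': "colprod n ls z'" "empath n p (u @ z) = empath n p u @ z'"
    using empath_prefix[OF assms(1,2) p] by auto
  note U = empath_colprod[OF assms(1) p]
  have "colprod n (ks @ ls) (empath n p u @ z')" using U z' by (auto simp: colprod_append)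
  then obtain q where q: "set q \<subseteq> {1..n}" "highest n (empath n q (empath n p u @ z'))"
    using exists_empath_highest by blast
  obtain z'' where z'': "colprod n ls z''" "empath n q (empath n p u @ z') = empath n p u @ z''"
    using empath_prefix[OF U z'(1) q(1)] empath_highest[OF h q(1)] by auto
  have "H m (empath n (p @ q) (u @ z)) = cap (ks @ ls) m"
    using assms(3)[unfolded full_def, rule_format, of "p @ q"] p q z' by (simp add: empath_append)
  then have "H m (empath n p u) + H m z'' = cap ks m + cap ls m"
    using z' z'' by (simp add: empath_append)
  then show "H m (empath n p u) = cap ks m"
    using H_colprod[OF U, of m] H_colprod[OF z''(1), of m] by simp
qed

lemma eps_phi_seg:
  assumes "l \<le> n" "1 \<le> i" "i \<le> n"
  shows "eps i (seg 1 l) = 0" "phi i (seg 1 l) = of_bool (i = l)"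
  unfolding column_crystal(1,2)[OF column_seg[OF assms(1)] assms(2,3)] using assms by (auto simp: set_seg)

text \<open>
  In a word of full weight that starts with the highest weight column of length \<open>l\<close>, the
  operator for \<open>l\<close> cannot act: after it has acted, \<open>X\<close> always retains a letter that could still be
  raised, but only the operator for \<open>l\<close> increases \<open>H l\<close>.
\<close>

lemma full_seg_eps:
  assumes X: "column n X" and l: "1 \<le> l" "l \<le> n" and f: "full n (cap [l, length X]) (seg 1 l @ X)"
  shows "eps l (seg 1 l @ X) = 0"
proof (rule ccontr)
  assume "eps l (seg 1 l @ X) \<noteq> 0"
  \<comment> \<open>The one uncancelled letter of sign +1 in \<open>seg 1 l\<close> absorbs one
    letter of \<open>X\<close>.\<close>
  then have e2: "eps l X \<ge> 2" by (simp add: eps_append eps_phi_seg[OF l(2) l] del: One_nat_def)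
  let ?c = "int (min (length X) l)"
  let ?Q = "\<lambda>X'. colprod n [length X] X' \<and> H l X' < ?c"
  note HX = H_colprod[of n "[length X]" _ l, simplified cap_simps add_0_right]
  have "?Q X"
  proof
    show XX: "colprod n [length X] X" using X by simp
    have "colprod n [length X] (up n l X)" using XX l e2 by (intro colprod_up) auto
    then show "H l X < ?c"
      using HX H_up(3)[OF columnD(1)[OF X] l] e2 by fastforce
  qed
  have step: "\<exists>Y'. em n j (seg 1 l @ Y) = seg 1 l @ Y' \<and> ?Q Y'" if Q: "?Q Y" and j: "1 \<le> j" "j \<le> n" for Y j
  proof -
    have Y: "Y \<in> words n" using Q colprod_words by blast
    have "em n j (seg 1 l) = seg 1 l" using j l by (simp add: em_def eps_phi_seg[OF l(2) j] del: One_nat_def)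
    then have 1: "em n j (seg 1 l @ Y) = seg 1 l @ (up n j ^^ (eps j Y - of_bool (j = l))) Y"
      using em_append[of "seg 1 l" Y n j] j l Y seg_words[of 1 l n] by (simp add: eps_phi_seg[OF l(2) j] del: One_nat_def)
    let ?Y = "(up n j ^^ (eps j Y - of_bool (j = l))) Y"
    have C: "colprod n [length X] ?Y" using Q j by (intro colprod_funpow_up) auto
    have "H l ?Y < ?c"
    proof (cases "j = l")
      case False
      then show ?thesis using H_funpow_up(2)[OF Y j, of "eps j Y" l] Q l by simp
    next
      case True
      show ?thesis
      proof (cases "eps l Y = 0")
        case True
        then show ?thesis using Q \<open>j = l\<close> by simp
      next
        case False
        then have "eps l ?Y = 1" using funpow_up[OF Y j, of "eps j Y - 1"] \<open>j = l\<close> by simp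
        then have "colprod n [length X] (up n l ?Y)" "H l ?Y < H l (up n l ?Y)"
          using colprod_up[OF C l] H_up(3)[OF colprod_words[OF C] l] by simp_all
        then show ?thesis using HX by fastforce
      qed
    qed
    then show ?thesis using 1 C by blast
  qed
  have path: "set p \<subseteq> {1..n} \<Longrightarrow> ?Q Y \<Longrightarrow> \<exists>Y'. empath n p (seg 1 l @ Y) = seg 1 l @ Y' \<and> ?Q Y'" for p Y
  proof (induction p arbitrary: Y)
    case (Cons j p)
    then show ?case using step[OF Cons.prems(2), of j] by fastforce
  qed auto
  have "colprod n [l, length X] (seg 1 l @ X)" using X column_seg[OF l(2)] by (intro colprod_Cons) simp_all
  then obtain p where p: "set p \<subseteq> {1..n}" "highest n (empath n p (seg 1 l @ X))"
    using exists_empath_highest by blast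
  obtain Y where Y: "empath n p (seg 1 l @ X) = seg 1 l @ Y" "?Q Y"
    using path[OF p(1) \<open>?Q X\<close>] by blast
  have "H l (empath n p (seg 1 l @ X)) = cap [l, length X] l"
    using f[unfolded full_def] p by blast
  then show False using Y by (simp add: H_seg del: One_nat_def)
qed

section \<open>Tableaux of partition shape\<close>

lemma nth_up:
  "p < length w \<Longrightarrow> up n i w ! p = w ! p \<or> (sg i (w ! p) = -1 \<and> up n i w ! p = upl n i (w ! p))"
proof (induction w arbitrary: p)
  case (Cons x w)
  then show ?case by (cases p) auto
qed simp

text \<open>A raised letter has sign +1 and cannot be raised again by the same operator, so each
  position changes at most once.\<close>

lemma nth_funpow_up:
  assumes "w \<in> words n" "1 \<le> i" "i \<le> n" "p < length w"
  shows "(up n i ^^ k) w ! p = w ! p \<or> (sg i (w ! p) = -1 \<and> (up n i ^^ k) w ! p = upl n i (w ! p))"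
proof (induction k)
  case (Suc k)
  have len: "length ((up n i ^^ k) w) = length w" for k by (induction k) auto
  have "w ! p \<in> letters n" using assms by (auto simp: words_iff)
  then have "sg i (w ! p) = -1 \<Longrightarrow> sg i (upl n i (w ! p)) = 1" using upl_props(2) assms by blast
  then show ?case using nth_up[of p "(up n i ^^ k) w" n i] Suc assms(4) by (auto simp: len)
qed simp

lemma length_funpow_up [simp]: "length ((up n i ^^ k) w) = length w"
  by (induction k) auto

lemma nth_funpow_up_le:
  assumes "w \<in> words n" "1 \<le> i" "i \<le> n" "p < length w"
  shows "(up n i ^^ k) w ! p \<le> w ! p"
proof -
  have "w ! p \<in> letters n" using assms by (auto simp: words_iff)
  then show ?thesis
    using nth_funpow_up[OF assms, of k] upl_props(4)[of "w ! p" n i] assms by auto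
qed

text \<open>Condenses the three cases for the row conditions. If the left column changes at all,
  then all its uncancelled minus letters are raised and \<open>C\<close> has no uncancelled
  plus.\<close>

lemma split_up_funpow:
  assumes C: "column n C" and i: "1 \<le> i" "i \<le> n" and e: "eps i C > 0"
  obtains k m where "rcol n (up n i C) = (up n i ^^ k) (rcol n C)"
    "lcol n (up n i C) = (up n i ^^ m) (lcol n C)"
    "m = 0 \<or> (0 < m \<and> m = eps i (lcol n C) \<and> phi i C = 0)"
proof -
  have p0: "phi i C = 0" if "phi i (rcol n C) = 0" "eps i (lcol n C) > 0"
    using eps_phi_split(2)[OF C i] that lcol_column[OF C] pair_free_lset
      pair_free_up(4)[of n "lcol n C" i] i by (simp add: phi_append)
  from split_up_words[OF C i e] show thesis
  proof cases
    case 1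
    then show thesis using that[of 0 2] p0 by (simp add: numeral_2_eq_2)
  next
    case 2
    then show thesis using that[of 1 1] p0 by simp
  next
    case 3
    then show thesis using that[of 2 0] by (simp add: numeral_2_eq_2)
  qed
qed

section \<open>Row conditions between neighbouring split columns\<close>

definition rowle :: "word \<Rightarrow> word \<Rightarrow> bool" where
  "rowle X Y \<longleftrightarrow> length Y \<le> length X \<and> (\<forall>p < length Y. X ! p \<le> Y ! p)"

text \<open>Here \<open>Y\<close> stands to the left of \<open>X\<close>. Raising replaces a letter
  by its predecessor in \<open>letters n\<close>, so a row can break only where both columns have
  the same letter \<open>Pos (Suc i)\<close> or \<open>Bar i\<close>. Because
  \<open>eps i Y = 0\<close>, \<open>Y\<close> contains \<open>Pos i\<close> or
  \<open>Bar (Suc i)\<close>, respectively; the rows force it into \<open>X\<close> too, and then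
  \<open>X\<close>, having no pairs, has nothing to raise.\<close>

lemma rowle_raise_right:
  assumes Y: "column n Y" "pair_free (set Y)" and X: "column n X" "pair_free (set X)"
    and i: "1 \<le> i" "i \<le> n" and le: "rowle Y X" and e: "eps i X > 0" "eps i Y = 0"
  shows "rowle Y ((up n i ^^ k) X)"
  unfolding rowle_def length_funpow_up
proof (intro conjI allI impI)
  show "length X \<le> length Y" using le by (simp add: rowle_def)
  have le': "X ! q \<ge> Y ! q" "q < length Y" if "q < length X" for q
    using le that by (auto simp: rowle_def)
  fix p assume p: "p < length X"
  note YL = column_set[OF Y(1)] and XL = column_set[OF X(1)]
  have yl: "Y ! p \<in> letters n" using le'(2)[OF p] YL nth_mem by blast
  have xl: "X ! p \<in> letters n" "X ! p \<in> set X" using p XL nth_mem by blast+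
  note eX = e(1)[unfolded column_crystal(1)[OF X(1) i]] and eY = e(2)[unfolded column_crystal(1)[OF Y(1) i]]
  have pfX: "\<not> (Pos j \<in> set X \<and> Bar j \<in> set X)" and pfY: "\<not> (Pos j \<in> set Y \<and> Bar j \<in> set Y)" for j
    using X(2) Y(2) by (auto simp: pair_free_def)
  \<comment> \<open>In \<open>Y\<close> the letter \<open>y\<close> stands above row
    \<open>p\<close>; in its row \<open>X\<close> has an entry that is at least \<open>y\<close> and
    smaller than \<open>X ! p\<close>, which can only be \<open>y\<close>.\<close>
  have before: "y \<in> set X" if y: "y \<in> set Y" "y < Y ! p" "Y ! p = X ! p" "\<And>x. y \<le> x \<Longrightarrow> x < X ! p \<Longrightarrow> x = y" for y
  proof -
    obtain q where q: "q < length Y" "Y ! q = y" using y(1) by (auto simp: in_set_conv_nth)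
    have qp: "q < p"
    proof (rule ccontr)
      assume "\<not> q < p"
      then have "Y ! p \<le> Y ! q"
        using columnD(2)[OF Y(1)] q(1) by (cases "p = q") (auto simp: sorted_wrt_iff_nth_less intro!: less_imp_le)
      then show False using q y(2) by simp
    qed
    then have "y \<le> X ! q" using le'(1)[of q] p q by simp
    moreover have "X ! q < X ! p" using columnD(2)[OF X(1)] qp p by (simp add: sorted_wrt_iff_nth_less)
    ultimately have "X ! q = y" by (rule y(4))
    then show ?thesis using qp p by (metis nth_mem order.strict_trans)
  qed
  consider "(up n i ^^ k) X ! p = X ! p" | "sg i (X ! p) = -1" "(up n i ^^ k) X ! p = upl n i (X ! p)"
    using nth_funpow_up[OF columnD(1)[OF X(1)] i p] by blast
  then show "Y ! p \<le> (up n i ^^ k) X ! p"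
  proof cases
    case 1
    then show ?thesis using le'(1)[OF p] by simp
  next
    case 2
    have "Y ! p \<noteq> X ! p"
    proof
      assume eq: "Y ! p = X ! p"
      then have yY: "X ! p \<in> set Y" using le'(2)[OF p] by (metis nth_mem)
      consider "X ! p = Pos (Suc i)" | "X ! p = Bar i"
        using 2(1) by (cases "X ! p") (auto split: if_splits)
      then show False
      proof cases
        case 1
        then have "Pos i \<in> set Y" using eY yY by (auto simp: of_bool_def split: if_splits)
        moreover have "x = Pos i" if "Pos i \<le> x" "x < Pos (Suc i)" for x
          using that by (cases x) (auto simp: less_eq_letter_def)
        ultimately have "Pos i \<in> set X" using before[of "Pos i"] eq 1 by auto
        then show False using eX 1 xl(2) pfX[of i] by (auto split: if_splits)
      next
        case 2
        then have "Bar (Suc i) \<in> set Y" using eY yY pfY[of i] by (auto simp: of_bool_def split: if_splits)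
        moreover have "x = Bar (Suc i)" if "Bar (Suc i) \<le> x" "x < Bar i" for x
          using that by (cases x) (auto simp: less_eq_letter_def)
        ultimately have "Bar (Suc i) \<in> set X" using before[of "Bar (Suc i)"] eq 2 by auto
        then show False using eX 2 xl(2) pfX[of i] pfX[of "Suc i"] by (auto split: if_splits)
      qed
    qed
    then have "Y ! p < X ! p" using le'(1)[OF p] by simp
    then show ?thesis
      using 2 yl i by (cases "X ! p"; cases "Y ! p") (auto simp: less_eq_letter_def split: if_splits)
  qed
qed

text \<open>Columns in reading order, so \<open>E\<close> is the left neighbour of \<open>D\<close>.
  Of the rows of the split tableau, the conditions between neighbouring columns are
  recorded.\<close>

definition kn :: "nat \<Rightarrow> word list \<Rightarrow> bool" where
  "kn n Ds \<longleftrightarrow> (\<forall>D \<in> set Ds. admissible n D) \<and> successively (\<lambda>D E. rowle (rcol n E) (lcol n D)) Ds"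

lemma admissible_column: "admissible n C \<Longrightarrow> column n C"
  by (simp add: admissible_def)

text \<open>
  If \<open>up n i\<close> changes the left column of a column \<open>D\<close> of the tableau, then \<open>phi i D = 0\<close>, so no
  uncancelled letter of sign \<open>-1\<close> can remain in the columns read later; in particular the right
  column of the left neighbour of \<open>D\<close> contains none, which rules out a violation of the rows.
\<close>

lemma kn_up:
  assumes "kn n Ds" "1 \<le> i" "i \<le> n" "eps i (concat Ds) > 0"
  shows "\<exists>Ds'. kn n Ds' \<and> up n i (concat Ds) = concat Ds'
     \<and> list_all2 (\<lambda>D D'. D' = D \<or> (eps i D > 0 \<and> D' = up n i D)) Ds Ds'"
  using assms(1,4)
proof (induction Ds)
  case (Cons D Ds)
  note i = assms(2,3)
  have aD: "admissible n D" and kDs: "kn n Ds" using Cons.prems(1) by (auto simp: kn_def successively_Cons)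
  have cD: "column n D" by (rule admissible_column[OF aD])
  show ?case
  proof (cases "eps i (concat Ds) > phi i D")
    case True
    then obtain Ds' where Ds': "kn n Ds'" "up n i (concat Ds) = concat Ds'"
      "list_all2 (\<lambda>D D'. D' = D \<or> (eps i D > 0 \<and> D' = up n i D)) Ds Ds'"
      using Cons.IH[OF kDs] by auto
    have "up n i (concat (D # Ds)) = concat (D # Ds')"
      using up_append_right[OF True, of n] Ds'(2) by simp
    moreover have "kn n (D # Ds')"
    proof (cases Ds)
      case Nil
      then show ?thesis using Ds' aD by (simp add: kn_def)
    next
      case (Cons E Es)
      then obtain E' Es' where E': "Ds' = E' # Es'" "E' = E \<or> (eps i E > 0 \<and> E' = up n i E)"
        using Ds'(3) by (auto simp: list_all2_Cons1)
      have cE: "column n E" using kDs Cons by (auto simp: kn_def admissible_column)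
      have r: "rowle (rcol n E) (lcol n D)" using Cons.prems(1) Cons by (simp add: kn_def)
      have "rowle (rcol n E') (lcol n D)"
        using E'(2)
      proof
        assume "eps i E > 0 \<and> E' = up n i E"
        then obtain k where k: "rcol n E' = (up n i ^^ k) (rcol n E)"
          using split_up_funpow[OF cE i] by metis
        note w = columnD(1)[OF rcol_column[OF cE, THEN conjunct1]]
        show ?thesis
          unfolding rowle_def k length_funpow_up
          using r nth_funpow_up_le[OF w i, of _ k] by (meson less_le_trans order.trans rowle_def)
      qed (use r in simp)
      then show ?thesis using Ds'(1) aD E'(1) by (simp add: kn_def)
    qed
    ultimately show ?thesis using Ds'(3) by (intro exI[of _ "D # Ds'"] conjI) (simp_all del: concat.simps)
  next
    case False
    then have e: "eps i D > 0" using Cons.prems(2) by (simp add: eps_append)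
    have "up n i (concat (D # Ds)) = concat (up n i D # Ds)"
      using up_append_left[of i "concat Ds" D n] False e by simp
    moreover have "kn n (up n i D # Ds)"
    proof (cases Ds)
      case Nil
      then show ?thesis using aD admissible_up_iff[OF cD i e] by (simp add: kn_def)
    next
      case (Cons E Es)
      have cE: "column n E" using kDs Cons by (auto simp: kn_def admissible_column)
      have r: "rowle (rcol n E) (lcol n D)" using Cons.prems(1) Cons by (simp add: kn_def)
      obtain m where m: "lcol n (up n i D) = (up n i ^^ m) (lcol n D)"
        "m = 0 \<or> (0 < m \<and> m = eps i (lcol n D) \<and> phi i D = 0)"
        using split_up_funpow[OF cD i e] by metis
      have "rowle (rcol n E) (lcol n (up n i D))"
        using m(2)
      proof
        assume m': "0 < m \<and> m = eps i (lcol n D) \<and> phi i D = 0"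
        then have "eps i E = 0" using False Cons by (simp add: eps_append)
        then have "eps i (rcol n E) = 0"
          using eps_phi_split(1)[OF cE i] by (simp add: eps_append)
        then show ?thesis
          unfolding m(1) using m' r i rcol_column[OF cE] lcol_column[OF cD] pair_free_rset pair_free_lset
          by (intro rowle_raise_right) auto
      qed (use r m(1) in simp)
      then show ?thesis using aD admissible_up_iff[OF cD i e] kDs Cons by (simp add: kn_def)
    qed
    ultimately show ?thesis
      using e by (intro exI[of _ "up n i D # Ds"] conjI) (simp_all add: list.rel_refl del: concat.simps)
  qed
qed simp

section \<open>Columns without pairs and highest weight columns\<close>

lemma pair_free_cnt:
  assumes "pair_free A" shows "cnt n A x = 0"
proof (induction "Suc n - x" arbitrary: x)
  case 0
  then show ?case by simp
next
  case (Suc m)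
  have "cnt n A (Suc x) = 0" by (rule Suc.hyps(1)) (use Suc.hyps(2) in simp)
  then show ?case using assms by (auto simp: cnt.simps[of n A x] pair_free_def)
qed

lemma pair_free_split:
  assumes "column n C" "pair_free (set C)"
  shows "rcol n C = C" "lcol n C = C" "admissible n C"
proof -
  have "repl n (set C) = {}" by (simp add: repl_def pair_free_cnt[OF assms(2)])
  then have "x \<in> rset n (set C) \<longleftrightarrow> x \<in> set C" "x \<in> lset n (set C) \<longleftrightarrow> x \<in> set C" for x
    using assms(2) by (cases x; auto simp: pair_free_def)+
  then have "set (rcol n C) = set C" "set (lcol n C) = set C"
    using rcol_column[OF assms(1)] lcol_column[OF assms(1)] by auto
  then show "rcol n C = C" "lcol n C = C"
    using column_eq rcol_column lcol_column assms(1) by blast+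
  show "admissible n C" using assms pair_free_cnt by (simp add: admissible_iff_cnt)
qed

lemma nle_prefix:
  assumes C: "column n C" and sub: "Pos ` {1..k} \<subseteq> set C" and k: "1 \<le> j" "j \<le> k" "Bar j \<in> set C"
  shows "j < nle C j"
proof -
  have "nle C j = card (set (filter (\<lambda>y. labs y \<le> j) C))"
    unfolding nle_def by (rule distinct_card[symmetric, OF distinct_filter[OF column_distinct[OF C]]])
  moreover have "card (insert (Bar j) (Pos ` {1..j})) \<le> card (set (filter (\<lambda>y. labs y \<le> j) C))"
    using assms by (intro card_mono) auto
  moreover have "card (insert (Bar j) (Pos ` {1..j})) = Suc j"
    by (subst card_insert_disjoint) (auto simp: card_image inj_on_def)
  ultimately show ?thesis by simp
qed

text \<open>The unbarred letters are closed downwards. At the largest barred value \<open>k\<close>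
  nothing but \<open>Pos k\<close> can cancel \<open>Bar k\<close>; then \<open>1, ..., k\<close>
  together with \<open>Bar k\<close> contradict admissibility.\<close>

lemma highest_column:
  assumes a: "admissible n C" and h: "\<And>i. 1 \<le> i \<Longrightarrow> i \<le> n \<Longrightarrow> eps i C = 0"
  shows "C = seg 1 (length C)"
proof -
  have C: "column n C" by (rule admissible_column[OF a])
  note L = column_set[OF C]
  have pos: "Pos i \<in> set C" if "Pos (Suc i) \<in> set C" "1 \<le> i" for i
  proof -
    have "i \<le> n" using that L by auto
    then show ?thesis using h[OF that(2)] that unfolding column_crystal(1)[OF C that(2) \<open>i \<le> n\<close>]
      by (auto simp: of_bool_def split: if_splits)
  qed
  have down: "Pos j \<in> set C" if "Pos i \<in> set C" "1 \<le> j" "j \<le> i" for i j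
    using that(3,1,2) by (induction rule: inc_induct) (use pos in auto)
  have nobar: "Bar j \<notin> set C" for j
  proof
    assume "Bar j \<in> set C"
    define k where "k = Max {i. Bar i \<in> set C}"
    have fin: "finite {i. Bar i \<in> set C}"
      by (rule finite_subset[of _ "{1..n}"]) (use L in auto)
    have k: "Bar k \<in> set C" using Max_in[OF fin] \<open>Bar j \<in> set C\<close> by (auto simp: k_def)
    have "Bar (Suc k) \<notin> set C"
    proof
      assume "Bar (Suc k) \<in> set C"
      then have "Suc k \<le> k" unfolding k_def by (intro Max_ge[OF fin]) auto
      then show False by simp
    qed
    have k1: "1 \<le> k" "k \<le> n" using k L by auto
    have "Pos k \<in> set C"
      using h[OF k1] k \<open>Bar (Suc k) \<notin> set C\<close> unfolding column_crystal(1)[OF C k1]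
      by (auto simp: of_bool_def split: if_splits)
    then have "Pos ` {1..k} \<subseteq> set C" using down by auto
    from nle_prefix[OF C this k1(1) order.refl k] a k1 show False
      by (auto simp: admissible_iff_nle not_le[symmetric])
  qed
  define k where "k = Max (insert 0 {i. Pos i \<in> set C})"
  have fin: "finite (insert 0 {i. Pos i \<in> set C})"
    by (rule finite_subset[of _ "{0..n}"]) (use L in auto)
  have "set C = Pos ` {1..k}"
  proof (intro set_eqI iffI)
    fix x assume x: "x \<in> set C"
    then obtain i where "x = Pos i" using nobar by (metis letter.exhaust)
    then show "x \<in> Pos ` {1..k}" using x L Max_ge[OF fin, of i] by (auto simp: k_def)
  next
    fix x assume "x \<in> Pos ` {1..k}"
    then obtain i where i: "x = Pos i" "1 \<le> i" "i \<le> k" by auto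
    have "k \<in> insert 0 {i. Pos i \<in> set C}" unfolding k_def by (rule Max_in[OF fin]) simp
    then show "x \<in> set C" using down i by auto
  qed
  moreover have "k \<in> insert 0 {i. Pos i \<in> set C}" unfolding k_def by (rule Max_in[OF fin]) simp
  then have "k \<le> n" using L by auto
  ultimately have "C = seg 1 k" by (intro column_eq[OF C column_seg]) (auto simp: set_seg)
  then show ?thesis by (metis length_seg)
qed

lemma nth_column_ge:
  assumes "column n X" "p < length X"
  shows "Pos (Suc p) \<le> X ! p"
  using assms(2)
proof (induction p)
  case 0
  then have "X ! 0 \<in> letters n" using column_set[OF assms(1)] nth_mem by blast
  then show ?case by (cases "X ! 0") (auto simp: less_eq_letter_def)
next
  case (Suc p)
  then have "Pos (Suc p) \<le> X ! p" by simp
  moreover have "X ! p < X ! Suc p" using columnD(2)[OF assms(1)] Suc.prems by (simp add: sorted_wrt_iff_nth_less)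
  ultimately show ?case by (cases "X ! p"; cases "X ! Suc p") (auto simp: less_eq_letter_def)
qed

text \<open>\<open>u\<close> is the part already read and \<open>l\<close> the length of its last
  column. By the rows the next column contains \<open>1, ..., l\<close>, hence by admissibility none
  of their bars; beyond \<open>l\<close> no letter of \<open>u\<close> can cancel its signs. So it
  is itself a highest weight column. At the start, \<open>l = 0\<close> makes the row condition
  trivial.\<close>

lemma kn_highest_aux:
  assumes "kn n Ds" "\<And>i. 1 \<le> i \<Longrightarrow> i \<le> n \<Longrightarrow> eps i (u @ concat Ds) = 0"
    "\<And>i. 1 \<le> i \<Longrightarrow> i \<le> n \<Longrightarrow> phi i u > 0 \<Longrightarrow> i \<le> l" "\<And>D Es. Ds = D # Es \<Longrightarrow> rowle (rcol n D) (seg 1 l)"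
  shows "concat Ds = hw (map length Ds)"
  using assms
proof (induction Ds arbitrary: u l)
  case (Cons D Ds)
  have aD: "admissible n D" and kDs: "kn n Ds" using Cons.prems(1) by (auto simp: kn_def successively_Cons)
  have cD: "column n D" by (rule admissible_column[OF aD])
  note R = rcol_column[OF cD]
  have r: "rowle (rcol n D) (seg 1 l)" using Cons.prems(4) by simp
  have "Pos j \<in> set D" if "1 \<le> j" "j \<le> l" for j
  proof -
    obtain p where p: "j = Suc p" using \<open>1 \<le> j\<close> by (cases j) auto
    have pl: "p < length (rcol n D)" "rcol n D ! p \<le> Pos (Suc p)"
      using r that p by (auto simp: rowle_def seg_def simp del: upt_Suc)
    then have "rcol n D ! p = Pos (Suc p)" using nth_column_ge[OF R[THEN conjunct1], of p] by simp
    then have "Pos j \<in> rset n (set D)" using pl R p nth_mem by metis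
    then show ?thesis by simp
  qed
  then have sub: "Pos ` {1..l} \<subseteq> set D" by auto
  have nob: "Bar j \<notin> set D" if "1 \<le> j" "j \<le> l" for j
  proof
    assume b: "Bar j \<in> set D"
    then have "j \<le> n" using column_set[OF cD] by auto
    then show False using nle_prefix[OF cD sub that b] aD by (auto simp: admissible_iff_nle not_le[symmetric])
  qed
  have eD: "eps i D = 0" if i: "1 \<le> i" "i \<le> n" for i
  proof (cases "i \<le> l")
    case True
    then have "Pos i \<in> set D" "Bar i \<notin> set D" using sub nob i by auto
    then show ?thesis unfolding column_crystal(1)[OF cD i] by simp
  next
    case False
    then have "phi i u = 0" using Cons.prems(3)[OF i] by (cases "phi i u = 0") auto
    then show ?thesis using Cons.prems(2)[OF i] by (simp add: eps_append)
  qed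
  have Ds: "D = seg 1 (length D)" by (rule highest_column[OF aD eD])
  have lD: "l \<le> length D"
  proof -
    have "card (Pos ` {1..l}) \<le> card (set D)" using sub by (intro card_mono) auto
    then show ?thesis using card_length[of D] by (simp add: card_image inj_on_def)
  qed
  have lDn: "length D \<le> n"
  proof (cases "length D")
    case (Suc m)
    then have "Pos (Suc m) \<in> set D" by (subst Ds) (simp add: set_seg)
    then show ?thesis using column_set[OF cD] Suc by auto
  qed simp
  have "concat Ds = hw (map length Ds)"
  proof (rule Cons.IH[OF kDs])
    show "eps i ((u @ D) @ concat Ds) = 0" if "1 \<le> i" "i \<le> n" for i
      using Cons.prems(2)[OF that] by simp
    show "i \<le> length D" if i: "1 \<le> i" "i \<le> n" "phi i (u @ D) > 0" for i
    proof -
      have "phi i D = of_bool (i = length D)"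
        by (subst Ds) (rule eps_phi_seg(2)[OF lDn i(1,2)])
      then show ?thesis using i Cons.prems(3)[of i] lD by (auto simp: phi_append of_bool_def split: if_splits)
    qed
    fix E Es assume "Ds = E # Es"
    then have "rowle (rcol n E) (lcol n D)" using Cons.prems(1) by (simp add: kn_def)
    moreover have "pair_free (set D)" unfolding pair_free_def by (subst (1 2) Ds) (auto simp: set_seg)
    ultimately show "rowle (rcol n E) (seg 1 (length D))" using pair_free_split(2)[OF cD] Ds by simp
  qed
  then show ?case using Ds by simp
qed simp

lemma kn_highest:
  assumes "kn n Ds" "highest n (concat Ds)"
  shows "concat Ds = hw (map length Ds)"
  by (rule kn_highest_aux[of n Ds "[]" 0]) (use assms in \<open>auto simp: highest_def rowle_def seg_def\<close>)

lemma list_all2_up_length: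
  "list_all2 (\<lambda>D D'. D' = D \<or> (eps i D > 0 \<and> D' = up n i D)) Ds Ds' \<Longrightarrow> map length Ds' = map length Ds"
  by (induction rule: list_all2_induct) auto

lemma kn_funpow_up:
  assumes "kn n Ds" "1 \<le> i" "i \<le> n" "k \<le> eps i (concat Ds)"
  shows "\<exists>Ds'. kn n Ds' \<and> (up n i ^^ k) (concat Ds) = concat Ds' \<and> map length Ds' = map length Ds"
  using assms(4)
proof (induction k)
  case (Suc k)
  then obtain Ds' where Ds': "kn n Ds'" "(up n i ^^ k) (concat Ds) = concat Ds'" "map length Ds' = map length Ds"
    by auto
  have "concat Ds \<in> words n" using assms(1) by (auto simp: kn_def words_iff dest!: admissible_column column_set)
  from funpow_up[OF this assms(2,3), of k] have "eps i (concat Ds') > 0" using Suc.prems Ds'(2) by simp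
  from kn_up[OF Ds'(1) assms(2,3) this] Ds' show ?case by (auto dest!: list_all2_up_length)
qed (use assms in auto)

lemma kn_empath:
  "kn n Ds \<Longrightarrow> set p \<subseteq> {1..n} \<Longrightarrow> \<exists>Ds'. kn n Ds' \<and> empath n p (concat Ds) = concat Ds' \<and> map length Ds' = map length Ds"
proof (induction p arbitrary: Ds)
  case (Cons i p)
  then obtain Ds' where "kn n Ds'" "em n i (concat Ds) = concat Ds'" "map length Ds' = map length Ds"
    using kn_funpow_up[of n Ds i "eps i (concat Ds)"] by (auto simp: em_def)
  then show ?case using Cons.IH[of Ds'] Cons.prems by auto
qed auto

lemma kn_full:
  assumes "kn n Ds"
  shows "full n (cap (map length Ds)) (concat Ds)"
  unfolding full_def
proof (intro allI impI)
  fix p m assume p: "set p \<subseteq> {1..n}" "highest n (empath n p (concat Ds))"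
  obtain Ds' where "kn n Ds'" "empath n p (concat Ds) = concat Ds'" "map length Ds' = map length Ds"
    using kn_empath[OF assms p(1)] by auto
  then show "H m (empath n p (concat Ds)) = cap (map length Ds) m"
    using kn_highest[of n Ds'] p H_hw[of m "map length Ds'"] by simp
qed

section \<open>Nestedness\<close>

lemma sg_wl: "x \<in> letters n \<Longrightarrow> sg i x = wl i x - wl (Suc i) x"
  by (cases x) auto

lemma phi_eps_wt:
  assumes "w \<in> words n"
  shows "int (phi i w) - int (eps i w) = wt i w - wt (Suc i) w"
proof -
  have "(\<Sum>x\<leftarrow>w. sg i x) = wt i w - wt (Suc i) w"
    using assms by (induction w) (auto simp: sg_wl[of _ n])
  then show ?thesis by (simp add: phi_eps_sg)
qed

lemma wt_column: "column n C \<Longrightarrow> wt k C = of_bool (Pos k \<in> set C) - of_bool (Bar k \<in> set C)"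
  by (rule wt_distinct[OF column_distinct])

lemma wt_range: "column n C \<Longrightarrow> -1 \<le> wt k C \<and> wt k C \<le> 1"
  by (auto simp: wt_column of_bool_def)

lemma wt_subset:
  assumes "column n A" "pair_free (set A)" "column n B" "set B \<subseteq> set A"
  shows "wt k B = 0 \<or> wt k B = wt k A"
  using assms by (auto simp: wt_column pair_free_def of_bool_def)

lemma pair_free_rfl:
  assumes "S \<subseteq> letters n" "pair_free S" "1 \<le> i" "i \<le> n"
  shows "pair_free (rfl n i ` S)"
  unfolding pair_free_def
proof
  fix j
  show "\<not> (Pos j \<in> rfl n i ` S \<and> Bar j \<in> rfl n i ` S)"
    using assms(2-4) rfl_image_mem[OF assms(1,3,4)]
    by (cases "j = i"; cases "j = Suc i"; cases "i = n") (auto simp: pair_free_def)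
qed

text \<open>If \<open>phi i A = 0\<close>, the reflection describes \<open>em n i A\<close> even
  when nothing is raised: both values then carry the same letters and the set is invariant.\<close>

lemma em_pair_free:
  assumes A: "column n A" "pair_free (set A)" and i: "1 \<le> i" "i \<le> n"
  shows "column n (em n i A)" "pair_free (set (em n i A))" "eps i A = 0 \<Longrightarrow> em n i A = A"
    "phi i A = 0 \<Longrightarrow> set (em n i A) = rfl n i ` set A"
proof -
  note p = pair_free_up[OF A i]
  have L: "set A \<subseteq> letters n" by (rule column_set[OF A(1)])
  show 0: "eps i A = 0 \<Longrightarrow> em n i A = A" by (simp add: em_def)
  have e: "eps i A = 0 \<or> (column n (em n i A) \<and> set (em n i A) = rfl n i ` set A)"
  proof -
    consider "eps i A = 0" | "eps i A = 1" | "eps i A = 2" using p(3) by linarith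
    then show ?thesis using p(1,2) by cases (auto simp: em_def numeral_2_eq_2)
  qed
  then show "column n (em n i A)" using A 0 by auto
  show "pair_free (set (em n i A))" using e A 0 pair_free_rfl[OF L A(2) i] by auto
  assume ph: "phi i A = 0"
  show "set (em n i A) = rfl n i ` set A"
  proof (cases "eps i A = 0")
    case True
    have nn: "Pos (Suc n) \<notin> set A" "Bar (Suc n) \<notin> set A" using L by auto
    have pf: "\<not> (Pos j \<in> set A \<and> Bar j \<in> set A)" for j using A(2) by (simp add: pair_free_def)
    have m: "(Pos i \<in> set A \<longleftrightarrow> Pos (Suc i) \<in> set A) \<and> (Bar i \<in> set A \<longleftrightarrow> Bar (Suc i) \<in> set A)"
      using True ph pf[of i] pf[of "Suc i"] unfolding column_crystal(1,2)[OF A(1) i]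
      by (auto simp: of_bool_def split: if_splits)
    have "set A = rfl n i ` set A"
      by (rule letter_set_eqI[of i]) (use m nn in \<open>auto simp: rfl_image_mem[OF L i]\<close>)
    then show ?thesis using 0 True by simp
  qed (use e in auto)
qed

lemma rfl_image_subset:
  assumes "S \<subseteq> letters n" "S' \<subseteq> letters n" "1 \<le> i" "i \<le> n" "rfl n i ` S' \<subseteq> rfl n i ` S"
  shows "S' \<subseteq> S"
proof
  fix x assume x: "x \<in> S'"
  have "rfl n i x \<in> rfl n i ` S" using x assms(5) by blast
  moreover have "rfl n i (rfl n i x) = x" using x assms(2-4) by (cases x) auto
  ultimately show "x \<in> S" using rfl_image_iff[OF assms(1,3,4)] by metis
qed

lemma wt_em:
  assumes A: "column n A" "pair_free (set A)" and i: "1 \<le> i" "i < n" and ph: "phi i A = 0"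
  shows "wt i (em n i A) = wt (Suc i) A" "wt (Suc i) (em n i A) = wt i A"
    "k \<noteq> i \<Longrightarrow> k \<noteq> Suc i \<Longrightarrow> wt k (em n i A) = wt k A"
proof -
  have i': "i \<le> n" "i \<noteq> n" using i by auto
  note E = em_pair_free[OF A i(1) i'(1)]
  note rm = rfl_image_mem[OF column_set[OF A(1)] i(1) i'(1)]
  show "wt i (em n i A) = wt (Suc i) A" "wt (Suc i) (em n i A) = wt i A"
    "k \<noteq> i \<Longrightarrow> k \<noteq> Suc i \<Longrightarrow> wt k (em n i A) = wt k A"
    by (simp_all add: wt_column[OF A(1)] wt_column[OF E(1)] E(4)[OF ph] rm i')
qed

text \<open>Two uncancelled minus letters can only be \<open>Pos (Suc i)\<close> and
  \<open>Bar i\<close>, with neither of the two plus letters present. This fixes two weights and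
  excludes \<open>i = n\<close>.\<close>

lemma eps_two:
  assumes X: "column n X" and i: "1 \<le> i" "i \<le> n" and e: "eps i X \<ge> 2"
  shows "eps i X = 2" "i < n" "wt i X = -1" "wt (Suc i) X = 1"
proof -
  have m: "Bar i \<in> set X \<and> Pos i \<notin> set X \<and> Pos (Suc i) \<in> set X \<and> Bar (Suc i) \<notin> set X"
    using e unfolding column_crystal(1)[OF X i] by (auto simp: of_bool_def split: if_splits)
  then show "eps i X = 2" "wt i X = -1" "wt (Suc i) X = 1"
    by (auto simp: column_crystal(1)[OF X i] wt_column[OF X])
  show "i < n" using m column_set[OF X] by auto
qed

text \<open>Such an \<open>A\<close> is the highest weight column, whose only positive
  \<open>phi\<close> is at its length, where \<open>full_seg_eps\<close> applies.\<close>

lemma no_raise_highest_key: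
  assumes A: "column n A" "pair_free (set A)" and X: "column n X"
    and f: "full n (cap [length A, length X]) (A @ X)"
    and 0: "\<And>i. 1 \<le> i \<Longrightarrow> i \<le> n \<Longrightarrow> eps i A = 0"
    and j: "1 \<le> j" "j \<le> n" "phi j A > 0"
  shows "eps j (A @ X) = 0"
proof -
  have s: "A = seg 1 (length A)" by (rule highest_column[OF pair_free_split(3)[OF A] 0])
  have l: "length A \<le> n"
  proof (cases "length A")
    case (Suc m)
    then have "Pos (Suc m) \<in> set A" by (subst s) (simp add: set_seg)
    then show ?thesis using column_set[OF A(1)] Suc by auto
  qed simp
  have "phi j (seg 1 (length A)) > 0" using j(3) s by simp
  then have "j = length A" using eps_phi_seg(2)[OF l j(1,2)] by (simp add: of_bool_def split: if_splits)
  then show ?thesis using full_seg_eps[OF X _ l] f j s by simp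
qed

text \<open>
  Maximal raising changes the first column of a word of full weight by a reflection if its sign
  at \<open>i\<close> is negative, and not at all otherwise. Inclusion therefore descends along \<open>em n i\<close> unless
  \<open>A\<close> and \<open>A'\<close> have opposite signs at \<open>i\<close>. If this is the case for every applicable \<open>i\<close>, then the
  second columns must have the letters \<open>i + 1\<close> and \<open>Bar i\<close>, and comparing weights is contradictory.
\<close>

lemma nested_keys:
  assumes "column n A" "pair_free (set A)" "column n A'" "pair_free (set A')"
    "column n X" "column n X'" "length X = length A'" "length X' = length A" "length A' \<le> length A"
    "knuth n (A @ X) (A' @ X')" "full n (cap [length A, length A']) (A @ X)"
  shows "set A' \<subseteq> set A"
  using assms
proof (induction "deficit n [length A, length A'] (A @ X)" arbitrary: A X A' X' rule: less_induct)
  case less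
  note A = less.prems(1,2) and A' = less.prems(3,4) and X = less.prems(5) and X' = less.prems(6)
    and len = less.prems(7-9) and kn = less.prems(10) and fl = less.prems(11)
  have cp: "colprod n [length A, length A'] (A @ X)" "colprod n [length A', length A] (A' @ X')"
    by (rule colprod_Cons; use A A' X X' len in simp)+
  have f': "full n (cap [length A', length A]) (A' @ X')"
    using full_knuth[OF fl kn] cap_perm[of "[length A, length A']" "[length A', length A]"]
    by (simp add: add_mset_commute)
  have eq: "eps i (A @ X) = eps i (A' @ X')" if "1 \<le> i" "i \<le> n" for i
    by (rule knuth_eps_phi(1)[OF kn that])
  note LA = column_set[OF A(1)] and LA' = column_set[OF A'(1)]
  have IH: "set (em n i A') \<subseteq> set (em n i A)" if i: "1 \<le> i" "i \<le> n" and e: "eps i (A @ X) > 0" for i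
  proof -
    let ?Y = "(up n i ^^ (eps i X - phi i A)) X" and ?Y' = "(up n i ^^ (eps i X' - phi i A')) X'"
    have 1: "em n i (A @ X) = em n i A @ ?Y" "em n i (A' @ X') = em n i A' @ ?Y'"
      by (rule em_append[OF colprod_words[OF cp(1)] i], rule em_append[OF colprod_words[OF cp(2)] i])
    have c: "column n ?Y" "column n ?Y'"
      using colprod_funpow_up[of n "[length X]" X i "eps i X - phi i A"]
        colprod_funpow_up[of n "[length X']" X' i "eps i X' - phi i A'"] X X' i by simp_all
    note e1 = em_pair_free[OF A i] and e2 = em_pair_free[OF A' i]
    have l: "length (em n i A) = length A" "length (em n i A') = length A'" by (simp_all add: em_def)
    show ?thesis
    proof (rule less.hyps[of "em n i A" "em n i A'" ?Y ?Y'])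
      show "deficit n [length (em n i A), length (em n i A')] (em n i A @ ?Y) < deficit n [length A, length A'] (A @ X)"
        using deficit_em[OF cp(1) i e] unfolding 1 l .
      show "knuth n (em n i A @ ?Y) (em n i A' @ ?Y')"
        using knuth_em[OF kn i] unfolding 1 .
      show "full n (cap [length (em n i A), length (em n i A')]) (em n i A @ ?Y)"
        using full_em[OF fl i] unfolding 1 l .
    qed (use c e1(1,2) e2(1,2) l len in simp_all)
  qed
  have opp: "\<not> (eps i A > 0 \<and> phi i A > 0)" "\<not> (eps i A' > 0 \<and> phi i A' > 0)" if "1 \<le> i" "i \<le> n" for i
    using pair_free_up(4)[OF A that] pair_free_up(4)[OF A' that] by linarith+
  show ?case
  proof (cases "\<exists>i. 1 \<le> i \<and> i \<le> n \<and> eps i (A @ X) > 0 \<and> \<not> (eps i A > 0 \<and> phi i A' > 0) \<and> \<not> (phi i A > 0 \<and> eps i A' > 0)")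
    case True
    then obtain i where i: "1 \<le> i" "i \<le> n" and e: "eps i (A @ X) > 0"
      and nc: "\<not> (eps i A > 0 \<and> phi i A' > 0)" "\<not> (phi i A > 0 \<and> eps i A' > 0)" by blast
    show ?thesis
    proof (cases "eps i A = 0 \<and> eps i A' = 0")
      case True
      then show ?thesis using IH[OF i e] em_pair_free(3)[OF A i] em_pair_free(3)[OF A' i] by simp
    next
      case False
      \<comment> \<open>One of the two columns is raised and the other is not of opposite sign, so
        both undergo the reflection, one of them possibly as the identity.\<close>
      then have "phi i A = 0" "phi i A' = 0" using nc opp[OF i] by presburger+
      then have "rfl n i ` set A' \<subseteq> rfl n i ` set A"
        using IH[OF i e] em_pair_free(4)[OF A i] em_pair_free(4)[OF A' i] by simp
      then show ?thesis by (rule rfl_image_subset[OF LA LA' i])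
    qed
  next
    case False
    then have conflict: "(eps i A > 0 \<and> phi i A' > 0) \<or> (phi i A > 0 \<and> eps i A' > 0)"
      if "1 \<le> i" "i \<le> n" "eps i (A @ X) > 0" for i using that by blast
    show ?thesis
    proof (cases "highest n (A @ X)")
      case True
      have "H m (A @ X) = cap [length A, length A'] m" for m
        using fl True unfolding full_def by (metis empath.simps(1) empty_subsetI list.set(1))
      then have "A @ X = hw [length A, length A']" using colprod_full[OF cp(1)] by blast
      then have sA: "A = seg 1 (length A)" by (simp del: One_nat_def)
      have "highest n (A' @ X')" using True knuth_highest[OF kn] by simp
      then have "H m (A' @ X') = cap [length A', length A] m" for m
        using f' unfolding full_def by (metis empath.simps(1) empty_subsetI list.set(1))
      then have "A' @ X' = hw [length A', length A]" using colprod_full[OF cp(2)] by blast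
      then have sA': "A' = seg 1 (length A')" by (simp del: One_nat_def)
      show ?thesis by (subst sA, subst sA') (use len(3) in \<open>auto simp: set_seg\<close>)
    next
      case False
      then obtain j0 where j0: "1 \<le> j0" "j0 \<le> n" "eps j0 (A @ X) > 0" by (auto simp: highest_def)
      \<comment> \<open>If nothing in \<open>A\<close> could be raised, \<open>A\<close> would be
        the highest weight column and the operator at \<open>j0\<close> could not act. The same
        holds for \<open>A'\<close> in the other word.\<close>
      have "\<exists>j. 1 \<le> j \<and> j \<le> n \<and> eps j A > 0"
      proof (rule ccontr)
        assume "\<not> ?thesis"
        then have 0: "\<And>j. 1 \<le> j \<Longrightarrow> j \<le> n \<Longrightarrow> eps j A = 0" by auto
        have "phi j0 A > 0" using conflict[OF j0] 0 j0 by auto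
        then show False using no_raise_highest_key[OF A X _ 0] fl len j0 by simp
      qed
      then obtain j where j: "1 \<le> j" "j \<le> n" "eps j A > 0" by blast
      have "\<exists>i. 1 \<le> i \<and> i \<le> n \<and> eps i A' > 0"
      proof (rule ccontr)
        assume "\<not> ?thesis"
        then have 0: "\<And>i. 1 \<le> i \<Longrightarrow> i \<le> n \<Longrightarrow> eps i A' = 0" by auto
        have "phi j0 A' > 0" using conflict[OF j0] 0 j0 by auto
        then show False using no_raise_highest_key[OF A' X' _ 0] f' len j0 eq by simp
      qed
      then obtain i where i: "1 \<le> i" "i \<le> n" "eps i A' > 0" by blast
      have ej: "eps j (A @ X) > 0" using j by (simp add: eps_append)
      then have pj: "phi j A' > 0" using conflict[of j] j opp[of j] by auto
      have "eps j A' = 0" using opp(2)[OF j(1,2)] pj by auto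
      \<comment> \<open>\<open>A'\<close> cancels a letter at \<open>j\<close>, yet the word can be
        raised there, so \<open>X'\<close> has two letters to raise and its weights at
        \<open>j\<close> and \<open>j + 1\<close> are known. The same holds for \<open>X\<close> at
        \<open>i\<close>.\<close>
      then have "eps j X' > phi j A'" using ej unfolding eq[OF j(1,2)] by (simp add: eps_append)
      moreover from this have "eps j X' \<ge> 2" using pj by simp
      note X2' = eps_two[OF X' j(1,2) this]
      ultimately have pj1: "phi j A' = 1" using pj by simp
      have ei: "eps i (A @ X) > 0" using i eq[OF i(1,2)] by (simp add: eps_append)
      then have pi: "phi i A > 0" using conflict[of i] i opp[of i] by auto
      have ei0: "eps i A = 0" using opp(1)[OF i(1,2)] pi by auto
      then have "eps i X > phi i A" using ei by (simp add: eps_append)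
      moreover from this have "eps i X \<ge> 2" using pi by simp
      note X2 = eps_two[OF X i(1,2) this]
      ultimately have pi1: "phi i A = 1" using pi by simp
      have pi0: "phi i A' = 0" using opp(2)[OF i(1,2)] i by auto
      have ij: "i \<noteq> j" using pi0 pj by auto
      have w: "A \<in> words n" "A' \<in> words n" using A A' columnD by auto
      have Ai: "wt i A - wt (Suc i) A = 1" using phi_eps_wt[OF w(1), of i] pi1 ei0 by simp
      have Aj: "wt j A < wt (Suc j) A" using phi_eps_wt[OF w(1), of j] j opp(1)[of j] by auto
      have A'j: "wt j A' - wt (Suc j) A' = 1" using phi_eps_wt[OF w(2), of j] pj1 \<open>eps j A' = 0\<close> by simp
      have sum: "wt k A + wt k X = wt k A' + wt k X'" for k
        using knuth_wt[OF kn, of k] by simp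
      \<comment> \<open>The induction hypothesis after raising at \<open>i\<close>, where
        \<open>A\<close> stays and \<open>A'\<close> is reflected.\<close>
      have B: "set (em n i A') \<subseteq> set A" using IH[OF i(1,2) ei] em_pair_free(3)[OF A i(1,2) ei0] by simp
      have sub: "wt k (em n i A') = 0 \<or> wt k (em n i A') = wt k A" for k
        by (rule wt_subset[OF A em_pair_free(1)[OF A' i(1,2)] B])
      note wB = wt_em[OF A' i(1) X2(2) pi0]
      have rA: "-1 \<le> wt k A" "wt k A \<le> 1" and rA': "-1 \<le> wt k A'" "wt k A' \<le> 1" for k
        using wt_range A A' by blast+
      \<comment> \<open>For adjacent \<open>i\<close> and \<open>j\<close> the second columns shift
        the common weight by two and force extreme values. Otherwise the reflection at
        \<open>i\<close> leaves the weights at \<open>j\<close> and \<open>j + 1\<close> alone, and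
        inclusion contradicts the opposite signs at \<open>j\<close>.\<close>
      consider "j = Suc i" | "i = Suc j" | "j \<noteq> Suc i" "i \<noteq> Suc j" by blast
      then have False
      proof cases
        case 1
        have "wt j A + 1 = wt j A' - 1" using sum[of j] X2(4) X2'(3) 1 by simp
        then have "wt j A = -1" "wt j A' = 1" using rA(1)[of j] rA'(2)[of j] by linarith+
        then show False using sub[of i] wB(1) Ai 1 by simp
      next
        case 2
        have "wt i A - 1 = wt i A' + 1" using sum[of i] X2(3) X2'(4) 2 by simp
        then have "wt i A = 1" "wt i A' = -1" using rA(2)[of i] rA'(1)[of i] by linarith+
        then show False using sub[of "Suc i"] wB(2) Ai by simp
      next
        case 3
        then have "wt j (em n i A') = wt j A'" "wt (Suc j) (em n i A') = wt (Suc j) A'"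
          using wB(3) ij by auto
        then show False
          using sub[of j] sub[of "Suc j"] Aj A'j rA[of j] rA[of "Suc j"] by auto
      qed
      then show ?thesis ..
    qed
  qed
qed

section \<open>Splitting all columns\<close>

definition dbl :: "nat \<Rightarrow> word list \<Rightarrow> word list" where
  "dbl n Ds = concat (map (\<lambda>D. [rcol n D, lcol n D]) Ds)"

lemma dbl_simps [simp]: "dbl n [] = []" "dbl n (D # Ds) = rcol n D # lcol n D # dbl n Ds"
  by (simp_all add: dbl_def)

lemma eps_phi_dbl:
  assumes "1 \<le> i" "i \<le> n" "\<forall>D \<in> set Ds. column n D"
  shows "eps i (concat (dbl n Ds)) = 2 * eps i (concat Ds) \<and> phi i (concat (dbl n Ds)) = 2 * phi i (concat Ds)"
  using assms(3)
proof (induction Ds)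
  case (Cons D Ds)
  have "concat (dbl n (D # Ds)) = (rcol n D @ lcol n D) @ concat (dbl n Ds)" by simp
  then show ?case
    using Cons eps_phi_split[of n D i] assms(1,2)
    by (simp only: eps_append[of i "rcol n D @ lcol n D"] phi_append[of i "rcol n D @ lcol n D"])
      (simp add: eps_append phi_append diff_mult_distrib2)
qed simp

lemma concat_dbl_words: "\<forall>D \<in> set Ds. column n D \<Longrightarrow> concat (dbl n Ds) \<in> words n"
proof (induction Ds)
  case (Cons D Ds)
  have "rcol n D \<in> words n" "lcol n D \<in> words n"
    using rcol_column[of n D] lcol_column[of n D] Cons.prems by (auto dest: columnD(1))
  then show ?case using Cons by simp
qed simp

text \<open>Every factor has its \<open>eps\<close> and \<open>phi\<close> exactly doubled, so both
  raisings fall on the doubled form of the column on which the single raising falls.\<close>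

lemma up_dbl:
  assumes "1 \<le> i" "i \<le> n" "\<forall>D \<in> set Ds. column n D" "eps i (concat Ds) > 0"
  shows "\<exists>Ds'. up n i (concat Ds) = concat Ds' \<and> up n i (up n i (concat (dbl n Ds))) = concat (dbl n Ds')
     \<and> (\<forall>D \<in> set Ds'. column n D) \<and> map length Ds' = map length Ds"
  using assms(3,4)
proof (induction Ds)
  case (Cons D Ds)
  note i = assms(1,2)
  let ?s = "rcol n D @ lcol n D" and ?d = "concat (dbl n Ds)"
  have cD: "column n D" using Cons.prems by simp
  note eD = eps_phi_split[OF cD i]
  have e: "eps i ?d = 2 * eps i (concat Ds)" using eps_phi_dbl[OF i, of Ds] Cons.prems by simp
  have dw: "?d \<in> words n"
    using Cons.prems by (intro concat_dbl_words) simp_all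
  have sw: "?s \<in> words n" using rcol_column[OF cD] lcol_column[OF cD] by (auto dest: columnD(1))
  have eq: "concat (dbl n (D # Ds)) = ?s @ ?d" by simp
  show ?case
  proof (cases "eps i (concat Ds) > phi i D")
    case True
    then obtain Ds' where Ds': "up n i (concat Ds) = concat Ds'" "up n i (up n i ?d) = concat (dbl n Ds')"
      "\<forall>D \<in> set Ds'. column n D" "map length Ds' = map length Ds"
      using Cons by fastforce
    have g: "eps i ?d > phi i ?s" "eps i ?d > 0" using True e eD by simp_all
    then have "eps i (up n i ?d) > phi i ?s" using eps_up[OF dw i g(2)] e eD True by simp
    then have "up n i (up n i (?s @ ?d)) = ?s @ concat (dbl n Ds')"
      using g Ds' by (simp only: up_append_right)
    moreover have "up n i (concat (D # Ds)) = concat (D # Ds')"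
      using up_append_right[OF True, of n] Ds' by simp
    ultimately show ?thesis using Ds' cD eq by (intro exI[of _ "D # Ds'"]) simp
  next
    case False
    then have eD0: "eps i D > 0" using Cons.prems(2) by (simp add: eps_append)
    have g: "eps i ?d \<le> phi i ?s" "eps i ?s > 0" using False e eD eD0 by simp_all
    then have "eps i ?d \<le> phi i (up n i ?s)" "eps i (up n i ?s) > 0"
      using eps_up[OF sw i g(2)] phi_up[OF sw i g(2)] eD eD0 by simp_all
    then have "up n i (up n i (?s @ ?d)) = up n i (up n i ?s) @ ?d"
      using g by (simp only: up_append_left)
    also have "up n i (up n i ?s) = rcol n (up n i D) @ lcol n (up n i D)"
      by (rule up_split_word[OF cD i eD0])
    finally have "up n i (up n i (?s @ ?d)) = concat (dbl n (up n i D # Ds))" by simp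
    moreover have "up n i (concat (D # Ds)) = concat (up n i D # Ds)"
      using up_append_left[of i "concat Ds" D n] False eD0 by simp
    ultimately show ?thesis
      using eq Cons.prems(1) column_crystal(3)[OF cD i eD0]
      by (intro exI[of _ "up n i D # Ds"]) simp
  qed
qed simp

definition dpath :: "nat list \<Rightarrow> nat list" where
  "dpath p = concat (map (\<lambda>i. [i, i]) p)"

lemma raises_dbl:
  "raises n p (concat Ds) h \<Longrightarrow> \<forall>D \<in> set Ds. column n D \<Longrightarrow>
   \<exists>Ds'. h = concat Ds' \<and> raises n (dpath p) (concat (dbl n Ds)) (concat (dbl n Ds'))
     \<and> (\<forall>D \<in> set Ds'. column n D) \<and> map length Ds' = map length Ds"
proof (induction p arbitrary: Ds)
  case Nil
  then show ?case by (auto simp: dpath_def)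
next
  case (Cons i p)
  then have i: "1 \<le> i" "i \<le> n" and e: "eps i (concat Ds) > 0"
    and r: "raises n p (up n i (concat Ds)) h" by auto
  let ?d = "concat (dbl n Ds)"
  obtain Ds1 where D1: "up n i (concat Ds) = concat Ds1" "up n i (up n i ?d) = concat (dbl n Ds1)"
    "\<forall>D \<in> set Ds1. column n D" "map length Ds1 = map length Ds"
    using up_dbl[OF i Cons.prems(2) e] by blast
  obtain Ds' where D': "h = concat Ds'" "raises n (dpath p) (concat (dbl n Ds1)) (concat (dbl n Ds'))"
    "\<forall>D \<in> set Ds'. column n D" "map length Ds' = map length Ds1"
    using Cons.IH[of Ds1] r D1 by auto
  have dw: "?d \<in> words n"
    using Cons.prems by (intro concat_dbl_words) simp_all
  have ed: "eps i ?d = 2 * eps i (concat Ds)" using eps_phi_dbl[OF i Cons.prems(2)] by simp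
  then have "eps i (up n i ?d) > 0" using eps_up[OF dw i] e by simp
  then have "raises n (dpath (i # p)) ?d (concat (dbl n Ds'))"
    using i ed e D1 D' by (simp add: dpath_def)
  then show ?case using D' D1 by auto
qed

definition dup :: "nat list \<Rightarrow> nat list" where
  "dup ls = concat (map (\<lambda>l. [l, l]) ls)"

lemma dup_simps [simp]: "dup [] = []" "dup (l # ls) = l # l # dup ls"
  by (simp_all add: dup_def)

lemma mset_dup: "mset (dup ls) = mset ls + mset ls"
  by (induction ls) auto

lemma dbl_seg: "set ls \<subseteq> {..n} \<Longrightarrow> concat (dbl n (map (seg 1) ls)) = hw (dup ls)"
proof (induction ls)
  case (Cons l ls)
  have "pair_free (set (seg 1 l))" by (auto simp: pair_free_def set_seg)
  then have "rcol n (seg 1 l) = seg 1 l" "lcol n (seg 1 l) = seg 1 l"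
    using Cons.prems by (simp_all add: pair_free_split column_seg del: One_nat_def)
  then show ?case using Cons by simp
qed simp

lemma raises_replicate_up:
  assumes "w \<in> words n" "1 \<le> i" "i \<le> n" "k \<le> eps i w"
  shows "raises n (replicate k i) w ((up n i ^^ k) w)"
  using assms(4)
proof (induction k)
  case (Suc k)
  have "raises n (replicate k i @ [i]) w ((up n i ^^ Suc k) w)"
    using Suc funpow_up[OF assms(1-3), of k] assms(2,3) by (auto simp: raises_append)
  then show ?case by (simp only: replicate_append_same replicate_Suc)
qed simp

lemma raises_empath: "w \<in> words n \<Longrightarrow> set p \<subseteq> {1..n} \<Longrightarrow> \<exists>q. raises n q w (empath n p w)"
proof (induction p arbitrary: w)
  case Nil
  then show ?case by (intro exI[of _ "[]"]) simp
next
  case (Cons i p)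
  then have i: "1 \<le> i" "i \<le> n" by auto
  have r: "raises n (replicate (eps i w) i) w (em n i w)"
    unfolding em_def by (rule raises_replicate_up[OF Cons.prems(1) i order.refl])
  have "em n i w \<in> words n" using raises_words[OF r Cons.prems(1)] .
  then obtain q where "raises n q (em n i w) (empath n p (em n i w))" using Cons by auto
  with r show ?case by (intro exI[of _ "replicate (eps i w) i @ q"]) (auto simp: raises_append)
qed

lemma colprod_concat: "\<forall>D \<in> set Ds. column n D \<Longrightarrow> colprod n (map length Ds) (concat Ds)"
  by (induction Ds) auto

lemma kn_columns: "kn n Ds \<Longrightarrow> \<forall>D \<in> set Ds. column n D"
  by (auto simp: kn_def admissible_column)

lemma kn_raises_highest:
  assumes "kn n Ds"
  obtains p where "raises n p (concat Ds) (hw (map length Ds))"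
proof -
  note c = colprod_concat[OF kn_columns[OF assms]]
  obtain q where q: "set q \<subseteq> {1..n}" "highest n (empath n q (concat Ds))"
    using exists_empath_highest[OF c] by blast
  obtain Ds' where Ds': "kn n Ds'" "empath n q (concat Ds) = concat Ds'" "map length Ds' = map length Ds"
    using kn_empath[OF assms q(1)] by blast
  have "empath n q (concat Ds) = hw (map length Ds)" using kn_highest[OF Ds'(1)] Ds' q by simp
  then show thesis using raises_empath[OF colprod_words[OF c] q(1)] that by auto
qed

text \<open>The lengths identify the columns reached as \<open>seg 1 l\<close>; these have no pairs
  and split into two copies of themselves.\<close>

lemma raises_dbl_hw:
  assumes r: "raises n p (concat Es) (hw (map length Es))" and c: "\<forall>E \<in> set Es. column n E"
    and n: "set (map length Es) \<subseteq> {..n}"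
  shows "raises n (dpath p) (concat (dbl n Es)) (hw (dup (map length Es)))"
proof -
  obtain Es' where Es': "hw (map length Es) = concat Es'"
    "raises n (dpath p) (concat (dbl n Es)) (concat (dbl n Es'))" "map length Es' = map length Es"
    using raises_dbl[OF r c] by blast
  have "Es' = map (seg 1) (map length Es)"
  proof (rule concat_injective)
    show "concat Es' = concat (map (seg 1) (map length Es))" using Es'(1) by (simp add: hw_def)
    show "length Es' = length (map (seg 1) (map length Es))" using arg_cong[OF Es'(3), of length] by simp
    show "\<forall>(x, y) \<in> set (zip Es' (map (seg 1) (map length Es))). length x = length y"
    proof
      fix z assume "z \<in> set (zip Es' (map (seg 1) (map length Es)))"
      then obtain k where k: "k < length Es" "k < length Es'" "z = (Es' ! k, seg 1 (length (Es ! k)))"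
        by (auto simp: set_zip)
      have "map length Es' ! k = map length Es ! k" using Es'(3) by simp
      then show "case z of (x, y) \<Rightarrow> length x = length y" using k by simp
    qed
  qed
  then show ?thesis using Es'(2) dbl_seg[OF n] by simp
qed

text \<open>The path is transported by equivalence, and its end has the same weight. As the bounds
  depend only on the multiset of lengths, that end attains them and is a product of highest weight
  columns.\<close>

lemma raises_colprod_frank:
  assumes kn: "kn n Ds" and c: "\<forall>E \<in> set Es. column n E" and k: "knuth n (concat Es) (concat Ds)"
    and ms: "mset (map length Es) = mset (map length Ds)" and r: "raises n p (concat Ds) (hw (map length Ds))"
  shows "raises n p (concat Es) (hw (map length Es)) \<and> set (map length Es) \<subseteq> {..n}"
proof -
  obtain h where h: "raises n p (concat Es) h" "knuth n (hw (map length Ds)) h"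
    using raises_knuth[OF r knuth.sym[OF k]] by blast
  have up: "colprod n ls w \<Longrightarrow> raises n q w v \<Longrightarrow> colprod n ls v" for ls w v q
  proof (induction q arbitrary: w)
    case (Cons i q)
    then show ?case using colprod_up[of n ls w i] by simp
  qed simp
  have "colprod n (map length Es) h" by (rule up[OF colprod_concat[OF c] h(1)])
  moreover have "H m h = cap (map length Es) m" for m
    using knuth_H[OF h(2), of m] H_hw[of m "map length Ds"] cap_perm[OF ms] by simp
  ultimately have "h = hw (map length Es) \<and> set (map length Es) \<subseteq> {..n}" by (rule colprod_full)
  then show ?thesis using h by simp
qed


section \<open>Keys of the rightmost columns\<close>

text \<open>For an admissible column nobody waits at the end of the scan, so as many letters are
  inserted as are removed.\<close>

lemma card_replace:
  fixes n :: nat and C :: word and f :: "nat \<Rightarrow> letter"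
  defines "Z \<equiv> {z \<in> {1..n}. Pos z \<in> set C \<and> Bar z \<in> set C}"
  assumes a: "admissible n C" and f: "inj f" "f ` Z \<subseteq> set C" "f ` repl n (set C) \<inter> set C = {}"
  shows "card ((set C - f ` Z) \<union> f ` repl n (set C)) = length C"
proof -
  let ?A = "set C"
  have fin: "finite (Z)" "finite (repl n ?A)" by (auto simp: Z_def repl_def)
  have Z1: "{z \<in> {1..n}. Pos z \<in> ?A \<and> Bar z \<in> ?A \<and> 1 \<le> z} = Z" by (auto simp: Z_def)
  have T1: "{t \<in> repl n ?A. 1 \<le> t} = repl n ?A" by (auto simp: repl_def)
  have zt: "card (Z) = card (repl n ?A)"
    using card_pairs_ge[of 1 n ?A, unfolded Z1 T1] a by (simp add: admissible_iff_cnt)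
  have cf: "card (f ` Z) = card (Z)" "card (f ` repl n ?A) = card (repl n ?A)"
    using f(1) by (auto intro!: card_image intro: inj_on_subset)
  have "card ((?A - f ` Z) \<union> f ` repl n ?A) = card (?A - f ` Z) + card (f ` repl n ?A)"
    using fin f(3) by (intro card_Un_disjoint) auto
  also have "card (?A - f ` Z) = card ?A - card (f ` Z)"
    using fin f(2) by (intro card_Diff_subset) auto
  also have "card ?A - card (f ` Z) + card (f ` repl n ?A) = card ?A"
  proof -
    have "card (f ` Z) \<le> card ?A" using f(2) by (intro card_mono) auto
    then show ?thesis using zt cf by simp
  qed
  finally show ?thesis
    using distinct_card[OF column_distinct[OF admissible_column[OF a]]] by simp
qed

lemma length_rcol_lcol:
  assumes a: "admissible n C"
  shows "length (rcol n C) = length C" "length (lcol n C) = length C"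
proof -
  note C = admissible_column[OF a]
  let ?A = "set C" and ?Z = "{z \<in> {1..n}. Pos z \<in> set C \<and> Bar z \<in> set C}"
  have r: "rset n ?A = (?A - Bar ` ?Z) \<union> Bar ` repl n ?A"
  proof (rule set_eqI)
    fix x show "x \<in> rset n ?A \<longleftrightarrow> x \<in> (?A - Bar ` ?Z) \<union> Bar ` repl n ?A"
      using column_set[OF C] by (cases x) auto
  qed
  have l: "lset n ?A = (?A - Pos ` ?Z) \<union> Pos ` repl n ?A"
  proof (rule set_eqI)
    fix x show "x \<in> lset n ?A \<longleftrightarrow> x \<in> (?A - Pos ` ?Z) \<union> Pos ` repl n ?A"
      using column_set[OF C] by (cases x) auto
  qed
  have "card (rset n ?A) = length C"
    unfolding r using repl_subset by (intro card_replace[OF a]) (auto simp: inj_on_def)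
  moreover have "card (lset n ?A) = length C"
    unfolding l using repl_subset by (intro card_replace[OF a]) (auto simp: inj_on_def)
  ultimately show "length (rcol n C) = length C" "length (lcol n C) = length C"
    using rcol_column[OF C] lcol_column[OF C] column_distinct distinct_card by metis+
qed

lemmas length_rcol = length_rcol_lcol(1) and length_lcol = length_rcol_lcol(2)

text \<open>Doubling is not checked on the individual Knuth relations. Both doubled words are raised
  along the doubled path to highest weight words with permuted columns; these are equivalent, and
  lowering makes the doubled words equivalent.\<close>

lemma full_dbl:
  assumes "kn n Ds" "kn n (dbl n Ds)" "\<forall>E \<in> set Es. column n E" "knuth n (concat Es) (concat Ds)"
    "mset (map length Es) = mset (map length Ds)" "raises n p (concat Ds) (hw (map length Ds))"
    "\<forall>D \<in> set Ds. length (lcol n D) = length D"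
  shows "full n (cap (dup (map length Es))) (concat (dbl n Es))"
proof -
  note kc = kn_columns[OF assms(1)]
  have kr: "knuth n (concat Ds) (concat Ds)" using colprod_words[OF colprod_concat[OF kc]] by (rule knuth.refl)
  note rD = raises_colprod_frank[OF assms(1) kc kr HOL.refl assms(6)]
  note rE = raises_colprod_frank[OF assms(1,3,4,5,6)]
  have 1: "raises n (dpath p) (concat (dbl n Ds)) (hw (dup (map length Ds)))"
    "raises n (dpath p) (concat (dbl n Es)) (hw (dup (map length Es)))"
    using raises_dbl_hw[OF rD[THEN conjunct1] kc rD[THEN conjunct2]]
      raises_dbl_hw[OF rE[THEN conjunct1] assms(3) rE[THEN conjunct2]] by blast+
  have w: "concat (dbl n Fs) \<in> words n" if "\<forall>F \<in> set Fs. column n F" for Fs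
    by (rule concat_dbl_words[OF that])
  have ms: "mset (dup (map length Ds)) = mset (dup (map length Es))"
    using assms(5) by (simp add: mset_dup)
  have "set (dup (map length Ds)) \<subseteq> {..n}" using rD by (auto simp: dup_def)
  then have "knuth n (hw (dup (map length Ds))) (hw (dup (map length Es)))" by (rule knuth_hw_perm[OF ms])
  from raises_knuth_rev[OF 1 this] have "knuth n (concat (dbl n Ds)) (concat (dbl n Es))"
    using w kc assms(3) by simp
  moreover have "map length (dbl n Ds) = dup (map length Ds)"
  proof -
    have "\<forall>D \<in> set Ds. length (lcol n D) = length D \<and> length (rcol n D) = length D"
      using assms(1,7) length_rcol by (auto simp: kn_def)
    then show ?thesis by (induction Ds) auto
  qed
  ultimately show ?thesis
    using full_knuth[OF kn_full[OF assms(2)]] cap_perm[OF ms] by simp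
qed

text \<open>
  After splitting there is a second column of every length, so two realizations with
  rightmost columns of different lengths can be rearranged so as to differ in their first two
  columns only.
\<close>

lemma frank_keys_nested:
  assumes kn: "kn n Ds" "kn n (dbl n Ds)" "\<forall>D \<in> set Ds. length (lcol n D) = length D"
    and S: "\<forall>E \<in> set (C # Xs). admissible n E" "knuth n (concat (C # Xs)) (concat Ds)"
      "mset (map length (C # Xs)) = mset (map length Ds)"
    and S': "\<forall>E \<in> set (C' # Xs'). admissible n E" "knuth n (concat (C' # Xs')) (concat Ds)"
      "mset (map length (C' # Xs')) = mset (map length Ds)"
    and l: "length C' < length C"
  shows "set (rcol n C') \<subseteq> set (rcol n C)"
proof -
  obtain p where p: "raises n p (concat Ds) (hw (map length Ds))" using kn_raises_highest[OF kn(1)] .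
  define q where "q = dpath p"
  \<comment> \<open>The doubled lengths without one column of each of the two lengths compared: the
    common tail to which both realizations are brought.\<close>
  define zs where "zs = sorted_list_of_multiset (mset (dup (map length Ds)) - {#length C, length C'#})"
  define M where "M = mset (dup (map length Ds))"
  have c: "\<forall>E \<in> set (C # Xs). column n E" "\<forall>E \<in> set (C' # Xs'). column n E"
    using S(1) S'(1) admissible_column by auto
  have "length C \<in># mset (map length Ds)" unfolding S(3)[symmetric] by simp
  moreover have "length C' \<in># mset (map length Ds)" unfolding S'(3)[symmetric] by simp
  ultimately have "{#length C, length C'#} \<subseteq># M"
    using l by (auto simp: M_def mset_dup insert_subset_eq_iff in_diff_count subseteq_mset_def count_eq_zero_iff
        intro: Suc_leI split: if_splits)
  then have M: "M = add_mset (length C) (add_mset (length C') (mset zs))"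
    by (metis M_def zs_def mset_sorted_list_of_multiset subset_mset.diff_add add.commute union_mset_add_mset_right add_0 empty_neutral(2))
  \<comment> \<open>\<open>rcol n E\<close> stays in front while the rest is rearranged into a
    column of length \<open>b\<close> and a tail with lengths \<open>zs\<close>. The rearrangement
    takes place at the highest weight and is pulled back by \<open>raises_replace\<close>.\<close>
  have step: "\<exists>X z. column n X \<and> length X = b \<and> colprod n zs z \<and>
      raises n q (rcol n E @ X @ z) (seg 1 (length E) @ seg 1 b @ hw zs) \<and>
      full n (cap ([length E, b] @ zs)) (rcol n E @ X @ z)"
    if E: "\<forall>F \<in> set (E # Ys). admissible n F" "knuth n (concat (E # Ys)) (concat Ds)"
      "mset (map length (E # Ys)) = mset (map length Ds)" and b: "M = add_mset (length E) (add_mset b (mset zs))"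
    for E Ys b
  proof -
    have cE: "\<forall>F \<in> set (E # Ys). column n F" using E(1) admissible_column by auto
    note rE = raises_colprod_frank[OF kn(1) cE E(2,3) p]
    have r: "raises n q (concat (dbl n (E # Ys))) (hw (dup (map length (E # Ys))))"
      unfolding q_def using rE by (intro raises_dbl_hw cE) auto
    define y where "y = lcol n E @ concat (dbl n Ys)"
    have Y: "concat (dbl n (E # Ys)) = rcol n E @ y" by (simp add: y_def)
    have w: "rcol n E @ y \<in> words n"
      unfolding Y[symmetric] by (rule concat_dbl_words[OF cE])
    have ms: "mset (length E # dup (map length Ys)) = mset (b # zs)"
    proof -
      have "M = mset (map length (E # Ys)) + mset (map length (E # Ys))"
        unfolding M_def mset_dup E(3) ..
      then show ?thesis using b by (simp add: mset_dup)
    qed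
    have "set (length E # dup (map length Ys)) \<subseteq> {..n}" using rE by (auto simp: dup_def)
    then have k: "knuth n (hw (length E # dup (map length Ys))) (hw (b # zs))" by (rule knuth_hw_perm[OF ms])
    have bz: "set (length E # b # zs) \<subseteq> {..n}"
      using rE set_mset_mset[of "length E # dup (map length Ys)"] ms \<open>set (length E # dup (map length Ys)) \<subseteq> {..n}\<close>
      by (metis insert_subset list.simps(15) set_mset_mset)
    have ry: "raises n q (rcol n E @ y) (seg 1 (length E) @ hw (length E # dup (map length Ys)))"
      using r unfolding Y by simp
    have "length (rcol n E) = length (seg 1 (length E))" using length_rcol[of n E] E(1) by simp
    with raises_replace[of n q "rcol n E" y "[]" "seg 1 (length E)" _ "[]"] ry k w
    obtain v where v: "knuth n y v" "raises n q (rcol n E @ v) (seg 1 (length E) @ hw (b # zs))"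
      by auto
    have kv: "knuth n (rcol n E @ y) (rcol n E @ v)"
      using w v(1) by (intro knuth_append knuth.refl) auto
    have "colprod n (length E # b # zs) (rcol n E @ v)"
    proof (rule colprod_raises_rev[OF v(2) knuth_words(2)[OF kv]])
      show "colprod n (length E # b # zs) (seg 1 (length E) @ hw (b # zs))"
        using colprod_hw[OF bz] by (simp only: hw_simps)
    qed
    then obtain e v' where ev: "rcol n E @ v = e @ v'" "length e = length E" "colprod n (b # zs) v'" by auto
    then have "v = v'" using length_rcol[of n E] E(1) by simp
    then obtain X z where Xz: "v = X @ z" "column n X" "length X = b" "colprod n zs z" using ev by auto
    have "full n (cap (dup (map length (E # Ys)))) (rcol n E @ y)"
      using full_dbl[OF kn(1,2) cE E(2,3) p kn(3)] unfolding Y .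
    moreover have "cap (dup (map length (E # Ys))) = cap ([length E, b] @ zs)"
      by (rule cap_perm) (use ms in simp)
    ultimately have "full n (cap ([length E, b] @ zs)) (rcol n E @ v)" using full_knuth[OF _ kv] by simp
    moreover have "raises n q (rcol n E @ X @ z) (seg 1 (length E) @ seg 1 b @ hw zs)"
      using v(2) unfolding Xz hw_simps .
    ultimately show ?thesis using Xz by blast
  qed
  obtain X z where X: "column n X" "length X = length C'" "colprod n zs z"
    "raises n q (rcol n C @ X @ z) (seg 1 (length C) @ seg 1 (length C') @ hw zs)"
    "full n (cap ([length C, length C'] @ zs)) (rcol n C @ X @ z)"
    using step[OF S M] by blast
  obtain X' z' where X': "column n X'" "length X' = length C" "colprod n zs z'"
    "raises n q (rcol n C' @ X' @ z') (seg 1 (length C') @ seg 1 (length C) @ hw zs)"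
    using step[OF S' M[unfolded add_mset_commute[of "length C"]]] by blast
  have aC: "admissible n C" "admissible n C'" using S(1) S'(1) by auto
  note R = rcol_column[OF admissible_column[OF aC(1)]] and R' = rcol_column[OF admissible_column[OF aC(2)]]
  have w: "rcol n C @ X @ z \<in> words n" "rcol n C' @ X' @ z' \<in> words n"
    using R R' X X' by (auto dest: columnD(1) colprod_words)
  have len: "length (rcol n C) = length C" "length (rcol n C') = length C'" using aC length_rcol by auto
  have lz: "length z = sum_list zs" "length z' = sum_list zs" "length (hw zs) = sum_list zs"
    using X X' colprod_length by (auto simp: hw_def length_concat comp_def simp del: One_nat_def)
  have ln: "length C \<le> n" "length C' \<le> n"
    using raises_colprod_frank[OF kn(1) c(1) S(2,3) p] raises_colprod_frank[OF kn(1) c(2) S'(2,3) p] by auto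
  have r: "raises n q ((rcol n C @ X) @ z) ((seg 1 (length C) @ seg 1 (length C')) @ hw zs)"
    using X(4) by simp
  \<comment> \<open>Exchanging the first two columns at the top and pulling back keeps the tail
    \<open>z\<close>. The result has the same path and the same end as the other realization, hence
    equals it, and the tails cancel.\<close>
  obtain v where v: "knuth n (rcol n C @ X) v"
    "raises n q (v @ z) ((seg 1 (length C') @ seg 1 (length C)) @ hw zs)"
    using raises_replace[OF _ _ _ knuth_seg_swap[OF ln], of q "[]" "rcol n C @ X" z "[]" "hw zs"]
      r w lz by auto
  have "v @ z = rcol n C' @ X' @ z'"
  proof (rule raises_inj)
    show "raises n q (v @ z) ((seg 1 (length C') @ seg 1 (length C)) @ hw zs)" by (rule v(2))
    show "raises n q (rcol n C' @ X' @ z') ((seg 1 (length C') @ seg 1 (length C)) @ hw zs)"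
      using X'(4) by simp
  qed (use w v knuth_words(2) in auto)
  then have vv: "v = rcol n C' @ X'" using lz by (metis append.assoc append_eq_append_conv)
  have "colprod n [length C, length C'] (rcol n C @ X)"
    using R X len by (intro colprod_Cons) auto
  then have "full n (cap [length C, length C']) (rcol n C @ X)"
    using full_prefix[of n "[length C, length C']" "rcol n C @ X" zs z] X by simp
  then show ?thesis
    using R R' X X' len l v(1) vv pair_free_rset
    by (intro nested_keys[of n "rcol n C" "rcol n C'" X X']) auto
qed

section \<open>Straight shapes as lists of columns, and the assembly of the key tableau\<close>

lemma semistandard_straight:
  assumes "\<forall>(m, C) \<in> set U. m = 0"
  shows "semistandard n U \<longleftrightarrow> sorted_wrt rowle (map snd U) \<and> (\<forall>C \<in> set (map snd U). column n C)"
proof -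
  have 0: "fst x = 0" if "x \<in> set U" for x using assms that by (cases x) auto
  have shape: "skew_shape U \<longleftrightarrow> sorted_wrt (\<lambda>X Y. length Y \<le> length X) (map snd U)"
  proof -
    have "sorted_wrt (\<ge>) (map fst U)"
      using 0 by (auto simp: sorted_wrt_iff_nth_less)
    moreover have m: "map (\<lambda>(m, C). m + length C) U = map length (map snd U)"
      using 0 by (auto simp: case_prod_beta)
    ultimately show ?thesis unfolding skew_shape_def m by (simp add: sorted_wrt_map)
  qed
  have rows: "rows_weak U \<longleftrightarrow> sorted_wrt (\<lambda>X Y. \<forall>i. i < length X \<and> i < length Y \<longrightarrow> X ! i \<le> Y ! i) (map snd U)"
    unfolding rows_weak_def sorted_wrt_map
    by (intro iffI; erule sorted_wrt_mono_rel[rotated]) (use 0 in \<open>auto simp: case_prod_beta\<close>)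
  have "sorted_wrt rowle (map snd U) \<longleftrightarrow> skew_shape U \<and> rows_weak U"
    unfolding shape rows by (auto simp: sorted_wrt_iff_nth_less rowle_def) (meson less_le_trans)
  then show ?thesis by (auto simp: semistandard_def case_prod_beta)
qed

lemma straight_split:
  assumes "\<forall>C \<in> set (map snd U). admissible n C"
  shows "map snd (split_tableau n U) = concat (map (\<lambda>C. [lcol n C, rcol n C]) (map snd U))"
  using assms by (induction U) (auto simp: split_tableau_def right_left_col)

lemma rev_split: "rev (concat (map (\<lambda>C. [lcol n C, rcol n C]) Cs)) = dbl n (rev Cs)"
  by (induction Cs) (simp_all add: dbl_def)

lemma successively_dbl:
  "sorted_wrt (\<lambda>X Y. rowle Y X) (dbl n Ds) \<Longrightarrow> successively (\<lambda>D E. rowle (rcol n E) (lcol n D)) Ds"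
  by (induction Ds rule: induct_list012) auto

text \<open>The columns of the split tableau have no pairs, so splitting leaves them unchanged and
  its row conditions say that the doubled list satisfies \<open>kn\<close> again. This supplies the
  highest weight of the doubled word.\<close>

lemma kn_of_KN:
  assumes "KN_skew n U" "\<forall>(m, C) \<in> set U. m = 0"
  defines "Ds \<equiv> rev (map snd U)"
  shows "kn n Ds" "kn n (dbl n Ds)"
proof -
  have a: "\<forall>C \<in> set (map snd U). admissible n C" using assms(1) by (auto simp: KN_skew_def)
  then have aD: "\<forall>D \<in> set Ds. admissible n D" by (simp add: Ds_def)
  have z: "\<forall>(m, C) \<in> set (split_tableau n U). m = 0"
    using assms(2) by (auto simp: split_tableau_def)
  have "sorted_wrt rowle (map snd (split_tableau n U))"
    using assms(1) semistandard_straight[OF z] by (simp add: KN_skew_def)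
  then have "sorted_wrt (\<lambda>X Y. rowle Y X) (rev (map snd (split_tableau n U)))"
    by (simp add: sorted_wrt_rev)
  then have s: "sorted_wrt (\<lambda>X Y. rowle Y X) (dbl n Ds)"
    unfolding straight_split[OF a] rev_split Ds_def .
  show "kn n Ds" using successively_dbl[OF s] aD by (simp add: kn_def)
  have p: "column n X \<and> pair_free (set X)" if X: "X \<in> set (dbl n Ds)" for X
  proof -
    obtain D where D: "D \<in> set Ds" "X = rcol n D \<or> X = lcol n D" using X by (auto simp: dbl_def)
    then have "column n D" using aD admissible_column by blast
    then show ?thesis using D(2) rcol_column lcol_column pair_free_rset pair_free_lset by auto
  qed
  have "successively (\<lambda>X Y. rowle Y X) (dbl n Ds)"
    using s by (rule successively_if_sorted_wrt)
  then have "successively (\<lambda>X Y. rowle (rcol n Y) (lcol n X)) (dbl n Ds)"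
    by (rule successively_mono) (use p pair_free_split in auto)
  then show "kn n (dbl n Ds)" using p pair_free_split by (auto simp: kn_def)
qed

text \<open>If \<open>Y ! p < X ! p\<close>, the first \<open>p + 1\<close> entries of
  \<open>Y\<close> would all be among the first \<open>p\<close> entries of
  \<open>X\<close>.\<close>

lemma rowle_subset:
  assumes X: "column n X" and Y: "column n Y" and sub: "set Y \<subseteq> set X"
  shows "rowle X Y"
  unfolding rowle_def
proof (intro conjI allI impI)
  have d: "distinct X" "distinct Y" using X Y column_distinct by auto
  have "card (set Y) \<le> card (set X)" using sub by (intro card_mono) auto
  then show len: "length Y \<le> length X" using d by (simp add: distinct_card)
  fix p assume p: "p < length Y"
  show "X ! p \<le> Y ! p"
  proof (rule ccontr)
    assume "\<not> X ! p \<le> Y ! p"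
    then have lt: "Y ! p < X ! p" by simp
    have "set (take (Suc p) Y) \<subseteq> set (take p X)"
    proof
      fix y assume "y \<in> set (take (Suc p) Y)"
      then obtain k where k: "k \<le> p" "y = Y ! k" using p by (auto simp: in_set_conv_nth less_Suc_eq_le)
      have "y \<le> Y ! p"
        using columnD(2)[OF Y] k p by (cases "k = p") (auto simp: sorted_wrt_iff_nth_less intro!: less_imp_le)
      then have "y < X ! p" using lt by simp
      moreover have "y \<in> set X" using sub k p nth_mem[of k Y] by auto
      then obtain q where q: "q < length X" "y = X ! q" by (auto simp: in_set_conv_nth)
      ultimately have "q < p"
        using columnD(2)[OF X] p len by (metis leD leI le_neq_implies_less less_imp_le order.strict_trans2 sorted_wrt_iff_nth_less)
      then show "y \<in> set (take p X)" using q p len by (auto simp: in_set_conv_nth)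
    qed
    then have "card (set (take (Suc p) Y)) \<le> card (set (take p X))" by (intro card_mono) auto
    then show False using d p len by (simp add: distinct_card)
  qed
qed

lemma sorted_wrt_double:
  "sorted_wrt P xs \<Longrightarrow> (\<And>x. x \<in> set xs \<Longrightarrow> P x x) \<Longrightarrow> sorted_wrt P (concat (map (\<lambda>x. [x, x]) xs))"
  by (induction xs) auto

theorem theorem4p7:
  fixes n :: nat and lam :: "nat list" and T :: skew_tableau and C :: "nat \<Rightarrow> word"
  assumes "n \<ge> 1"
    and "is_partition lam"
    and "T \<in> KN lam n"
    and "\<And>l. l \<in> set (col_lengths T) \<Longrightarrow> frank_right_column n T l (C l)"
  shows "key_tableau lam n (K_plus n C T)"
proof -
  define Ds where "Ds = rev (map snd T)"
  define key where "key l = rcol n (C l)" for l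
  have T: "KN_skew n T" "\<forall>(m, D) \<in> set T. m = 0" "col_lengths T = conjugate lam"
    using assms(3) by (auto simp: KN_def)
  note kn = kn_of_KN[OF T(1,2), folded Ds_def]
  have cl: "col_lengths U = map length (map snd U)" for U
    by (auto simp: col_lengths_def)
  have lens: "map length Ds = rev (col_lengths T)"
    by (simp add: Ds_def cl rev_map)
  have lD: "\<forall>D \<in> set Ds. length (lcol n D) = length D"
    using kn(1) length_lcol by (auto simp: kn_def)
  \<comment> \<open>Reading goes from right to left, so the rightmost column of \<open>S\<close> is
    the head of the list of columns and \<open>Xs\<close> are the others.\<close>
  have fr: "admissible n (C l) \<and> length (C l) = l \<and>
    (\<exists>Xs. (\<forall>E \<in> set (C l # Xs). admissible n E) \<and> knuth n (concat (C l # Xs)) (concat Ds)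
      \<and> mset (map length (C l # Xs)) = mset (map length Ds))" if l: "l \<in> set (col_lengths T)" for l
  proof -
    obtain S where S: "KN_skew n S" "\<And>k. count (mset (col_lengths S)) k = count (mset (col_lengths T)) k"
      "length (snd (last S)) = l" "rectifies_to n S T" "C l = snd (last S)"
      using assms(4)[OF l] by (auto simp: frank_right_column_def)
    have ms: "mset (col_lengths S) = mset (col_lengths T)" using S(2) by (rule multiset_eqI)
    then have "S \<noteq> []" using l by (auto simp: col_lengths_def)
    then have rS: "rev (map snd S) = C l # rev (map snd (butlast S))"
    proof -
      have "map snd S = map snd (butlast S @ [last S])" using \<open>S \<noteq> []\<close> by simp
      then show ?thesis using S(5) by (simp del: append_butlast_last_id)
    qed
    have a: "\<forall>E \<in> set (rev (map snd S)). admissible n E" using S(1) by (auto simp: KN_skew_def)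
    have k: "knuth n (concat (rev (map snd S))) (concat Ds)"
      using S(4) by (simp add: rectifies_to_def is_P_def column_reading_def Ds_def)
    have m: "mset (map length (rev (map snd S))) = mset (map length Ds)"
      using ms unfolding lens cl by (simp add: multiset.map_comp)
    have "admissible n (C l)" "length (C l) = l" using a S(3,5) unfolding rS by simp_all
    then show ?thesis using a k m unfolding rS by blast
  qed
  have key: "column n (key l)" "pair_free (set (key l))" "length (key l) = l"
    if "l \<in> set (col_lengths T)" for l
    using fr[OF that] rcol_column[of n "C l"] length_rcol[of n "C l"] pair_free_rset admissible_column
    by (auto simp: key_def)
  have nested: "set (key l') \<subseteq> set (key l)"
    if l: "l \<in> set (col_lengths T)" "l' \<in> set (col_lengths T)" "l' \<le> l" for l l'
  proof (cases "l' = l")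
    case False
    then show ?thesis
      using frank_keys_nested[OF kn lD] fr[OF l(1)] fr[OF l(2)] l(3) unfolding key_def
      by (metis le_neq_implies_less)
  qed simp
  have sl: "sorted_wrt (\<lambda>l l'. l' \<le> l) (col_lengths T)"
  proof -
    have "map (\<lambda>(m, D). m + length D) T = col_lengths T"
      using T(2) by (auto simp: col_lengths_def)
    then show ?thesis using T(1) by (auto simp: KN_skew_def semistandard_def skew_shape_def)
  qed
  define K where "K = K_plus n C T"
  have sK: "map snd K = map key (col_lengths T)"
    unfolding K_def K_plus_def col_lengths_def
    using fr right_left_col(1) by (auto simp: key_def col_lengths_def case_prod_beta)
  have zK: "\<forall>(m, D) \<in> set K. m = 0" using T(2) by (auto simp: K_def K_plus_def)
  have cK: "column n D \<and> pair_free (set D)" if "D \<in> set (map snd K)" for D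
    using that key unfolding sK by auto
  have rK: "sorted_wrt rowle (map snd K)"
    unfolding sK sorted_wrt_map
    by (rule sorted_wrt_mono_rel[OF _ sl]) (intro rowle_subset[of n] key nested)
  have aK: "\<forall>D \<in> set (map snd K). admissible n D" using cK pair_free_split(3) by blast
  have spl: "map snd (split_tableau n K) = concat (map (\<lambda>D. [D, D]) (map snd K))"
    unfolding straight_split[OF aK]
    by (intro arg_cong[of _ _ concat] map_cong refl) (use cK pair_free_split in auto)
  have zs: "\<forall>(m, D) \<in> set (split_tableau n K). m = 0" using zK by (auto simp: split_tableau_def)
  have "semistandard n (split_tableau n K)"
    unfolding semistandard_straight[OF zs] spl
  proof
    show "sorted_wrt rowle (concat (map (\<lambda>D. [D, D]) (map snd K)))"
      by (rule sorted_wrt_double[OF rK]) (simp add: rowle_def)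
  qed (use cK in auto)
  then have KK: "KN_skew n K"
    using semistandard_straight[OF zK] rK cK aK by (auto simp: KN_skew_def)
  have "col_lengths K = map length (map snd K)"
    by (simp add: col_lengths_def case_prod_beta)
  also have "\<dots> = col_lengths T"
    unfolding sK using key(3) by (simp add: map_idI)
  finally have "K \<in> KN lam n" using KK zK T(3) by (simp add: KN_def)
  moreover have "set (snd (K ! Suc j)) \<subseteq> set (snd (K ! j))" if j: "Suc j < length K" for j
  proof -
    have len: "length K = length (col_lengths T)" using arg_cong[OF sK, of length] by simp
    have "snd (K ! k) = key (col_lengths T ! k)" if "k < length K" for k
      using arg_cong[OF sK, of "\<lambda>xs. xs ! k"] that len by simp
    moreover have "col_lengths T ! Suc j \<le> col_lengths T ! j"
      using sl j len by (auto simp: sorted_wrt_iff_nth_less)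
    ultimately show ?thesis using nested j len by simp
  qed
  moreover have "\<not> (Pos i \<in> set (column_reading K) \<and> Bar i \<in> set (column_reading K))" for i
  proof
    assume "Pos i \<in> set (column_reading K) \<and> Bar i \<in> set (column_reading K)"
    then obtain D D' where D: "D \<in> set (map snd K)" "Pos i \<in> set D" and D': "D' \<in> set (map snd K)" "Bar i \<in> set D'"
      by (auto simp: column_reading_def)
    obtain l l' where l: "l \<in> set (col_lengths T)" "D = key l" "l' \<in> set (col_lengths T)" "D' = key l'"
      using D(1) D'(1) unfolding sK by auto
    \<comment> \<open>Since the columns form a chain, a letter and its bar in two columns would both
      lie in the larger one, which has no pairs.\<close>
    have "set (key l) \<subseteq> set (key l') \<or> set (key l') \<subseteq> set (key l)"
      using nested[of l l'] nested[of l' l] l by (cases "l \<le> l'") auto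
    then show False
      using key(2)[OF l(1)] key(2)[OF l(3)] D(2) D'(2) l by (auto simp: pair_free_def)
  qed
  ultimately show ?thesis using assms(2) by (simp add: key_tableau_def K_def)
qed

end
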